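(* Let $d\ge 2$, $Q>0$ and $m>0$. For every $\alpha\in(0,d-1)$, $$\inf\left\{\mathcal F_{\alpha,Q}(E):\ E\subset\mathbb R^d \text{ compact},\ |E|=m\right\}=\left(\frac{m}{\omega_d}\right)^{\frac{d-1}{d}}P(B).$$
   Context: $|E|$ is Lebesgue measure in $\mathbb R^d$; $B$ is the open unit ball of $\mathbb R^d$ and $\omega_d=|B|$. $P(E)$ is the perimeter of $E$ in $\mathbb R^d$ in the sense of De Giorgi (total variation of the distributional gradient of $\chi_E$), which equals $\mathcal H^{d-1}(\partial E)$ when $E$ has smooth boundary. For $\alpha\in(0,d)$ and $E$ compact, the Riesz potential energy is $$\mathcal I_\alpha(E)=\inf\left\{\int_{\mathbb R^d\times\mathbb R^d}\frac{d\mu(x)\,d\mu(y)}{|x-y|^\alpha}:\ \mu \text{ non-negative Borel measure on }\mathbb R^d,\ \mu(E)=1\right\}.$$ For $Q>0$, $\mathcal F_{\alpha,Q}(E)=P(E)+Q^2\,\mathcal I_\alpha(E)$. *)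

theory Defs
  imports "HOL-Analysis.Analysis"
begin

definition C1c_fields :: "('a::euclidean_space \<Rightarrow> 'a) set" where
  "C1c_fields =
    {\<phi>. (\<exists>\<phi>'::'a \<Rightarrow> 'a \<Rightarrow>\<^sub>L 'a.
            (\<forall>x. (\<phi> has_derivative blinfun_apply (\<phi>' x)) (at x)) \<and> continuous_on UNIV \<phi>') \<and>
         compact (closure {x. \<phi> x \<noteq> 0})}"

definition divergence :: "('a::euclidean_space \<Rightarrow> 'a) \<Rightarrow> 'a \<Rightarrow> real" where
  "divergence \<phi> x = (\<Sum>b\<in>Basis. frechet_derivative \<phi> (at x) b \<bullet> b)"

text \<open>
  Total variation of the distributional gradient of a locally integrable \<open>u\<close>, by duality with
  compactly supported \<open>C\<^sup>1\<close> vector fields. The coercion \<open>ennreal\<close> sends negative integrals to 0,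
  which does not affect the supremum because \<open>\<phi> = 0\<close> is admissible.
\<close>
definition total_variation :: "('a::euclidean_space \<Rightarrow> real) \<Rightarrow> ennreal" where
  "total_variation u =
    (SUP \<phi>\<in>{\<phi> \<in> C1c_fields. \<forall>x. norm (\<phi> x) \<le> 1}.
       ennreal (integral\<^sup>L lebesgue (\<lambda>x. u x * divergence \<phi> x)))"

text \<open>The De Giorgi perimeter, meaningful for Lebesgue measurable sets.\<close>
definition perimeter :: "'a::euclidean_space set \<Rightarrow> ennreal" where
  "perimeter E = total_variation (indicator E)"

text \<open>The division is taken in \<^typ>\<open>ennreal\<close>, so that the kernel is infinite on the diagonal.\<close>
definition riesz_kernel :: "real \<Rightarrow> 'a::euclidean_space \<Rightarrow> 'a \<Rightarrow> ennreal" where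
  "riesz_kernel \<alpha> x y = 1 / ennreal (norm (x - y) powr \<alpha>)"

lemma riesz_kernel_diagonal: "riesz_kernel \<alpha> x x = \<infinity>"
  by (simp add: riesz_kernel_def ennreal_divide_eq_top_iff infinity_ennreal_def)

lemma riesz_kernel_off_diagonal:
  "x \<noteq> y \<Longrightarrow> riesz_kernel \<alpha> x y = ennreal (1 / norm (x - y) powr \<alpha>)"
  using divide_ennreal[of 1 "norm (x - y) powr \<alpha>"] by (simp add: riesz_kernel_def)

text \<open>
  All Borel measures with \<open>\<mu>(E) = 1\<close> compete, including those that are not \<open>\<sigma>\<close>-finite, for which
  the product measure of the library may degenerate; hence the double integral is iterated.
  For \<open>\<sigma>\<close>-finite \<open>\<mu>\<close> both readings agree by Tonelli's theorem.
\<close>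
definition riesz_energy :: "real \<Rightarrow> 'a::euclidean_space set \<Rightarrow> ennreal" where
  "riesz_energy \<alpha> E =
    (INF \<mu>\<in>{\<mu>. sets \<mu> = sets borel \<and> emeasure \<mu> E = 1}.
       \<integral>\<^sup>+ x. (\<integral>\<^sup>+ y. riesz_kernel \<alpha> x y \<partial>\<mu>) \<partial>\<mu>)"

definition charged_energy :: "real \<Rightarrow> real \<Rightarrow> 'a::euclidean_space set \<Rightarrow> ennreal" where
  "charged_energy \<alpha> Q E = perimeter E + ennreal (Q\<^sup>2) * riesz_energy \<alpha> E"

end

theory Submission imports Defs "HOL-Probability.Distribution_Functions" begin

text \<open>
  Lower bound: the Riesz term is nonnegative, so the isoperimetric inequality for the De Giorgi
  perimeter suffices. The Brunn--Minkowski inequality (Hadwiger--Ohmann: finite unions of boxes, cut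
  by hyperplanes in equal proportions) gives |A + h B| >= |A| + d h |B|^(1/d) |A|^(1-1/d). Let u be a
  mollified indicator of E. For small h, {u > t} + h B is contained in {u + h (|grad u| + delta) > t},
  which bounds the integral of |grad u| from below without the coarea formula. Testing the perimeter
  of E with the mollification of - grad u / |grad u| bounds the same integral from above by P(E).

  Upper bound: take a ball carrying almost all the volume and N balls of radius N^(-beta) far away
  from each other, with 1/(d-1) < beta < 1/alpha. The small balls have total perimeter of order
  N^(1 - beta (d-1)), and spreading the charge uniformly over them costs energy of order
  N^(alpha beta - 1); both tend to 0.
\<close>

section \<open>The Brunn--Minkowski inequality\<close>

text \<open>The lower bound concerns arbitrary compact sets and a perimeter defined by duality, so
  nothing is known about the boundary; volume growth of A + h B is the only geometric input. It is
  applied to open superlevel sets, whose sums with a ball are open and hence measurable. Bernoulli's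
  inequality makes the growth estimate valid for every h > 0, linear in h, so that h later cancels
  and no limit in h has to be taken. The fields that test the perimeter need only be C^1, so a
  mollifier with merely Lipschitz gradient is enough. The number P(B) on the right is computed too:
  the divergence theorem on balls, in the form of a limit of thin annuli, gives P(B) <= d |B|, and
  the isoperimetric inequality applied to B gives the converse. In the upper bound the small balls
  carry the whole charge and the large ball none. The window for beta is nonempty exactly because
  alpha < d - 1, and since beta > 1/(d-1) the volume N^(1 - beta d) of the small balls also tends to
  0; the radius of the large ball is adjusted so that the volume is exactly m.\<close>

lemma box_add_subset:
  fixes a b c d :: "'a::euclidean_space"
  assumes ab: "\<And>i. i \<in> Basis \<Longrightarrow> a \<bullet> i < b \<bullet> i" and cd: "\<And>i. i \<in> Basis \<Longrightarrow> c \<bullet> i < d \<bullet> i"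
  shows "box (a + c) (b + d) \<subseteq> box a b + box c d"
proof
  fix z assume z: "z \<in> box (a + c) (b + d)"
  define p where "p i = b \<bullet> i - a \<bullet> i" for i
  define q where "q i = d \<bullet> i - c \<bullet> i" for i
  \<comment> \<open>The relative position of \<open>z\<close> in side \<open>i\<close> of the large
    box; the same relative position in each of the two small boxes gives the summands
    \<open>x\<close> and \<open>y\<close>.\<close>
  define t where "t i = (z \<bullet> i - a \<bullet> i - c \<bullet> i) / (p i + q i)" for i
  have pq: "p i > 0" "q i > 0" if "i \<in> Basis" for i
    using ab cd that by (auto simp: p_def q_def)
  have t: "0 < t i" "t i < 1" if "i \<in> Basis" for i
    using z pq[OF that] that by (auto simp: t_def mem_box inner_add_left p_def q_def field_simps)
  have tz: "t i * (p i + q i) = z \<bullet> i - a \<bullet> i - c \<bullet> i" if "i \<in> Basis" for i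
    using pq[OF that] by (simp add: t_def)
  define x where "x = (\<Sum>i\<in>Basis. (a \<bullet> i + t i * p i) *\<^sub>R i)"
  define y where "y = (\<Sum>i\<in>Basis. (c \<bullet> i + t i * q i) *\<^sub>R i)"
  have "x \<in> box a b"
    unfolding mem_box
  proof
    fix i :: 'a assume i: "i \<in> Basis"
    have "0 < t i * p i" "t i * p i < 1 * p i"
      using pq[OF i] t[OF i] by (auto intro: mult_strict_right_mono)
    then show "a \<bullet> i < x \<bullet> i \<and> x \<bullet> i < b \<bullet> i"
      using i by (simp add: x_def p_def)
  qed
  moreover have "y \<in> box c d"
    unfolding mem_box
  proof
    fix i :: 'a assume i: "i \<in> Basis"
    have "0 < t i * q i" "t i * q i < 1 * q i"
      using pq[OF i] t[OF i] by (auto intro: mult_strict_right_mono)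
    then show "c \<bullet> i < y \<bullet> i \<and> y \<bullet> i < d \<bullet> i"
      using i by (simp add: y_def q_def)
  qed
  moreover have "z = x + y"
  proof (rule euclidean_eqI)
    fix i :: 'a assume i: "i \<in> Basis"
    show "z \<bullet> i = (x + y) \<bullet> i"
    proof -
      have "x \<bullet> i = a \<bullet> i + t i * p i" "y \<bullet> i = c \<bullet> i + t i * q i"
        using i by (simp_all add: x_def y_def)
      then show ?thesis using tz[OF i] by (simp add: inner_add_left algebra_simps)
    qed
  qed
  ultimately show "z \<in> box a b + box c d" by (auto simp: set_plus_def)
qed

text \<open>Brunn--Minkowski for two boxes with side lengths \<open>p\<close> and \<open>q\<close>.
  After division by the right side, the arithmetic-geometric mean inequality applies to the ratios p
  i / (p i + q i) and to q i / (p i + q i); the two arithmetic means add up to 1.\<close>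

lemma root_prod_add_le:
  fixes p q :: "'b \<Rightarrow> real"
  assumes S: "finite S" "S \<noteq> {}" and p: "\<And>i. i \<in> S \<Longrightarrow> 0 < p i" and q: "\<And>i. i \<in> S \<Longrightarrow> 0 < q i"
  shows "root (card S) (prod p S) + root (card S) (prod q S) \<le> root (card S) (\<Prod>i\<in>S. p i + q i)"
proof -
  define n where "n = card S"
  have n: "n > 0" using S by (simp add: n_def card_gt_0_iff)
  have pq: "p i + q i > 0" if "i \<in> S" for i using p[OF that] q[OF that] by simp
  define D where "D = (\<Prod>i\<in>S. p i + q i)"
  have D: "D > 0" unfolding D_def using pq by (intro prod_pos) auto
  have R: "root n (prod r S) \<le> root n D * (\<Sum>i\<in>S. r i / (p i + q i) / n)"
    if r: "\<And>i. i \<in> S \<Longrightarrow> 0 < r i" for r :: "'b \<Rightarrow> real"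
  proof -
    have "(\<Prod>i\<in>S. r i / (p i + q i)) powr (1 / n) \<le> (\<Sum>i\<in>S. r i / (p i + q i) / n)"
      unfolding n_def
    proof (rule arith_geom_mean[OF S])
      show "0 \<le> r i / (p i + q i)" if "i \<in> S" for i
        using r[OF that] pq[OF that] by simp
    qed
    moreover have "(\<Prod>i\<in>S. r i / (p i + q i)) powr (1 / n) = root n (prod r S) / root n D"
    proof -
      have "(\<Prod>i\<in>S. r i / (p i + q i)) = prod r S / D"
        by (simp add: D_def prod_dividef)
      moreover have "prod r S > 0" using r by (intro prod_pos) auto
      ultimately show ?thesis using n D
        by (simp add: root_powr_inverse powr_divide)
    qed
    ultimately have "root n (prod r S) / root n D \<le> (\<Sum>i\<in>S. r i / (p i + q i) / n)" by simp
    then show ?thesis using D n by (simp add: pos_divide_le_eq mult.commute)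
  qed
  have "root n (prod p S) + root n (prod q S)
      \<le> root n D * (\<Sum>i\<in>S. p i / (p i + q i) / n) + root n D * (\<Sum>i\<in>S. q i / (p i + q i) / n)"
    using p q by (intro add_mono R)
  also have "\<dots> = root n D * (\<Sum>i\<in>S. p i / (p i + q i) / n + q i / (p i + q i) / n)"
    by (simp add: sum.distrib algebra_simps)
  also have "(\<Sum>i\<in>S. p i / (p i + q i) / n + q i / (p i + q i) / n) = (\<Sum>i\<in>S. 1 / n)"
    using pq by (intro sum.cong refl) (simp add: add_divide_distrib[symmetric] less_imp_neq[symmetric])
  also have "\<dots> = 1" using n by (simp add: n_def)
  finally show ?thesis by (simp add: n_def D_def)
qed

lemma open_set_plus:
  fixes A B :: "'a::real_normed_vector set"
  assumes "open A"
  shows "open (A + B)"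
proof -
  have "A + B = (\<Union>b\<in>B. (\<lambda>a. a + b) ` A)" by (auto simp: set_plus_def)
  then show ?thesis using assms by (auto intro!: open_translation_subtract[where a="-b" for b, simplified])
qed

lemma bounded_set_plus:
  fixes A B :: "'a::real_normed_vector set"
  assumes "bounded A" "bounded B"
  shows "bounded (A + B)"
proof -
  have "A + B = (\<Union>x\<in>A. \<Union>y\<in>B. {x + y})" by (auto simp: set_plus_def)
  then show ?thesis using bounded_sums[OF assms] by simp
qed

lemma measure_lborel_mono_bounded:
  fixes A B :: "'a::euclidean_space set"
  assumes "A \<subseteq> B" "A \<in> sets borel" "B \<in> sets borel" "bounded B"
  shows "measure lborel A \<le> measure lborel B"
  using assms emeasure_bounded_finite[of B] by (intro measure_mono_fmeasurable) (auto intro: fmeasurableI)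

lemma measure_open_pos:
  fixes A :: "'a::euclidean_space set"
  assumes "open A" "bounded A" "A \<noteq> {}"
  shows "measure lborel A > 0"
proof -
  have "emeasure lborel A \<noteq> 0"
    using assms open_not_negligible[of A] by (auto simp: negligible_iff_emeasure0)
  then show ?thesis
    using assms emeasure_bounded_finite[of A]
    by (simp add: measure_def enn2real_positive_iff zero_less_iff_neq_zero)
qed

section \<open>Finite families of disjoint boxes\<close>

text \<open>With open boxes disjointness is literal, a half-space cut of a box is again an open box,
  and sums of the unions are open. Empty members are excluded so that the cardinality can serve as
  induction measure.\<close>

definition disjoint_boxes :: "'a::euclidean_space set set \<Rightarrow> bool" where
  "disjoint_boxes D \<longleftrightarrow> finite D \<and> (\<forall>K\<in>D. K \<noteq> {} \<and> (\<exists>a b. K = box a b)) \<and> disjoint D"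

lemma disjoint_boxes_open_bounded:
  assumes "disjoint_boxes D"
  shows "open (\<Union>D)" "bounded (\<Union>D)"
proof -
  show "open (\<Union>D)" using assms open_box unfolding disjoint_boxes_def by (metis open_Union)
  show "bounded (\<Union>D)" using assms bounded_box unfolding disjoint_boxes_def by (metis bounded_Union)
qed

lemma disjoint_boxes_measure_pos:
  fixes D :: "'a::euclidean_space set set"
  assumes "disjoint_boxes D" "D \<noteq> {}"
  shows "measure lborel (\<Union>D) > 0"
proof (rule measure_open_pos)
  show "\<Union>D \<noteq> {}" using assms by (auto simp: disjoint_boxes_def)
qed (use disjoint_boxes_open_bounded assms in auto)

text \<open>Empty pieces are discarded, so cutting never increases the number of boxes on either
  side, and a box lying wholly on one side lowers the number on the other. The two strict
  inequalities drive the induction in \<open>brunn_minkowski_boxes\<close>.\<close>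

lemma disjoint_boxes_split:
  fixes D :: "'a::euclidean_space set set" and c :: real
  assumes D: "disjoint_boxes D" and i: "i \<in> Basis"
  defines "L \<equiv> (\<lambda>K. K \<inter> {x. x \<bullet> i < c}) ` D - {{}}"
      and "R \<equiv> (\<lambda>K. K \<inter> {x. c < x \<bullet> i}) ` D - {{}}"
  shows "disjoint_boxes L" "disjoint_boxes R" "card L \<le> card D" "card R \<le> card D"
    "\<Union>L = \<Union>D \<inter> {x. x \<bullet> i < c}" "\<Union>R = \<Union>D \<inter> {x. c < x \<bullet> i}"
    "(\<exists>K\<in>D. K \<inter> {x. x \<bullet> i < c} = {}) \<Longrightarrow> card L < card D"
    "(\<exists>K\<in>D. K \<inter> {x. c < x \<bullet> i} = {}) \<Longrightarrow> card R < card D"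
proof -
  have fin: "finite D" and bx: "\<And>K. K \<in> D \<Longrightarrow> \<exists>a b. K = box a b" and dj: "disjoint D"
    using D by (auto simp: disjoint_boxes_def)
  have lt: "\<exists>a' b'. box a b \<inter> {x. x \<bullet> i < c} = box a' (b'::'a)" for a b
  proof (intro exI)
    show "box a b \<inter> {x. x \<bullet> i < c} = box a (\<Sum>j\<in>Basis. (if j = i then min (b \<bullet> i) c else b \<bullet> j) *\<^sub>R j)"
      using i by (fastforce simp: mem_box split: if_splits)
  qed
  have gt: "\<exists>a' b'. box a b \<inter> {x. c < x \<bullet> i} = box a' (b'::'a)" for a b
  proof (intro exI)
    show "box a b \<inter> {x. c < x \<bullet> i} = box (\<Sum>j\<in>Basis. (if j = i then max (a \<bullet> i) c else a \<bullet> j) *\<^sub>R j) b"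
      using i by (fastforce simp: mem_box split: if_splits)
  qed
  have card: "card ((\<lambda>K. K \<inter> H) ` D - {{}}) \<le> card D" for H
    by (meson card_image_le card_mono fin finite_imageI Diff_subset le_trans)
  have card2: "card ((\<lambda>K. K \<inter> H) ` D - {{}}) < card D" if "\<exists>K\<in>D. K \<inter> H = {}" for H
  proof -
    from that obtain K where K: "K \<in> D" "K \<inter> H = {}" by blast
    then have "(\<lambda>K. K \<inter> H) ` D - {{}} \<subseteq> (\<lambda>K. K \<inter> H) ` (D - {K})" by auto
    then have "card ((\<lambda>K. K \<inter> H) ` D - {{}}) \<le> card (D - {K})"
      by (meson card_image_le card_mono fin finite_Diff finite_imageI le_trans)
    also have "\<dots> < card D" using K fin by (intro card_Diff1_less)
    finally show ?thesis .
  qed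
  have dj2: "disjoint ((\<lambda>K. K \<inter> H) ` D - {{}})" for H
    unfolding disjoint_def
  proof (intro ballI impI)
    fix X Y assume "X \<in> (\<lambda>K. K \<inter> H) ` D - {{}}" "Y \<in> (\<lambda>K. K \<inter> H) ` D - {{}}" "X \<noteq> Y"
    then obtain K K' where K: "K \<in> D" "K' \<in> D" "X = K \<inter> H" "Y = K' \<inter> H" by blast
    with \<open>X \<noteq> Y\<close> have "K \<noteq> K'" by blast
    then have "K \<inter> K' = {}" using K dj by (auto simp: disjoint_def)
    then show "X \<inter> Y = {}" using K by blast
  qed
  have "\<exists>a b. X = box a b" if X: "X \<in> L" for X
  proof -
    obtain K where K: "K \<in> D" "X = K \<inter> {x. x \<bullet> i < c}" using X by (auto simp: L_def)
    then show ?thesis using bx[OF K(1)] lt by auto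
  qed
  then show "disjoint_boxes L" unfolding disjoint_boxes_def using fin dj2 by (simp add: L_def)
  have "\<exists>a b. X = box a b" if X: "X \<in> R" for X
  proof -
    obtain K where K: "K \<in> D" "X = K \<inter> {x. c < x \<bullet> i}" using X by (auto simp: R_def)
    then show ?thesis using bx[OF K(1)] gt by auto
  qed
  then show "disjoint_boxes R" unfolding disjoint_boxes_def using fin dj2 by (simp add: R_def)
  show "card L \<le> card D" "card R \<le> card D" unfolding L_def R_def by (rule card)+
  show "\<Union>L = \<Union>D \<inter> {x. x \<bullet> i < c}" "\<Union>R = \<Union>D \<inter> {x. c < x \<bullet> i}"
    unfolding L_def R_def by auto
  show "card L < card D" if "\<exists>K\<in>D. K \<inter> {x. x \<bullet> i < c} = {}" unfolding L_def by (rule card2) fact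
  show "card R < card D" if "\<exists>K\<in>D. K \<inter> {x. c < x \<bullet> i} = {}" unfolding R_def by (rule card2) fact
qed

lemma null_hyperplane:
  fixes i :: "'a::euclidean_space"
  assumes "i \<in> Basis" shows "{x. x \<bullet> i = c} \<in> null_sets lborel"
  using negligible_standard_hyperplane[OF assms, of c]
  by (subst null_sets_completion_iff[symmetric]) (auto simp: negligible_iff_null_sets)

lemma measure_split_hyperplane:
  fixes A :: "'a::euclidean_space set"
  assumes A: "A \<in> sets borel" "bounded A" and i: "i \<in> Basis"
  shows "measure lborel A = measure lborel (A \<inter> {x. x \<bullet> i < c}) + measure lborel (A \<inter> {x. c < x \<bullet> i})"
proof -
  have fm: "A \<inter> H \<in> fmeasurable lborel" if "H \<in> sets borel" for H
    using A that emeasure_bounded_finite[of "A \<inter> H"] by (intro fmeasurableI) (auto intro: bounded_subset)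
  let ?L = "A \<inter> {x. x \<bullet> i < c}" and ?R = "A \<inter> {x. c < x \<bullet> i}"
  have "measure lborel A = measure lborel ((?L \<union> ?R) \<union> A \<inter> {x. x \<bullet> i = c})"
    by (rule arg_cong[where f="measure lborel"]) auto
  also have "\<dots> = measure lborel (?L \<union> ?R)"
  proof (rule measure_Un_null_set)
    show "?L \<union> ?R \<in> sets lborel" using A by auto
    show "A \<inter> {x. x \<bullet> i = c} \<in> null_sets lborel"
      using A null_hyperplane[OF i, of c] by (intro null_set_Int1) auto
  qed
  also have "\<dots> = measure lborel ?L + measure lborel ?R"
    by (rule measure_Un2[THEN trans]) (auto intro!: fm arg_cong[where f="measure lborel"])
  finally show ?thesis .
qed

text \<open>Intermediate value theorem for the distribution function of the coordinate
  \<open>x \<bullet> i\<close> under Lebesgue measure restricted to \<open>B\<close>. It is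
  continuous because hyperplanes are null, so the distribution has no atoms.\<close>

lemma measure_halfspace_split:
  fixes B :: "'a::euclidean_space set"
  assumes B: "B \<in> sets borel" "bounded B" and i: "i \<in> Basis"
    and y: "0 < y" "y < measure lborel B"
  shows "\<exists>c. measure lborel (B \<inter> {x. x \<bullet> i < c}) = y"
proof -
  define M where "M = distr (restrict_space lborel B) borel (\<lambda>x. x \<bullet> i)"
  have Bs: "B \<in> sets lborel" using B by simp
  have me[measurable]: "(\<lambda>x. x \<bullet> i) \<in> borel_measurable (restrict_space lborel B)"
    by (rule measurable_restrict_space1) auto
  have em: "emeasure M S = emeasure lborel (B \<inter> {x. x \<bullet> i \<in> S})" if "S \<in> sets borel" for S
  proof -
    have "emeasure M S = emeasure (restrict_space lborel B) ((\<lambda>x. x \<bullet> i) -` S \<inter> B)"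
      unfolding M_def using that by (subst emeasure_distr) (auto simp: space_restrict_space)
    also have "\<dots> = emeasure lborel ((\<lambda>x. x \<bullet> i) -` S \<inter> B)"
      using Bs by (subst emeasure_restrict_space) auto
    finally show ?thesis by (simp add: vimage_def Int_commute)
  qed
  have sM: "sets M = sets borel" "space M = UNIV" by (auto simp: M_def)
  have "finite_measure M"
    using em[of UNIV] emeasure_bounded_finite[OF B(2)] sM
    by (intro finite_measureI) (auto simp: top.not_eq_extremum)
  then interpret M: finite_borel_measure M
    using sM by (simp add: finite_borel_measure_def finite_borel_measure_axioms_def)
  have mM: "measure M S = measure lborel (B \<inter> {x. x \<bullet> i \<in> S})" if "S \<in> sets borel" for S
    using em[OF that] by (simp add: measure_def)
  have cont: "isCont (cdf M) x" for x
  proof -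
    have "measure M {x} = measure lborel (B \<inter> {z. z \<bullet> i = x})" by (subst mM) auto
    also have "\<dots> = 0"
      using null_set_Int1[OF null_hyperplane[OF i, of x] Bs] by (intro measure_eq_0_null_sets) (simp add: Int_commute)
    finally show ?thesis by (simp add: M.isCont_cdf)
  qed
  have top: "(cdf M \<longlongrightarrow> measure lborel B) at_top"
    using M.cdf_lim_at_top mM[of UNIV] sM by simp
  obtain u where u: "cdf M u > y"
    using order_tendstoD(1)[OF top y(2)] by (auto simp: eventually_at_top_linorder)
  obtain l where l: "cdf M l < y"
    using order_tendstoD(2)[OF M.cdf_lim_at_bot y(1)] by (auto simp: eventually_at_bot_linorder)
  have lu: "l \<le> u" using M.cdf_nondecreasing[of u l] l u by force
  obtain c where "cdf M c = y"
    using IVT[of "cdf M" l y u] l u lu cont by auto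
  moreover have "cdf M c = measure lborel (B \<inter> {x. x \<bullet> i < c})"
  proof -
    have "cdf M c = measure lborel (B \<inter> {x. x \<bullet> i \<le> c})"
      unfolding cdf_def by (subst mM) (auto )
    also have "\<dots> = measure lborel (B \<inter> {x. x \<bullet> i < c} \<union> B \<inter> {x. x \<bullet> i = c})"
      by (rule arg_cong[where f="measure lborel"]) auto
    also have "\<dots> = measure lborel (B \<inter> {x. x \<bullet> i < c})"
      using B null_set_Int1[OF null_hyperplane[OF i, of c] Bs]
      by (intro measure_Un_null_set) (auto simp: Int_commute)
    finally show ?thesis .
  qed
  ultimately show ?thesis by auto
qed

text \<open>Hypothesis \<open>pr\<close> says that both totals are cut in the same ratio \<theta>.
  By homogeneity of the root the two summands are \<theta> and 1 - \<theta> times the same n-th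
  power, so that the induction loses nothing when it splits.\<close>

lemma root_pow_superadditive:
  fixes a1 a2 b1 b2 :: real
  assumes n: "n > 0" and pos: "a1 > 0" "a2 > 0" "b1 > 0" "b2 > 0"
    and pr: "b1 * (a1 + a2) = a1 * (b1 + b2)"
  shows "(root n a1 + root n b1) ^ n + (root n a2 + root n b2) ^ n
      = (root n (a1 + a2) + root n (b1 + b2)) ^ n"
proof -
  define \<theta> where "\<theta> = a1 / (a1 + a2)"
  have a: "a1 = \<theta> * (a1 + a2)" using pos by (simp add: \<theta>_def)
  have b: "b1 = \<theta> * (b1 + b2)" using pos pr by (simp add: \<theta>_def field_simps)
  have a': "a2 = (1 - \<theta>) * (a1 + a2)" using a by (simp add: algebra_simps)
  have b': "b2 = (1 - \<theta>) * (b1 + b2)" using b by (simp add: algebra_simps)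
  have \<theta>: "0 \<le> \<theta>" "\<theta> \<le> 1" using pos by (auto simp: \<theta>_def)
  let ?s = "root n (a1 + a2) + root n (b1 + b2)"
  have "root n a1 + root n b1 = root n \<theta> * ?s"
    using a b by (metis distrib_left real_root_mult)
  moreover have "root n a2 + root n b2 = root n (1 - \<theta>) * ?s"
    using a' b' by (metis distrib_left real_root_mult)
  ultimately have "(root n a1 + root n b1) ^ n + (root n a2 + root n b2) ^ n = \<theta> * ?s ^ n + (1 - \<theta>) * ?s ^ n"
    using n \<theta> by (simp only: power_mult_distrib real_root_pow_pos2 diff_ge_0_iff_ge)
  then show ?thesis by (simp add: left_diff_distrib)
qed

text \<open>The sum of the two lower parts lies strictly below the hyperplane at height
  \<open>c + e\<close> and the sum of the two upper parts strictly above it, so the two sums are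
  disjoint subsets of \<open>A + B\<close>.\<close>

lemma set_plus_halfspaces_measure:
  fixes A B :: "'a::euclidean_space set"
  assumes "open A" "bounded A" "open B" "bounded B" "i \<in> Basis"
  shows "measure lborel ((A \<inter> {x. x \<bullet> i < c}) + (B \<inter> {x. x \<bullet> i < e}))
      + measure lborel ((A \<inter> {x. c < x \<bullet> i}) + (B \<inter> {x. e < x \<bullet> i})) \<le> measure lborel (A + B)"
proof -
  let ?S = "A + B"
  have S: "open ?S" "bounded ?S" using assms by (auto intro: open_set_plus bounded_set_plus)
  have o: "open {x::'a. x \<bullet> i < c}" "open {x::'a. c < x \<bullet> i}" for c
    by (auto intro!: open_Collect_less continuous_intros)
  have 1: "measure lborel ((A \<inter> {x. x \<bullet> i < c}) + (B \<inter> {x. x \<bullet> i < e})) \<le> measure lborel (?S \<inter> {x. x \<bullet> i < c + e})"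
    using assms S o
    by (intro measure_lborel_mono_bounded borel_open open_set_plus open_Int bounded_Int)
      (auto simp: set_plus_def inner_add_left)
  have 2: "measure lborel ((A \<inter> {x. c < x \<bullet> i}) + (B \<inter> {x. e < x \<bullet> i})) \<le> measure lborel (?S \<inter> {x. c + e < x \<bullet> i})"
    using assms S o
    by (intro measure_lborel_mono_bounded borel_open open_set_plus open_Int bounded_Int)
      (auto simp: set_plus_def inner_add_left)
  show ?thesis
    using 1 2 measure_split_hyperplane[of ?S i "c + e"] S assms by (auto)
qed

text \<open>Two disjoint nonempty boxes already have disjoint projections on some axis. A cut at the
  end of the lower interval leaves one of them wholly below and the other wholly above.\<close>

lemma disjoint_boxes_separate:
  fixes D :: "'a::euclidean_space set set"
  assumes D: "disjoint_boxes D" "card D \<ge> 2"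
  obtains i c where "i \<in> Basis" "\<exists>K\<in>D. K \<inter> {x. x \<bullet> i < c} = {}" "\<exists>K\<in>D. K \<inter> {x. c < x \<bullet> i} = {}"
proof -
  obtain K K' where K: "K \<in> D" "K' \<in> D" "K \<noteq> K'"
    using D(2) by (metis card_2_iff' card_le_Suc0_iff_eq  D(1) disjoint_boxes_def not_less_eq_eq numeral_2_eq_2)
  have ex: "\<And>K. K \<in> D \<Longrightarrow> K \<noteq> {} \<and> (\<exists>a b. K = box a b)" and dj: "disjoint D"
    using D(1) by (auto simp: disjoint_boxes_def)
  have disj: "K \<inter> K' = {}" using dj K by (auto simp: disjoint_def)
  from ex K obtain a b a' b' where eq: "K = box a b" "K' = box a' b'" by meson
  have ne: "box a b \<noteq> {}" "box a' b' \<noteq> {}" using ex K eq by auto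
  from disj have "\<exists>i\<in>Basis. b \<bullet> i \<le> a' \<bullet> i \<or> b' \<bullet> i \<le> a \<bullet> i"
    unfolding eq disjoint_interval using ne by (auto simp: box_ne_empty not_le)
  then obtain i where i: "i \<in> Basis" and "b \<bullet> i \<le> a' \<bullet> i \<or> b' \<bullet> i \<le> a \<bullet> i" by blast
  then consider "b \<bullet> i \<le> a' \<bullet> i" | "b' \<bullet> i \<le> a \<bullet> i" by blast
  then show thesis
  proof cases
    case 1
    have "K' \<inter> {x. x \<bullet> i < b \<bullet> i} = {}" "K \<inter> {x. b \<bullet> i < x \<bullet> i} = {}"
      using 1 i by (auto simp: eq mem_box) (meson less_le_trans less_asym le_less_trans)+
    then show thesis using that[OF i, of "b \<bullet> i"] K by blast
  next
    case 2
    have "K \<inter> {x. x \<bullet> i < b' \<bullet> i} = {}" "K' \<inter> {x. b' \<bullet> i < x \<bullet> i} = {}"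
      using 2 i by (auto simp: eq mem_box) (meson less_le_trans less_asym le_less_trans)+
    then show thesis using that[OF i, of "b' \<bullet> i"] K by blast
  qed
qed

text \<open>Hadwiger--Ohmann induction on the total number of boxes. A cut that separates two boxes
  of one family strictly lowers its number on both sides, while the other family does not grow. The
  base case, one box each, is \<open>root_prod_add_le\<close>.\<close>

lemma brunn_minkowski_boxes:
  fixes A B :: "'a::euclidean_space set set"
  assumes "disjoint_boxes A" "disjoint_boxes B" "A \<noteq> {}" "B \<noteq> {}"
  shows "(root DIM('a) (measure lborel (\<Union>A)) + root DIM('a) (measure lborel (\<Union>B))) ^ DIM('a)
      \<le> measure lborel (\<Union>A + \<Union>B)"
  using assms
proof (induction "card A + card B" arbitrary: A B rule: less_induct)
  case less
  let ?n = "DIM('a)" and ?m = "measure lborel"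
  \<comment> \<open>Stated for its own \<open>A\<close> and \<open>B\<close>, so that it also serves
    with the roles exchanged when only the second family has two boxes.\<close>
  have step: "(root ?n (?m (\<Union>A)) + root ?n (?m (\<Union>B))) ^ ?n \<le> ?m (\<Union>A + \<Union>B)"
    if AB: "disjoint_boxes A" "disjoint_boxes B" "A \<noteq> {}" "B \<noteq> {}" "card A \<ge> 2"
      and IH: "\<And>A' B' :: 'a set set. card A' + card B' < card A + card B \<Longrightarrow> disjoint_boxes A' \<Longrightarrow> disjoint_boxes B' \<Longrightarrow> A' \<noteq> {} \<Longrightarrow> B' \<noteq> {} \<Longrightarrow>
        (root ?n (?m (\<Union>A')) + root ?n (?m (\<Union>B'))) ^ ?n \<le> ?m (\<Union>A' + \<Union>B')"
    for A B :: "'a set set"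
  proof -
    obtain i c where i: "i \<in> Basis" and c: "\<exists>K\<in>A. K \<inter> {x. x \<bullet> i < c} = {}" "\<exists>K\<in>A. K \<inter> {x. c < x \<bullet> i} = {}"
      using disjoint_boxes_separate AB by blast
    note sA = disjoint_boxes_split[OF AB(1) i, of c]
    define A1 where "A1 = (\<lambda>K. K \<inter> {x. x \<bullet> i < c}) ` A - {{}}"
    define A2 where "A2 = (\<lambda>K. K \<inter> {x. c < x \<bullet> i}) ` A - {{}}"
    have A12: "disjoint_boxes A1" "disjoint_boxes A2" "card A1 < card A" "card A2 < card A"
        "\<Union>A1 = \<Union>A \<inter> {x. x \<bullet> i < c}" "\<Union>A2 = \<Union>A \<inter> {x. c < x \<bullet> i}"
      unfolding A1_def A2_def using sA c by auto
    have oA: "open (\<Union>A)" "bounded (\<Union>A)" and oB: "open (\<Union>B)" "bounded (\<Union>B)"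
      using disjoint_boxes_open_bounded AB by auto
    have "A1 \<noteq> {}"
    proof -
      obtain K where K: "K \<in> A" "K \<inter> {x. c < x \<bullet> i} = {}" using c by blast
      \<comment> \<open>A box with no point above the cut must have one below: otherwise it would be
        a nonempty open set inside a null hyperplane.\<close>
      have "K \<inter> {x. x \<bullet> i < c} \<noteq> {}"
      proof
        assume *: "K \<inter> {x. x \<bullet> i < c} = {}"
        have "open K" "K \<noteq> {}" using K(1) AB(1) by (auto simp: disjoint_boxes_def)
        have "K \<subseteq> {x. x \<bullet> i = c}" using * K(2) by (auto simp: not_less disjoint_iff intro!: antisym)
        then have "negligible K" using negligible_standard_hyperplane[OF i] negligible_subset by blast
        then show False using open_not_negligible \<open>open K\<close> \<open>K \<noteq> {}\<close> by blast
      qed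
      then show ?thesis using K(1) by (auto simp: A1_def)
    qed
    have "A2 \<noteq> {}"
    proof -
      obtain K where K: "K \<in> A" "K \<inter> {x. x \<bullet> i < c} = {}" using c by blast
      have "K \<inter> {x. c < x \<bullet> i} \<noteq> {}"
      proof
        assume *: "K \<inter> {x. c < x \<bullet> i} = {}"
        have "open K" "K \<noteq> {}" using K(1) AB(1) by (auto simp: disjoint_boxes_def)
        have "K \<subseteq> {x. x \<bullet> i = c}" using * K(2) by (auto simp: not_less disjoint_iff intro!: antisym)
        then have "negligible K" using negligible_standard_hyperplane[OF i] negligible_subset by blast
        then show False using open_not_negligible \<open>open K\<close> \<open>K \<noteq> {}\<close> by blast
      qed
      then show ?thesis using K(1) by (auto simp: A2_def)
    qed
    have a: "?m (\<Union>A1) > 0" "?m (\<Union>A2) > 0"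
      using disjoint_boxes_measure_pos[OF A12(1)] disjoint_boxes_measure_pos[OF A12(2)] \<open>A1 \<noteq> {}\<close> \<open>A2 \<noteq> {}\<close> by blast+
    have asum: "?m (\<Union>A) = ?m (\<Union>A1) + ?m (\<Union>A2)"
      unfolding A12 using oA i by (intro measure_split_hyperplane) auto
    have b: "?m (\<Union>B) > 0" using disjoint_boxes_measure_pos AB by auto
    \<comment> \<open>Cut \<open>B\<close> in the same proportion as \<open>A\<close>: each pair of halves then contributes the same multiple of
      the total.\<close>
    define y where "y = ?m (\<Union>A1) / ?m (\<Union>A) * ?m (\<Union>B)"
    have y: "0 < y" "y < ?m (\<Union>B)" using a asum b by (auto simp: y_def field_simps)
    obtain e where e: "?m (\<Union>B \<inter> {x. x \<bullet> i < e}) = y"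
      using measure_halfspace_split[of "\<Union>B" i y] oB i y by auto
    note sB = disjoint_boxes_split[OF AB(2) i, of e]
    define B1 where "B1 = (\<lambda>K. K \<inter> {x. x \<bullet> i < e}) ` B - {{}}"
    define B2 where "B2 = (\<lambda>K. K \<inter> {x. e < x \<bullet> i}) ` B - {{}}"
    have B12: "disjoint_boxes B1" "disjoint_boxes B2" "card B1 \<le> card B" "card B2 \<le> card B"
        "\<Union>B1 = \<Union>B \<inter> {x. x \<bullet> i < e}" "\<Union>B2 = \<Union>B \<inter> {x. e < x \<bullet> i}"
      unfolding B1_def B2_def using sB by auto
    have bsum: "?m (\<Union>B) = ?m (\<Union>B1) + ?m (\<Union>B2)"
      unfolding B12 using oB i by (intro measure_split_hyperplane) auto
    have b1: "?m (\<Union>B1) = y" using B12 e by simp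
    have bpos: "?m (\<Union>B1) > 0" "?m (\<Union>B2) > 0" using b1 y bsum by auto
    then have "B1 \<noteq> {}" "B2 \<noteq> {}" by auto
    have "(root ?n (?m (\<Union>A)) + root ?n (?m (\<Union>B))) ^ ?n
        = (root ?n (?m (\<Union>A1)) + root ?n (?m (\<Union>B1))) ^ ?n + (root ?n (?m (\<Union>A2)) + root ?n (?m (\<Union>B2))) ^ ?n"
      unfolding asum bsum
    proof (rule root_pow_superadditive[symmetric])
      show "?m (\<Union>B1) * (?m (\<Union>A1) + ?m (\<Union>A2)) = ?m (\<Union>A1) * (?m (\<Union>B1) + ?m (\<Union>B2))"
        unfolding asum[symmetric] bsum[symmetric] unfolding b1 using a asum by (simp add: y_def)
    qed (use a bpos in auto)
    also have "\<dots> \<le> ?m (\<Union>A1 + \<Union>B1) + ?m (\<Union>A2 + \<Union>B2)"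
      using A12 B12 \<open>A1 \<noteq> {}\<close> \<open>A2 \<noteq> {}\<close> \<open>B1 \<noteq> {}\<close> \<open>B2 \<noteq> {}\<close>
      by (intro add_mono IH[of A1 B1] IH[of A2 B2]) auto
    also have "\<dots> \<le> ?m (\<Union>A + \<Union>B)"
      unfolding A12 B12 using oA oB i by (intro set_plus_halfspaces_measure) auto
    finally show ?thesis .
  qed
  have card: "card A > 0" "card B > 0" using less.prems by (auto simp: disjoint_boxes_def card_gt_0_iff)
  consider "card A \<ge> 2" | "card B \<ge> 2" | "card A = 1" "card B = 1" using card by linarith
  then show ?case
  proof cases
    case 1
    show ?thesis by (rule step) (use less 1 in auto)
  next
    case 2
    have "(root ?n (?m (\<Union>B)) + root ?n (?m (\<Union>A))) ^ ?n \<le> ?m (\<Union>B + \<Union>A)"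
      by (rule step) (use less 2 in auto)
    then show ?thesis by (simp add: add.commute)
  next
    case 3
    then obtain K K' where K: "A = {K}" "B = {K'}" by (meson card_1_singletonE)
    have "\<exists>a b. K = box a b" "\<exists>c d. K' = box c d" and "K \<noteq> {}" "K' \<noteq> {}"
      using less.prems unfolding disjoint_boxes_def K by auto
    then obtain a b c d where eq: "K = box a b" "K' = box c d" and ne: "box a b \<noteq> {}" "box c d \<noteq> {}"
      by metis
    have lt: "\<And>i. i \<in> Basis \<Longrightarrow> a \<bullet> i < b \<bullet> i" "\<And>i. i \<in> Basis \<Longrightarrow> c \<bullet> i < d \<bullet> i"
      using ne by (auto simp: box_ne_empty)
    let ?R = "\<Prod>i\<in>(Basis::'a set). (b - a) \<bullet> i + (d - c) \<bullet> i"
    have "root ?n (?m (box a b)) + root ?n (?m (box c d))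
      = root ?n (\<Prod>i\<in>Basis. (b - a) \<bullet> i) + root ?n (\<Prod>i\<in>Basis. (d - c) \<bullet> i)"
      using lt by (simp add: measure_lborel_box_eq less_imp_le)
    also have "\<dots> \<le> root ?n ?R"
      using lt by (intro root_prod_add_le) (auto simp: inner_diff_left)
    finally have le: "root ?n (?m (box a b)) + root ?n (?m (box c d)) \<le> root ?n ?R" .
    have "(root ?n (?m (box a b)) + root ?n (?m (box c d))) ^ ?n \<le> root ?n ?R ^ ?n"
      using le by (intro power_mono) auto
    also have "\<dots> = ?R" using lt
      by (intro real_root_pow_pos2 prod_nonneg ballI add_nonneg_nonneg) (auto simp: inner_diff_left less_imp_le)
    also have "\<dots> = ?m (box (a + c) (b + d))"
    proof -
      have "(a + c) \<bullet> i \<le> (b + d) \<bullet> i" if "i \<in> Basis" for i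
        using lt[OF that] by (simp add: inner_add_left)
      then show ?thesis
        by (simp add: measure_lborel_box_eq) (auto intro!: prod.cong simp: algebra_simps)
    qed
    also have "\<dots> \<le> ?m (box a b + box c d)"
      using box_add_subset[of a b c d] lt
      by (intro measure_lborel_mono_bounded) (auto intro!: bounded_set_plus borel_open open_set_plus)
    finally show ?thesis using K eq by simp
  qed
qed

section \<open>From boxes to bounded open sets\<close>

text \<open>An open set is a countable union of closed boxes, possibly overlapping; finitely many of
  them carry more than \<open>y\<close> of the volume. Their union has a division into boxes with
  disjoint interiors, and passing to the interiors loses only frontiers, which are null.\<close>

lemma open_inner_boxes:
  fixes A :: "'a::euclidean_space set"
  assumes A: "open A" "bounded A" and y: "y < measure lborel A"
  obtains D where "disjoint_boxes D" "\<Union>D \<subseteq> A" "y < measure lborel (\<Union>D)"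
proof (cases "A = {}")
  case True
  show ?thesis by (rule that[of "{}"]) (use y True in \<open>auto simp: disjoint_boxes_def\<close>)
next
  case False
  obtain C where C: "countable C" "C \<subseteq> Pow A" "\<And>X. X \<in> C \<Longrightarrow> \<exists>a b. X = cbox a b" "\<Union>C = A"
    using open_countable_Union_open_cbox[OF A(1)] by metis
  have "C \<noteq> {}" using C(4) False by auto
  define F where "F n = (\<Union>k\<le>n. from_nat_into C k)" for n
  have FC: "from_nat_into C k \<in> C" for k using \<open>C \<noteq> {}\<close> by (rule from_nat_into)
  have FA: "F n \<subseteq> A" for n using FC C(2) by (auto simp: F_def)
  have Fb: "from_nat_into C k \<in> sets borel" for k using C(3)[OF FC[of k]] by auto
  have UF: "(\<Union>n. F n) = A"
  proof -
    have "(\<Union>n. F n) = (\<Union>k. from_nat_into C k)" by (auto simp: F_def)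
    also have "\<dots> = \<Union>C" using range_from_nat_into[OF \<open>C \<noteq> {}\<close> C(1)] by simp
    finally show ?thesis using C by simp
  qed
  have fin: "emeasure lborel A < \<infinity>" by (rule emeasure_bounded_finite[OF A(2)])
  have "(\<lambda>n. measure lborel (F n)) \<longlonglongrightarrow> measure lborel (\<Union>n. F n)"
  proof (rule Lim_measure_incseq)
    show "range F \<subseteq> sets lborel" using Fb by (auto simp: F_def)
    show "incseq F" by (force simp: incseq_def F_def)
    show "emeasure lborel (\<Union>n. F n) \<noteq> \<infinity>" using fin UF by simp
  qed
  then have "eventually (\<lambda>n. y < measure lborel (F n)) sequentially"
    using y unfolding UF by (rule order_tendstoD)
  then obtain n where n: "y < measure lborel (F n)" by (auto simp: eventually_sequentially)
  obtain p where p: "p division_of (F n)"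
  proof (rule elementary_unions_intervals[of "from_nat_into C ` {..n}"])
    show "\<exists>a b. s = cbox a b" if "s \<in> from_nat_into C ` {..n}" for s using that C(3) FC by auto
  qed (use that in \<open>auto simp: F_def\<close>)
  define D where "D = interior ` p - {{}}"
  have D: "disjoint_boxes D"
    unfolding disjoint_boxes_def
  proof (intro conjI ballI)
    show "finite D" using p by (auto simp: D_def)
    fix K assume "K \<in> D"
    then show "K \<noteq> {}" "\<exists>a b. K = box a b" using p by (fastforce simp: D_def)+
  next
    show "disjoint D" unfolding disjoint_def
    proof (intro ballI impI)
      fix X Y assume "X \<in> D" "Y \<in> D" "X \<noteq> Y"
      then obtain K K' where "K \<in> p" "K' \<in> p" "X = interior K" "Y = interior K'" "K \<noteq> K'"
        by (auto simp: D_def)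
      then show "X \<inter> Y = {}" using division_ofD(5)[OF p] by blast
    qed
  qed
  have DF: "\<Union>D \<subseteq> F n"
    using interior_subset division_ofD(6)[OF p] by (fastforce simp: D_def)
  define N where "N = (\<Union>K\<in>p. frontier K)"
  have Nn: "N \<in> null_sets lborel"
  proof -
    have "frontier K \<in> null_sets lborel" if K: "K \<in> p" for K
    proof -
      obtain a b where K: "K = cbox a b" using division_ofD(4)[OF p K] by blast
      have "negligible (frontier K)" unfolding K by (intro negligible_convex_frontier convex_box)
      then show ?thesis
        by (subst null_sets_completion_iff[symmetric]) (auto simp: negligible_iff_null_sets)
    qed
    then show ?thesis unfolding N_def using division_ofD(1)[OF p] by (intro null_sets.finite_UN) auto
  qed
  have Db: "open (\<Union>D)" "bounded (\<Union>D)" using disjoint_boxes_open_bounded[OF D] by auto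
  have "F n \<subseteq> \<Union>D \<union> N"
  proof
    fix x assume "x \<in> F n"
    then obtain K where K: "K \<in> p" "x \<in> K" using division_ofD(6)[OF p] by blast
    show "x \<in> \<Union>D \<union> N"
    proof (cases "x \<in> interior K")
      case False
      then have "x \<in> frontier K" using K closure_subset by (auto simp: frontier_def)
      then show ?thesis using K by (auto simp: N_def)
    qed (use K in \<open>auto simp: D_def\<close>)
  qed
  moreover have "bounded N"
    unfolding N_def using division_ofD(1,4)[OF p] by (intro bounded_UN) (auto intro!: bounded_subset[OF bounded_cbox frontier_subset_closed[OF closed_cbox]])
  ultimately have "measure lborel (F n) \<le> measure lborel (\<Union>D \<union> N)"
    using Db Fb Nn by (intro measure_lborel_mono_bounded) (auto simp: F_def)
  also have "\<dots> = measure lborel (\<Union>D)" using Db Nn by (intro measure_Un_null_set) auto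
  finally show ?thesis using n DF FA[of n] D by (intro that[of D]) auto
qed

theorem brunn_minkowski_open:
  fixes A B :: "'a::euclidean_space set"
  assumes A: "open A" "bounded A" "A \<noteq> {}" and B: "open B" "bounded B" "B \<noteq> {}"
  shows "(root DIM('a) (measure lborel A) + root DIM('a) (measure lborel B)) ^ DIM('a)
      \<le> measure lborel (A + B)"
proof (rule tendsto_upperbound)
  let ?n = "DIM('a)" and ?m = "measure lborel"
  define f where "f e = (root ?n (?m A - e) + root ?n (?m B - e)) ^ ?n" for e
  have "(f \<longlongrightarrow> (root ?n (?m A - 0) + root ?n (?m B - 0)) ^ ?n) (at_right 0)"
    unfolding f_def by (intro tendsto_intros)
  then show "(f \<longlongrightarrow> (root ?n (?m A) + root ?n (?m B)) ^ ?n) (at_right 0)" by simp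
  \<comment> \<open>An \<open>e\<close> below both volumes keeps both families of inner boxes
    nonempty, as \<open>brunn_minkowski_boxes\<close> demands.\<close>
  have "?m A > 0" "?m B > 0" using measure_open_pos A B by auto
  then have "\<forall>\<^sub>F e in at_right 0. e < min (?m A) (?m B)"
    using eventually_at_right_real[of 0 "min (?m A) (?m B)"] by (auto elim: eventually_mono)
  moreover have "\<forall>\<^sub>F e in at_right 0. (0::real) < e" by (rule eventually_at_right_less)
  ultimately show "\<forall>\<^sub>F e in at_right 0. f e \<le> ?m (A + B)"
  proof eventually_elim
    case (elim e)
    obtain D where D: "disjoint_boxes D" "\<Union>D \<subseteq> A" "?m A - e < ?m (\<Union>D)"
      using open_inner_boxes[OF A(1,2), of "?m A - e"] elim by auto
    obtain E where E: "disjoint_boxes E" "\<Union>E \<subseteq> B" "?m B - e < ?m (\<Union>E)"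
      using open_inner_boxes[OF B(1,2), of "?m B - e"] elim by auto
    have ne: "D \<noteq> {}" "E \<noteq> {}" using D E elim by auto
    have "f e \<le> (root ?n (?m (\<Union>D)) + root ?n (?m (\<Union>E))) ^ ?n"
      unfolding f_def using D E elim by (intro power_mono add_mono) auto
    also have "\<dots> \<le> ?m (\<Union>D + \<Union>E)" by (rule brunn_minkowski_boxes) (use D E ne in auto)
    also have "\<dots> \<le> ?m (A + B)"
      using D E A B disjoint_boxes_open_bounded[OF D(1)]
      by (intro measure_lborel_mono_bounded set_plus_mono2 bounded_set_plus borel_open open_set_plus) auto
    finally show ?case .
  qed
qed simp

text \<open>Brunn--Minkowski with a ball of radius \<open>h\<close>; Bernoulli's inequality keeps
  the terms of order 0 and 1 in \<open>h\<close>. The coefficient of \<open>h\<close> is the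
  perimeter of a ball with the volume of \<open>A\<close>.\<close>

lemma measure_add_ball_ge:
  fixes A :: "'a::euclidean_space set" and h :: real
  assumes A: "open A" "bounded A" "A \<noteq> {}" and h: "h > 0"
  shows "measure lborel A + DIM('a) * h * root DIM('a) (unit_ball_vol DIM('a)) * root DIM('a) (measure lborel A) ^ (DIM('a) - 1)
      \<le> measure lborel (A + ball 0 h)"
proof -
  let ?n = "DIM('a)" and ?m = "measure lborel"
  let ?a = "root ?n (?m A)" and ?b = "h * root ?n (unit_ball_vol ?n)"
  have a: "?a > 0" using measure_open_pos[OF A] by simp
  have "?m (ball (0::'a) h) = unit_ball_vol ?n * h ^ ?n"
    using h by (simp add: content_ball)
  then have b: "root ?n (?m (ball (0::'a) h)) = ?b"
    using h by (simp add: real_root_mult real_root_power_cancel mult.commute)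
  have "?m A + ?n * h * root ?n (unit_ball_vol ?n) * ?a ^ (?n - 1) = ?a ^ ?n * (1 + real ?n * (?b / ?a))"
  proof -
    have 1: "?a ^ ?n = ?m A" by simp
    have 2: "?a ^ ?n = ?a * ?a ^ (?n - 1)" by (metis DIM_positive power_eq_if not_less0)
    have "?a ^ ?n * (1 + real ?n * (?b / ?a)) = ?a ^ ?n + ?a ^ (?n - 1) * (real ?n * ?b)"
      using a unfolding 2 by (simp add: field_simps)
    then show ?thesis unfolding 1 by (simp add: algebra_simps)
  qed
  also have "\<dots> \<le> ?a ^ ?n * (1 + ?b / ?a) ^ ?n"
    using a h by (intro mult_left_mono Bernoulli_inequality) (auto intro: order_trans[of _ 0])
  also have "\<dots> = (?a + ?b) ^ ?n"
    unfolding power_mult_distrib[symmetric] using a by (simp add: distrib_left)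
  also have "\<dots> \<le> ?m (A + ball 0 h)"
    using brunn_minkowski_open[OF A, of "ball 0 h"] h b by simp
  finally show ?thesis .
qed

section \<open>A lower bound for the integral of the gradient\<close>

text \<open>Layer cake: \<open>v x - u x\<close> is the length of the set of levels t with u x <= t
  < v x. Tonelli exchanges the integrals over points and levels, which takes the place of the coarea
  formula.\<close>

lemma level_sets_le_integral_diff:
  fixes u v :: "'a::euclidean_space \<Rightarrow> real" and s c :: real
  assumes [measurable]: "u \<in> borel_measurable borel" "v \<in> borel_measurable borel"
    and int: "integrable lborel (\<lambda>x. v x - u x)" and le: "\<And>x. u x \<le> v x"
    and c: "0 \<le> c" "0 < s"
    and level: "\<And>t. 0 < t \<Longrightarrow> t < s \<Longrightarrow> ennreal c \<le> emeasure lborel {x. u x \<le> t \<and> t < v x}"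
  shows "s * c \<le> (\<integral>x. v x - u x \<partial>lborel)"
proof -
  define F where "F x t = (indicator {p. 0 < snd p \<and> snd p < s \<and> u (fst p) \<le> snd p \<and> snd p < v (fst p)} (x, t) :: ennreal)" for x :: 'a and t :: real
  have Fm[measurable]: "(\<lambda>(x, t). F x t) \<in> borel_measurable (lborel \<Otimes>\<^sub>M lborel)"
    unfolding F_def by measurable
  have "ennreal (s * c) = (\<integral>\<^sup>+t. ennreal c * indicator {0<..<s} t \<partial>lborel)"
    using c by (simp add: nn_integral_cmult_indicator ennreal_mult mult.commute)
  also have "\<dots> \<le> (\<integral>\<^sup>+t. (\<integral>\<^sup>+x. F x t \<partial>lborel) \<partial>lborel)"
  proof (rule nn_integral_mono)
    fix t :: real
    show "ennreal c * indicator {0<..<s} t \<le> (\<integral>\<^sup>+x. F x t \<partial>lborel)"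
    proof (cases "0 < t \<and> t < s")
      case True
      have "(\<integral>\<^sup>+x. F x t \<partial>lborel) = (\<integral>\<^sup>+x. indicator {x. u x \<le> t \<and> t < v x} x \<partial>lborel)"
        using True by (intro nn_integral_cong) (simp add: F_def indicator_def)
      also have "\<dots> = emeasure lborel {x. u x \<le> t \<and> t < v x}"
        by (rule nn_integral_indicator) measurable
      finally show ?thesis using level[of t] True by simp
    qed simp
  qed
  also have "\<dots> = (\<integral>\<^sup>+x. (\<integral>\<^sup>+t. F x t \<partial>lborel) \<partial>lborel)"
    by (rule lborel_pair.Fubini') measurable
  also have "\<dots> \<le> (\<integral>\<^sup>+x. ennreal (v x - u x) \<partial>lborel)"
  proof (rule nn_integral_mono)
    fix x :: 'a
    have "(\<integral>\<^sup>+t. F x t \<partial>lborel) \<le> (\<integral>\<^sup>+t. indicator {u x..v x} t \<partial>lborel)"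
      by (intro nn_integral_mono) (auto simp: F_def indicator_def)
    then show "(\<integral>\<^sup>+t. F x t \<partial>lborel) \<le> ennreal (v x - u x)"
      using le[of x] by simp
  qed
  also have "\<dots> = ennreal (\<integral>x. v x - u x \<partial>lborel)"
    using int le by (intro nn_integral_eq_integral) auto
  finally show ?thesis
    using le by (subst (asm) ennreal_le_iff) (auto intro!: integral_nonneg_AE)
qed

lemma has_derivative_inner_bound:
  fixes u :: "'a::euclidean_space \<Rightarrow> real"
  assumes d: "\<And>x. (u has_derivative (\<lambda>v. G x \<bullet> v)) (at x)"
    and M: "\<And>z. dist z x < h \<Longrightarrow> norm (G z) \<le> M" and y: "dist y x < h"
  shows "u y - u x \<le> M * dist y x"
proof -
  have "norm (u y - u x) \<le> M * norm (y - x)"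
  proof (rule differentiable_bound[of "ball x h" u "\<lambda>z v. G z \<bullet> v"])
    show "(u has_derivative (\<bullet>) (G z)) (at z within ball x h)" for z
      using d[of z] by (rule has_derivative_at_withinI)
    show "onorm ((\<bullet>) (G z)) \<le> M" if "z \<in> ball x h" for z
    proof (rule onorm_bound)
      show "0 \<le> M" using M[of z] that norm_ge_zero[of "G z"] by (simp add: dist_commute) (meson order_trans norm_ge_zero)
      show "norm (G z \<bullet> v) \<le> M * norm v" for v
        using M[of z] that Cauchy_Schwarz_ineq2[of "G z" v]
        by (simp add: dist_commute) (meson mult_right_mono norm_ge_zero order_trans)
    qed
    show "y \<in> ball x h" using y by (simp add: dist_commute)
    show "x \<in> ball x h" using y zero_le_dist[of y x] by (simp add: order.strict_trans1[OF zero_le_dist])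
  qed auto
  then show ?thesis by (simp add: dist_norm)
qed

text \<open>Each level below \<open>s\<close> contributes at least the isoperimetric bound for
  volume \<open>k\<close>. To see this, \<open>u\<close> is compared with its first-order growth
  \<open>v\<close> over the distance \<open>h\<close>: enlarging a superlevel set of
  \<open>u\<close> by a ball of radius \<open>h\<close> stays inside the superlevel set of
  \<open>v\<close>.\<close>

lemma integral_gradient_ge:
  fixes u :: "'a::euclidean_space \<Rightarrow> real" and G :: "'a \<Rightarrow> 'a" and s k :: real
  assumes d: "\<And>x. (u has_derivative (\<lambda>v. G x \<bullet> v)) (at x)" and G: "continuous_on UNIV G"
    and supp: "\<And>x. norm x > R \<Longrightarrow> u x = 0" "\<And>x. norm x > R \<Longrightarrow> G x = 0"
    and nn: "\<And>x. u x \<ge> 0" and s: "0 < s" and k: "0 < k"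
    and level: "\<And>t. 0 < t \<Longrightarrow> t < s \<Longrightarrow> k \<le> measure lborel {x. t < u x}"
  shows "DIM('a) * root DIM('a) (unit_ball_vol DIM('a)) * s * root DIM('a) k ^ (DIM('a) - 1)
      \<le> (\<integral>x. norm (G x) \<partial>lborel)"
proof -
  define K where "K = DIM('a) * root DIM('a) (unit_ball_vol DIM('a)) * root DIM('a) k ^ (DIM('a) - 1)"
  have K: "K \<ge> 0" unfolding K_def using k by auto
  have uc: "continuous_on UNIV u"
    by (intro continuous_at_imp_continuous_on ballI has_derivative_continuous[OF d])
  have [measurable]: "u \<in> borel_measurable borel" "G \<in> borel_measurable borel"
    using uc G by (auto intro: borel_measurable_continuous_onI)
  have Gint: "integrable lborel (\<lambda>x. norm (G x))"
  proof -
    have "integrable lborel (\<lambda>x. indicator (cball 0 R) x *\<^sub>R norm (G x))"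
      using G by (intro borel_integrable_compact[unfolded set_integrable_def]) (auto intro!: continuous_intros intro: continuous_on_subset)
    also have "(\<lambda>x. indicator (cball 0 R) x *\<^sub>R norm (G x)) = (\<lambda>x. norm (G x))"
      using supp by (auto simp: fun_eq_iff indicator_def not_le)
    finally show ?thesis .
  qed
  define W where "W = cball (0::'a) (R + 1)"
  have main: "s * K \<le> (\<integral>x. norm (G x) \<partial>lborel) + \<delta> * measure lborel W" if \<delta>: "\<delta> > 0" for \<delta>
  proof -
    have "uniformly_continuous_on (cball 0 (R + 2)) G"
      by (intro compact_uniformly_continuous continuous_on_subset[OF G]) auto
    then obtain h0 where h0: "h0 > 0" "\<And>x y. x \<in> cball 0 (R + 2) \<Longrightarrow> y \<in> cball 0 (R + 2) \<Longrightarrow> dist y x < h0 \<Longrightarrow> dist (G y) (G x) < \<delta>"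
      unfolding uniformly_continuous_on_def using \<delta> by meson
    define h where "h = min h0 1"
    have h: "0 < h" "h \<le> 1" "h \<le> h0" using h0 by (auto simp: h_def)
    have Gd: "norm (G y) \<le> norm (G x) + \<delta>" if "dist y x < h" for x y
    proof (cases "norm x \<le> R + 1")
      case True
      have "norm y \<le> R + 2" using that h True norm_triangle_ineq2[of y x] by (simp add: dist_norm)
      then have "dist (G y) (G x) < \<delta>" using True that h by (intro h0) auto
      then show ?thesis using norm_triangle_ineq2[of "G y" "G x"] by (simp add: dist_norm)
    next
      case False
      have "norm y > R" using that h False norm_triangle_ineq2[of x y] by (simp add: dist_norm norm_minus_commute)
      then show ?thesis using supp \<delta> by (simp add: add_nonneg_pos less_imp_le)
    qed
    \<comment> \<open>The summand \<delta> absorbs the oscillation of \<open>G\<close> within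
      distance \<open>h\<close>. It is confined to \<open>W\<close> so that \<open>v - u\<close>
      stays integrable; \<open>W\<close> has radius R + 1 and \<open>h\<close> is at most 1, so it
      contains every point that the enlarged superlevel sets can reach.\<close>
    define v where "v x = u x + h * (norm (G x) + \<delta>) * indicator W x" for x
    have [measurable]: "W \<in> sets borel" by (simp add: W_def)
    have [measurable]: "v \<in> borel_measurable borel" unfolding v_def by measurable
    have vu: "v x - u x = h * (norm (G x) + \<delta> * indicator W x)" for x
      using supp(2)[of x] by (auto simp: v_def W_def indicator_def)
    have Wi: "integrable lborel (\<lambda>x. \<delta> * indicator W x)"
      using emeasure_bounded_finite[of W] by (auto simp: W_def)
    have "s * (h * K) \<le> (\<integral>x. v x - u x \<partial>lborel)"
    proof (rule level_sets_le_integral_diff)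
      show "integrable lborel (\<lambda>x. v x - u x)"
        unfolding vu using Gint Wi by auto
      show "u x \<le> v x" for x
        unfolding v_def using h \<delta> by (intro add_increasing2 mult_nonneg_nonneg) auto
      show "0 \<le> h * K" using h K by simp
      fix t assume t: "0 < t" "t < s"
      let ?A = "{x. t < u x}"
      have uA: "open ?A" by (intro open_Collect_less uc continuous_intros)
      have sub: "?A \<subseteq> cball 0 R" using supp(1) t by (force simp: not_le[symmetric])
      then have bA: "bounded ?A" using bounded_cball bounded_subset by blast
      have kA: "k \<le> measure lborel ?A" by (rule level[OF t])
      then have neA: "?A \<noteq> {}" using k by (intro notI) simp
      have fin: "emeasure lborel ?A < \<infinity>" "emeasure lborel (?A + ball 0 h) < \<infinity>"
        by (rule emeasure_bounded_finite, use bA in \<open>simp add: bounded_set_plus\<close>)+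
      have "h * K \<le> DIM('a) * h * root DIM('a) (unit_ball_vol DIM('a)) * root DIM('a) (measure lborel ?A) ^ (DIM('a) - 1)"
        unfolding K_def using kA h k by (auto simp: mult_ac intro!: mult_left_mono power_mono)
      also have "\<dots> \<le> measure lborel (?A + ball 0 h) - measure lborel ?A"
        using measure_add_ball_ge[OF uA bA neA h(1)] by simp
      also have "\<dots> = measure lborel ((?A + ball 0 h) - ?A)"
      proof (rule measure_Diff[symmetric])
        show "?A \<subseteq> ?A + ball 0 h"
        proof
          fix x assume "x \<in> ?A"
          then have "x + 0 \<in> ?A + ball 0 h" using h by (intro set_plus_intro) auto
          then show "x \<in> ?A + ball 0 h" by simp
        qed
      qed (use fin uA in \<open>auto intro!: borel_open open_set_plus\<close>)
      also have "\<dots> \<le> measure lborel {x. u x \<le> t \<and> t < v x}"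
      proof (rule measure_mono_fmeasurable)
        show "(?A + ball 0 h) - ?A \<subseteq> {x. u x \<le> t \<and> t < v x}"
        proof
          fix x assume x: "x \<in> (?A + ball 0 h) - ?A"
          then obtain a b where ab: "x = a + b" "t < u a" "norm b < h" by (auto simp: set_plus_def)
          have dx: "dist a x < h" using ab by (simp add: dist_norm)
          have aR: "norm a \<le> R" using sub ab by auto
          then have xW: "x \<in> W" using ab h norm_triangle_ineq[of a b] by (simp add: W_def)
          have "u a - u x \<le> (norm (G x) + \<delta>) * dist a x"
            by (rule has_derivative_inner_bound[OF d _ dx]) (rule Gd)
          also have "\<dots> \<le> (norm (G x) + \<delta>) * h"
            using dx \<delta> by (intro mult_left_mono) (auto intro: add_nonneg_nonneg)
          finally have "u a \<le> v x" using xW by (simp add: v_def mult.commute)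
          then show "x \<in> {x. u x \<le> t \<and> t < v x}" using ab x by simp
        qed
        have "{x. u x \<le> t \<and> t < v x} \<subseteq> W"
          by (auto simp: v_def indicator_def split: if_splits)
        then have "bounded {x. u x \<le> t \<and> t < v x}" by (rule bounded_subset[rotated]) (simp add: W_def)
        then have "emeasure lborel {x. u x \<le> t \<and> t < v x} < \<infinity>" by (rule emeasure_bounded_finite)
        then show "{x. u x \<le> t \<and> t < v x} \<in> fmeasurable lborel"
          by (intro fmeasurableI) auto
      qed (use uA in \<open>auto intro!: sets.Diff borel_open[OF open_set_plus]\<close>)
      finally have "ennreal (h * K) \<le> ennreal (measure lborel {x. u x \<le> t \<and> t < v x})"
        by (rule ennreal_leI)
      also have "\<dots> \<le> emeasure lborel {x. u x \<le> t \<and> t < v x}"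
        by (simp add: measure_def ennreal_enn2real_if)
      finally show "ennreal (h * K) \<le> emeasure lborel {x. u x \<le> t \<and> t < v x}" .
    qed (use s in auto)
    also have "\<dots> = h * ((\<integral>x. norm (G x) \<partial>lborel) + \<delta> * measure lborel W)"
      unfolding vu using Gint Wi by simp
    \<comment> \<open>Both sides are linear in \<open>h\<close>, so the \<open>h\<close> forced by
      uniform continuity simply cancels and only \<delta> has to tend to 0.\<close>
    finally have "h * (s * K) \<le> h * ((\<integral>x. norm (G x) \<partial>lborel) + \<delta> * measure lborel W)"
      by (simp add: mult_ac)
    then show ?thesis using h by simp
  qed
  have "s * K \<le> (\<integral>x. norm (G x) \<partial>lborel)"
  proof (rule field_le_epsilon)
    fix e :: real assume e: "e > 0"
    let ?d = "e / (measure lborel W + 1)"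
    have p: "measure lborel W + 1 > 0" by (simp add: add_nonneg_pos)
    have "s * K \<le> (\<integral>x. norm (G x) \<partial>lborel) + ?d * measure lborel W"
      using e p by (intro main divide_pos_pos)
    also have "?d * measure lborel W \<le> e"
      using e p by (simp add: divide_le_eq mult_left_mono)
    finally show "s * K \<le> (\<integral>x. norm (G x) \<partial>lborel) + e" by simp
  qed
  then show ?thesis by (simp add: K_def mult_ac)
qed

section \<open>Mollification and the isoperimetric inequality\<close>

lemma nn_integral_lborel_translation:
  fixes f :: "'a::euclidean_space \<Rightarrow> ennreal"
  assumes "f \<in> borel_measurable borel"
  shows "(\<integral>\<^sup>+x. f (x - c) \<partial>lborel) = (\<integral>\<^sup>+x. f x \<partial>lborel)"
proof -
  have "(\<integral>\<^sup>+x. f x \<partial>lborel) = (\<integral>\<^sup>+x. f x \<partial>distr lborel borel ((+) (- c)))"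
    by (simp add: lborel_distr_plus)
  also have "\<dots> = (\<integral>\<^sup>+x. f (x - c) \<partial>lborel)"
    using assms by (subst nn_integral_distr) auto
  finally show ?thesis by simp
qed

text \<open>
  \<open>g\<close> is the gradient of \<open>\<rho>\<close>. The quadratic remainder bound \<open>quad\<close> allows convolutions with merely
  integrable functions to be differentiated without a theorem on parameter integrals.
\<close>
locale mollifier =
  fixes \<rho> :: "'a::euclidean_space \<Rightarrow> real" and g :: "'a \<Rightarrow> 'a" and e C L :: real
  assumes e: "0 < e" and nonneg: "0 \<le> \<rho> z"
    and supp: "e \<le> norm z \<Longrightarrow> \<rho> z = 0" and suppg: "e \<le> norm z \<Longrightarrow> g z = 0"
    and even: "\<rho> (- z) = \<rho> z" and odd: "g (- z) = - g z"
    and quad: "norm v \<le> 1 \<Longrightarrow> \<bar>\<rho> (z + v) - \<rho> z - g z \<bullet> v\<bar> \<le> C * (norm v)\<^sup>2"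
    and lip: "norm (g z - g w) \<le> L * norm (z - w)"
    and one: "(\<integral>\<^sup>+z. ennreal (\<rho> z) \<partial>lborel) = 1"
begin

lemma L_nonneg: "0 \<le> L"
proof -
  obtain b :: 'a where b: "b \<in> Basis" using nonempty_Basis by blast
  have "0 \<le> norm (g b - g 0)" by simp
  also have "\<dots> \<le> L * norm (b - 0)" by (rule lip)
  finally show ?thesis using b by simp
qed

lemma g_bound: "norm (g z) \<le> L * (2 * e)"
proof (cases "norm z < e")
  case True
  obtain b :: 'a where b: "b \<in> Basis" using nonempty_Basis by blast
  \<comment> \<open>This point is at distance 2 e from \<open>z\<close>, hence outside the support
    of \<open>g\<close>, and the Lipschitz bound between the two points bounds
    \<open>g z\<close>.\<close>
  let ?w = "z + (2 * e) *\<^sub>R b"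
  have "norm ?w \<ge> 2 * e - norm z"
    using norm_triangle_ineq4[of ?w z] b e by simp
  then have "g ?w = 0" using True by (intro suppg) simp
  then show ?thesis using lip[of ?w z] b e by simp
qed (use suppg L_nonneg e in auto)

lemma g_continuous: "continuous_on UNIV g"
  by (rule lipschitz_on_continuous_on[of L]) (auto intro!: lipschitz_onI lip L_nonneg simp: dist_norm)

lemma rho_has_derivative: "(\<rho> has_derivative (\<lambda>v. g z \<bullet> v)) (at z)"
proof (rule has_derivativeI_sandwich[of 1])
  show "bounded_linear ((\<bullet>) (g z))" by (rule bounded_linear_inner_right)
  show "((\<lambda>y. C * norm (y - z)) \<longlongrightarrow> 0) (at z)"
    by (auto intro!: tendsto_eq_intros)
  fix y assume "y \<noteq> z" "dist y z < 1"
  then show "norm (\<rho> y - \<rho> z - g z \<bullet> (y - z)) / norm (y - z) \<le> C * norm (y - z)"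
    using quad[of "y - z" z] by (simp add: dist_norm divide_le_eq power2_eq_square mult.assoc)
qed auto

lemma rho_continuous: "continuous_on UNIV \<rho>"
  by (intro continuous_at_imp_continuous_on ballI has_derivative_continuous[OF rho_has_derivative])

lemma measurable_rho_g[measurable]: "\<rho> \<in> borel_measurable borel" "g \<in> borel_measurable borel"
  using rho_continuous g_continuous by (auto intro: borel_measurable_continuous_onI)

lemma rho_bound: obtains B where "0 \<le> B" "\<And>z. \<rho> z \<le> B"
proof -
  have "compact (\<rho> ` cball 0 e)"
    by (intro compact_continuous_image continuous_on_subset[OF rho_continuous]) auto
  then obtain B where B: "\<And>z. norm z \<le> e \<Longrightarrow> \<bar>\<rho> z\<bar> \<le> B"
    unfolding bounded_real[of "\<rho> ` cball 0 e"] using compact_imp_bounded bounded_real by force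
  have "0 \<le> B" using B[of 0] e nonneg[of 0] by simp
  moreover have "\<rho> z \<le> B" for z
    using B[of z] supp[of z] \<open>0 \<le> B\<close> by (cases "norm z \<le> e") auto
  ultimately show thesis by (rule that)
qed

lemma one_shift: "(\<integral>\<^sup>+x. ennreal (\<rho> (y - x)) \<partial>lborel) = 1" "(\<integral>\<^sup>+x. ennreal (\<rho> (x - y)) \<partial>lborel) = 1"
proof -
  show *: "(\<integral>\<^sup>+x. ennreal (\<rho> (x - y)) \<partial>lborel) = 1"
    using nn_integral_lborel_translation[of "\<lambda>z. ennreal (\<rho> z)" y] one by simp
  have "\<rho> (y - x) = \<rho> (x - y)" for x using even[of "x - y"] by simp
  then show "(\<integral>\<^sup>+x. ennreal (\<rho> (y - x)) \<partial>lborel) = 1" using * by simp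
qed

lemma integral_rho: "integrable lborel (\<lambda>x. \<rho> (y - x))" "(\<integral>x. \<rho> (y - x) \<partial>lborel) = 1"
proof -
  have h: "has_bochner_integral lborel (\<lambda>x. \<rho> (y - x)) 1"
    by (rule has_bochner_integral_nn_integral) (use nonneg one_shift in auto)
  then show "integrable lborel (\<lambda>x. \<rho> (y - x))" "(\<integral>x. \<rho> (y - x) \<partial>lborel) = 1"
    by (auto simp: has_bochner_integral_iff)
qed

definition conv :: "('a \<Rightarrow> 'b::euclidean_space) \<Rightarrow> 'a \<Rightarrow> 'b" where
  "conv f y = (\<integral>x. \<rho> (y - x) *\<^sub>R f x \<partial>lborel)"

lemma integrable_conv:
  fixes f :: "'a \<Rightarrow> 'b::euclidean_space"
  assumes f: "integrable lborel f"
  shows "integrable lborel (\<lambda>x. \<rho> (y - x) *\<^sub>R f x)"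
proof -
  obtain B where B: "0 \<le> B" "\<And>z. \<rho> z \<le> B" using rho_bound by blast
  show ?thesis
  proof (rule Bochner_Integration.integrable_bound)
    show "integrable lborel (\<lambda>x. B *\<^sub>R f x)" using f by simp
    show "AE x in lborel. norm (\<rho> (y - x) *\<^sub>R f x) \<le> norm (B *\<^sub>R f x)"
      using B nonneg by (auto intro!: mult_right_mono)
  qed (use f in measurable)
qed

lemma integrable_conv_g:
  fixes f :: "'a \<Rightarrow> 'b::euclidean_space"
  assumes f: "integrable lborel f"
  shows "integrable lborel (\<lambda>x. (g (y - x) \<bullet> v) *\<^sub>R f x)"
proof (rule Bochner_Integration.integrable_bound)
  show "integrable lborel (\<lambda>x. (L * (2 * e) * norm v) *\<^sub>R f x)" using f by simp
  have "\<bar>g z \<bullet> v\<bar> \<le> L * (2 * e) * norm v" for z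
    using Cauchy_Schwarz_ineq2[of "g z" v] g_bound[of z] by (meson mult_right_mono norm_ge_zero order_trans)
  then show "AE x in lborel. norm ((g (y - x) \<bullet> v) *\<^sub>R f x) \<le> norm ((L * (2 * e) * norm v) *\<^sub>R f x)"
    using L_nonneg e by (auto intro!: mult_right_mono)
qed (use f in measurable)

text \<open>The derivative of \<open>conv f\<close> at \<open>y\<close> in direction
  \<open>v\<close>, with the differentiation carried entirely by the mollifier, as
  \<open>conv_has_derivative\<close> shows.\<close>

definition dconv :: "('a \<Rightarrow> 'b::euclidean_space) \<Rightarrow> 'a \<Rightarrow> 'a \<Rightarrow> 'b" where
  "dconv f y v = (\<integral>x. (g (y - x) \<bullet> v) *\<^sub>R f x \<partial>lborel)"

lemma dconv_diff_bound:
  fixes f :: "'a \<Rightarrow> 'b::euclidean_space"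
  assumes f: "integrable lborel f"
  shows "norm (dconv f y v - dconv f w v) \<le> L * norm (y - w) * (\<integral>x. norm (f x) \<partial>lborel) * norm v"
proof -
  have "dconv f y v - dconv f w v = (\<integral>x. (g (y - x) \<bullet> v) *\<^sub>R f x - (g (w - x) \<bullet> v) *\<^sub>R f x \<partial>lborel)"
    unfolding dconv_def using integrable_conv_g[OF f] by simp
  also have "norm \<dots> \<le> (\<integral>x. L * norm (y - w) * norm v * norm (f x) \<partial>lborel)"
  proof (rule Bochner_Integration.integral_norm_bound_integral)
    fix x
    have "norm ((g (y - x) \<bullet> v) *\<^sub>R f x - (g (w - x) \<bullet> v) *\<^sub>R f x) = \<bar>(g (y - x) - g (w - x)) \<bullet> v\<bar> * norm (f x)"
      by (simp add: scaleR_left_diff_distrib[symmetric] inner_diff_left)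
    also have "\<bar>(g (y - x) - g (w - x)) \<bullet> v\<bar> \<le> norm (g (y - x) - g (w - x)) * norm v"
      by (rule Cauchy_Schwarz_ineq2)
    also have "\<dots> \<le> L * norm (y - w) * norm v"
      using lip[of "y - x" "w - x"] by (intro mult_right_mono) auto
    finally show "norm ((g (y - x) \<bullet> v) *\<^sub>R f x - (g (w - x) \<bullet> v) *\<^sub>R f x) \<le> L * norm (y - w) * norm v * norm (f x)"
      by (simp add: mult_right_mono)
  qed (use f integrable_conv_g[OF f] in auto)
  finally show ?thesis using f by (simp add: mult_ac)
qed

lemma bounded_linear_dconv:
  fixes f :: "'a \<Rightarrow> 'b::euclidean_space"
  assumes f: "integrable lborel f"
  shows "bounded_linear (dconv f y)"
  unfolding linear_conv_bounded_linear[symmetric] dconv_def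
  using integrable_conv_g[OF f]
  by (intro linearI) (auto simp: inner_add_right scaleR_left_distrib simp flip: scaleR_scaleR)

lemma conv_has_derivative:
  fixes f :: "'a \<Rightarrow> 'b::euclidean_space"
  assumes f: "integrable lborel f"
  shows "(conv f has_derivative dconv f y) (at y)"
proof (rule has_derivativeI_sandwich[of 1])
  let ?I = "\<integral>x. norm (f x) \<partial>lborel"
  show "bounded_linear (dconv f y)" by (rule bounded_linear_dconv[OF f])
  show "((\<lambda>w. C * ?I * norm (w - y)) \<longlongrightarrow> 0) (at y)"
    by (auto intro!: tendsto_eq_intros)
  fix w assume w: "w \<noteq> y" "dist w y < 1"
  have "conv f w - conv f y - dconv f y (w - y)
      = (\<integral>x. \<rho> (w - x) *\<^sub>R f x - \<rho> (y - x) *\<^sub>R f x - (g (y - x) \<bullet> (w - y)) *\<^sub>R f x \<partial>lborel)"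
    unfolding conv_def dconv_def using integrable_conv[OF f] integrable_conv_g[OF f] by simp
  also have "norm \<dots> \<le> (\<integral>x. C * (norm (w - y))\<^sup>2 * norm (f x) \<partial>lborel)"
  proof (rule Bochner_Integration.integral_norm_bound_integral)
    fix x
    have "norm (\<rho> (w - x) *\<^sub>R f x - \<rho> (y - x) *\<^sub>R f x - (g (y - x) \<bullet> (w - y)) *\<^sub>R f x)
        = \<bar>\<rho> ((y - x) + (w - y)) - \<rho> (y - x) - g (y - x) \<bullet> (w - y)\<bar> * norm (f x)"
      by (simp flip: scaleR_left_diff_distrib)
    also have "\<dots> \<le> C * (norm (w - y))\<^sup>2 * norm (f x)"
      using w by (intro mult_right_mono quad) (auto simp: dist_norm)
    finally show "norm (\<rho> (w - x) *\<^sub>R f x - \<rho> (y - x) *\<^sub>R f x - (g (y - x) \<bullet> (w - y)) *\<^sub>R f x) \<le> C * (norm (w - y))\<^sup>2 * norm (f x)" .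
  qed (use f integrable_conv[OF f] integrable_conv_g[OF f] in auto)
  finally show "norm (conv f w - conv f y - dconv f y (w - y)) / norm (w - y) \<le> C * ?I * norm (w - y)"
    using w by (simp add: divide_le_eq power2_eq_square mult_ac)
qed auto

lemma conv_support:
  fixes f :: "'a \<Rightarrow> 'b::euclidean_space"
  assumes "\<And>x. R < norm x \<Longrightarrow> f x = 0" "R + e < norm y"
  shows "conv f y = 0" "dconv f y v = 0"
proof -
  have "\<rho> (y - x) = 0 \<and> g (y - x) = 0 \<or> f x = 0" for x
  proof (cases "R < norm x")
    case False
    then have "e \<le> norm (y - x)" using assms norm_triangle_ineq2[of y x] by simp
    then show ?thesis using supp suppg by blast
  qed (use assms in simp)
  then have z: "\<rho> (y - x) *\<^sub>R f x = 0" "(g (y - x) \<bullet> v) *\<^sub>R f x = 0" for x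
    by (metis scaleR_eq_0_iff inner_zero_left)+
  show "conv f y = 0" "dconv f y v = 0"
    unfolding conv_def dconv_def z by (rule Bochner_Integration.integral_zero)+
qed

text \<open>The Lipschitz bound on \<open>g\<close> passes to the derivative of
  \<open>conv f\<close> in operator norm, which gives its continuity; the support grows by at most
  \<open>e\<close>. So a merely integrable field of bounded support becomes an admissible
  one.\<close>

lemma conv_C1c_field:
  fixes f :: "'a \<Rightarrow> 'a"
  assumes f: "integrable lborel f" and R: "\<And>x. R < norm x \<Longrightarrow> f x = 0"
  shows "conv f \<in> C1c_fields"
  unfolding C1c_fields_def
proof (intro CollectI conjI exI)
  let ?D = "\<lambda>y. Blinfun (dconv f y)"
  let ?I = "\<integral>x. norm (f x) \<partial>lborel"
  have app: "blinfun_apply (?D y) = dconv f y" for y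
    by (rule bounded_linear_Blinfun_apply[OF bounded_linear_dconv[OF f]])
  show "\<forall>y. (conv f has_derivative blinfun_apply (?D y)) (at y)"
    unfolding app using conv_has_derivative[OF f] by blast
  show "continuous_on UNIV ?D"
  proof (rule lipschitz_on_continuous_on[of "L * ?I"], rule lipschitz_onI)
    show "0 \<le> L * ?I" using L_nonneg by simp
    fix y w
    have "norm (?D y - ?D w) \<le> L * norm (y - w) * ?I"
    proof (rule norm_blinfun_bound)
      show "0 \<le> L * norm (y - w) * ?I" using L_nonneg by simp
      show "norm (blinfun_apply (?D y - ?D w) v) \<le> L * norm (y - w) * ?I * norm v" for v
        using dconv_diff_bound[OF f] by (simp add: blinfun.diff_left app)
    qed
    then show "dist (?D y) (?D w) \<le> L * ?I * dist y w" by (simp add: dist_norm mult_ac)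
  qed
  have "{x. conv f x \<noteq> 0} \<subseteq> cball 0 (R + e)" using conv_support(1)[OF R] by force
  then have "bounded {x. conv f x \<noteq> 0}" using bounded_cball bounded_subset by blast
  then show "compact (closure {x. conv f x \<noteq> 0})" by simp
qed

lemma norm_conv_le:
  fixes f :: "'a \<Rightarrow> 'b::euclidean_space"
  assumes f: "integrable lborel f" and b: "\<And>x. norm (f x) \<le> 1"
  shows "norm (conv f y) \<le> 1"
proof -
  have "norm (conv f y) \<le> (\<integral>x. \<rho> (y - x) \<partial>lborel)"
    unfolding conv_def
  proof (rule Bochner_Integration.integral_norm_bound_integral)
    show "norm (\<rho> (y - x) *\<^sub>R f x) \<le> \<rho> (y - x)" for x
      using nonneg[of "y - x"] b[of x] by (simp add: mult_left_le)
  qed (use integrable_conv[OF f] integral_rho in auto)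
  then show ?thesis using integral_rho by simp
qed

lemma divergence_conv:
  fixes f :: "'a \<Rightarrow> 'a"
  assumes f: "integrable lborel f"
  shows "divergence (conv f) y = (\<integral>x. g (y - x) \<bullet> f x \<partial>lborel)"
proof -
  have fd: "frechet_derivative (conv f) (at y) = dconv f y"
    using frechet_derivative_at[OF conv_has_derivative[OF f]] by simp
  have int: "integrable lborel (\<lambda>x. (g (y - x) \<bullet> b) * (f x \<bullet> b))" for b
    using integrable_inner_left[OF integrable_conv_g[OF f, of y b], of b] by simp
  have "divergence (conv f) y = (\<Sum>b\<in>Basis. (\<integral>x. (g (y - x) \<bullet> b) * (f x \<bullet> b) \<partial>lborel))"
    unfolding divergence_def fd dconv_def
  proof (intro sum.cong refl)
    fix b :: 'a
    have "(\<integral>x. (g (y - x) \<bullet> b) *\<^sub>R f x \<partial>lborel) \<bullet> b = (\<integral>x. ((g (y - x) \<bullet> b) *\<^sub>R f x) \<bullet> b \<partial>lborel)"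
      using integrable_conv_g[OF f] by (intro integral_inner_left[symmetric])
    then show "(\<integral>x. (g (y - x) \<bullet> b) *\<^sub>R f x \<partial>lborel) \<bullet> b = (\<integral>x. (g (y - x) \<bullet> b) * (f x \<bullet> b) \<partial>lborel)" by simp
  qed
  also have "\<dots> = (\<integral>x. (\<Sum>b\<in>Basis. (g (y - x) \<bullet> b) * (f x \<bullet> b)) \<partial>lborel)"
    using int by (intro Bochner_Integration.integral_sum[symmetric])
  finally show ?thesis by (simp only: euclidean_inner[symmetric])
qed

text \<open>The gradient of the mollified indicator of \<open>E\<close>;
  \<open>dconv_indicator\<close> makes the connection.\<close>

definition grad :: "'a set \<Rightarrow> 'a \<Rightarrow> 'a" where
  "grad E y = (\<integral>x. indicator E x *\<^sub>R g (y - x) \<partial>lborel)"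

lemma integrable_grad:
  assumes "E \<in> sets borel" "bounded E"
  shows "integrable lborel (\<lambda>x. indicator E x *\<^sub>R g (y - x))"
proof (rule Bochner_Integration.integrable_bound)
  show "integrable lborel (\<lambda>x. indicator E x *\<^sub>R (L * (2 * e)))"
    using assms emeasure_bounded_finite[of E] by (intro integrable_scaleR_left) auto
  show "AE x in lborel. norm (indicator E x *\<^sub>R g (y - x)) \<le> norm (indicator E x *\<^sub>R (L * (2 * e)))"
    using g_bound L_nonneg e by (auto simp: indicator_def)
qed (use assms in measurable)

lemma dconv_indicator:
  assumes "E \<in> sets borel" "bounded E"
  shows "dconv (indicator E) y v = grad E y \<bullet> v"
proof -
  have "grad E y \<bullet> v = (\<integral>x. (indicator E x *\<^sub>R g (y - x)) \<bullet> v \<partial>lborel)"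
    unfolding grad_def using integrable_grad[OF assms] by (intro integral_inner_left[symmetric])
  then show ?thesis by (simp add: dconv_def mult.commute)
qed

lemma grad_continuous:
  assumes E: "E \<in> sets borel" "bounded E"
  shows "continuous_on UNIV (grad E)"
proof -
  have i: "integrable lborel (indicat_real E)" using assms emeasure_bounded_finite[of E] by auto
  have "norm (grad E y - grad E w) \<le> (L * (\<integral>x. norm (indicat_real E x) \<partial>lborel)) * norm (y - w)" for y w
  proof (cases "grad E y = grad E w")
    case False
    \<comment> \<open>Testing the bound for directional derivatives with the difference itself turns
      it into a bound on the norm of the difference.\<close>
    let ?v = "grad E y - grad E w"
    have "norm ?v * norm ?v = ?v \<bullet> ?v" by (simp add: dot_square_norm power2_eq_square)
    also have "\<dots> = dconv (indicat_real E) y ?v - dconv (indicat_real E) w ?v"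
      by (simp add: dconv_indicator[OF E] inner_diff_left)
    also have "\<dots> \<le> L * norm (y - w) * (\<integral>x. norm (indicat_real E x) \<partial>lborel) * norm ?v"
      using dconv_diff_bound[OF i, of y ?v w] by simp
    finally show ?thesis using False by (simp add: mult_ac)
  qed (use L_nonneg in \<open>simp add: zero_le_mult_iff\<close>)
  then show ?thesis
    using L_nonneg
    by (intro lipschitz_on_continuous_on[of "L * (\<integral>x. norm (indicat_real E x) \<partial>lborel)"] lipschitz_onI)
      (auto simp: dist_norm)
qed

text \<open>Duality, with the mollification moved from the field to the set. After Fubini, oddness
  of \<open>g\<close> turns \<open>g (y - x)\<close> into \<open>- g (x - y)\<close>, so the
  divergence of \<open>conv f\<close> integrated over \<open>E\<close> equals the integral of
  \<open>- grad E x \<bullet> f x\<close>.\<close>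

lemma perimeter_ge_grad:
  assumes E: "E \<in> sets borel" "bounded E"
  shows "ennreal (\<integral>x. norm (grad E x) \<partial>lborel) \<le> perimeter E"
proof -
  obtain R where "\<forall>x\<in>E. norm x \<le> R" using E(2) unfolding bounded_iff by (elim exE)
  then have R: "E \<subseteq> cball 0 R" by auto
  \<comment> \<open>The pointwise optimal direction: - grad E x paired with \<open>f x\<close> gives
    the norm. It is only bounded and measurable, so the perimeter is tested with
    \<open>conv f\<close>.\<close>
  define f where "f x = - sgn (grad E x)" for x
  have Gm[measurable]: "grad E \<in> borel_measurable borel"
    using grad_continuous[OF E] by (rule borel_measurable_continuous_onI)
  have fm[measurable]: "f \<in> borel_measurable borel"
    unfolding f_def sgn_div_norm by measurable
  have f1: "norm (f x) \<le> 1" for x by (simp add: f_def norm_sgn)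
  have G0: "grad E x = 0" if "R + e < norm x" for x
  proof -
    have "grad E x \<bullet> grad E x = dconv (indicator E) x (grad E x)" by (simp add: dconv_indicator[OF E])
    also have "\<dots> = 0" by (rule conv_support(2)[of R]) (use R that in \<open>auto simp: indicator_def\<close>)
    finally show ?thesis by simp
  qed
  have f0: "f x = 0" if "R + e < norm x" for x using G0[OF that] by (simp add: f_def)
  have fi: "integrable lborel f"
  proof (rule Bochner_Integration.integrable_bound)
    show "integrable lborel (indicat_real (cball (0::'a) (R + e)))"
      using emeasure_bounded_finite[of "cball (0::'a) (R + e)"] by auto
    show "AE x in lborel. norm (f x) \<le> norm (indicat_real (cball 0 (R + e)) x)"
      using f1 f0 by (auto simp: indicator_def not_le)
  qed simp
  have adm: "conv f \<in> {\<phi> \<in> C1c_fields. \<forall>x. norm (\<phi> x) \<le> 1}"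
    using conv_C1c_field[OF fi f0] norm_conv_le[OF fi f1] by auto
  have [measurable]: "(\<lambda>y. \<integral>x. g (y - x) \<bullet> f x \<partial>lborel) \<in> borel_measurable borel"
    by measurable
  have [measurable]: "E \<in> sets borel" by fact
  have "(\<integral>y. indicator E y * divergence (conv f) y \<partial>lebesgue)
      = (\<integral>y. indicator E y * divergence (conv f) y \<partial>lborel)"
    unfolding divergence_conv[OF fi] by (rule integral_completion) measurable
  also have "\<dots> = (\<integral>y. (\<integral>x. indicator E y * (g (y - x) \<bullet> f x) \<partial>lborel) \<partial>lborel)"
    unfolding divergence_conv[OF fi] by simp
  also have "\<dots> = (\<integral>x. (\<integral>y. indicator E y * (g (y - x) \<bullet> f x) \<partial>lborel) \<partial>lborel)"
  proof (rule lborel_pair.Fubini_integral)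
    show "integrable (lborel \<Otimes>\<^sub>M lborel) (\<lambda>(x, y). indicator E y * (g (y - x) \<bullet> f x))"
    proof (rule Bochner_Integration.integrable_bound)
      let ?S = "cball (0::'a) (R + e) \<times> E"
      have "emeasure (lborel \<Otimes>\<^sub>M lborel) ?S = emeasure lborel (cball (0::'a) (R + e)) * emeasure lborel E"
        by (rule lborel.emeasure_pair_measure_Times) auto
      also have "\<dots> < \<infinity>"
        using emeasure_bounded_finite[OF E(2)] emeasure_bounded_finite[of "cball (0::'a) (R + e)"]
        by (simp add: ennreal_mult_less_top)
      finally have "integrable (lborel \<Otimes>\<^sub>M lborel) (indicat_real ?S)"
        by (intro integrable_real_indicator) auto
      then show "integrable (lborel \<Otimes>\<^sub>M lborel) (\<lambda>p. L * (2 * e) * indicat_real ?S p)" by simp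
      have "\<bar>indicator E y * (g (y - x) \<bullet> f x)\<bar> \<le> L * (2 * e) * indicat_real ?S (x, y)" for x y
      proof (cases "y \<in> E \<and> norm x \<le> R + e")
        case True
        have "\<bar>g (y - x) \<bullet> f x\<bar> \<le> norm (g (y - x)) * norm (f x)" by (rule Cauchy_Schwarz_ineq2)
        also have "\<dots> \<le> L * (2 * e) * 1" using g_bound f1 L_nonneg e by (intro mult_mono) auto
        finally show ?thesis using True by simp
      qed (use f0 L_nonneg e in \<open>auto simp: indicator_def not_le\<close>)
      then show "AE p in lborel \<Otimes>\<^sub>M lborel. norm (case p of (x, y) \<Rightarrow> indicator E y * (g (y - x) \<bullet> f x))
            \<le> norm (L * (2 * e) * indicat_real ?S p)"
        using L_nonneg e by (auto simp: abs_mult)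
    qed measurable
  qed
  also have "\<dots> = (\<integral>x. norm (grad E x) \<partial>lborel)"
  proof (rule Bochner_Integration.integral_cong[OF refl])
    fix x
    have "(\<integral>y. indicator E y * (g (y - x) \<bullet> f x) \<partial>lborel) = (\<integral>y. (indicator E y *\<^sub>R - g (x - y)) \<bullet> f x \<partial>lborel)"
      using odd[of "x - _"] by simp
    also have "\<dots> = (\<integral>y. indicator E y *\<^sub>R - g (x - y) \<partial>lborel) \<bullet> f x"
      using integrable_grad[OF E, of x] by (intro integral_inner_left) auto
    also have "\<dots> = - grad E x \<bullet> f x" by (simp add: grad_def)
    also have "\<dots> = norm (grad E x)"
      by (cases "grad E x = 0") (simp_all add: f_def sgn_div_norm dot_square_norm power2_eq_square)
    finally show "(\<integral>y. indicator E y * (g (y - x) \<bullet> f x) \<partial>lborel) = norm (grad E x)" .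
  qed
  finally have "(\<integral>y. indicator E y * divergence (conv f) y \<partial>lebesgue) = (\<integral>x. norm (grad E x) \<partial>lborel)" .
  then show ?thesis
    unfolding perimeter_def total_variation_def
    using SUP_upper[OF adm, of "\<lambda>\<phi>. ennreal (\<integral>y. indicator E y * divergence \<phi> y \<partial>lebesgue)"] by simp
qed

text \<open>Chebyshev's inequality for 1 - u on \<open>E\<close>. With \<open>w y\<close> the mass
  of the mollifier at \<open>y\<close> that falls outside \<open>E\<close>, one has u + w = 1. By
  Tonelli the integral of \<open>w\<close> over \<open>E\<close> is at most the volume of
  \<open>U - E\<close>: each point outside \<open>E\<close> spreads mass at most 1 over
  \<open>E\<close>, and only points within \<open>e\<close> of \<open>E\<close> contribute. So
  \<open>u\<close> is at most \<open>t\<close> only on a small part of \<open>E\<close>.\<close>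

lemma conv_level_measure:
  assumes E: "compact E" and U: "U \<in> sets borel" "bounded U" "E + ball 0 e \<subseteq> U"
    and t: "0 \<le> t" "t < 1"
  shows "measure lborel E - (measure lborel U - measure lborel E) / (1 - t)
    \<le> measure lborel {y. t < conv (indicat_real E) y}"
proof -
  let ?u = "conv (indicat_real E)"
  have Eb[measurable]: "E \<in> sets borel" "U \<in> sets borel" and bE: "bounded E" using E U
    by (auto simp: compact_imp_closed compact_imp_bounded borel_closed)
  have fin: "emeasure lborel E < \<infinity>" "emeasure lborel U < \<infinity>"
    using emeasure_bounded_finite bE U(2) by auto
  have i: "integrable lborel (indicat_real E)" using fin by auto
  have um[measurable]: "?u \<in> borel_measurable borel"
    by (intro borel_measurable_continuous_onI continuous_at_imp_continuous_on ballI has_derivative_continuous[OF conv_has_derivative[OF i]])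
  define w where "w y = (\<integral>\<^sup>+x. ennreal (\<rho> (y - x)) * indicator (- E) x \<partial>lborel)" for y
  have wm[measurable]: "w \<in> borel_measurable borel" unfolding w_def by measurable
  have uw: "ennreal (?u y) + w y = 1" for y
  proof -
    have "ennreal (?u y) = (\<integral>\<^sup>+x. ennreal (\<rho> (y - x) *\<^sub>R indicator E x) \<partial>lborel)"
      unfolding conv_def using integrable_conv[OF i] nonneg by (intro nn_integral_eq_integral[symmetric]) auto
    also have "\<dots> = (\<integral>\<^sup>+x. ennreal (\<rho> (y - x)) * indicator E x \<partial>lborel)"
      by (intro nn_integral_cong) (simp add: indicator_def)
    finally have "ennreal (?u y) + w y = (\<integral>\<^sup>+x. ennreal (\<rho> (y - x)) * indicator E x + ennreal (\<rho> (y - x)) * indicator (- E) x \<partial>lborel)"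
      unfolding w_def by (simp add: nn_integral_add)
    also have "\<dots> = (\<integral>\<^sup>+x. ennreal (\<rho> (y - x)) \<partial>lborel)"
      by (intro nn_integral_cong) (simp add: indicator_def)
    finally show ?thesis by (simp add: one_shift)
  qed
  have EU: "E \<subseteq> U"
  proof
    fix x assume "x \<in> E"
    then have "x + 0 \<in> E + ball 0 e" using e by (intro set_plus_intro) auto
    then show "x \<in> U" using U by auto
  qed
  have "(\<integral>\<^sup>+y. indicator E y * w y \<partial>lborel)
      = (\<integral>\<^sup>+y. (\<integral>\<^sup>+x. indicator E y * (ennreal (\<rho> (y - x)) * indicator (- E) x) \<partial>lborel) \<partial>lborel)"
    unfolding w_def by (intro nn_integral_cong nn_integral_cmult[symmetric]) measurable
  also have "\<dots> = (\<integral>\<^sup>+x. (\<integral>\<^sup>+y. indicator E y * (ennreal (\<rho> (y - x)) * indicator (- E) x) \<partial>lborel) \<partial>lborel)"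
    by (rule lborel_pair.Fubini') measurable
  also have "\<dots> \<le> (\<integral>\<^sup>+x. (\<integral>\<^sup>+y. indicator (U - E) x * ennreal (\<rho> (y - x)) \<partial>lborel) \<partial>lborel)"
  proof (intro nn_integral_mono)
    fix x y
    show "indicator E y * (ennreal (\<rho> (y - x)) * indicator (- E) x) \<le> indicator (U - E) x * ennreal (\<rho> (y - x))"
    proof (cases "y \<in> E \<and> x \<notin> E \<and> norm (y - x) < e")
      case True
      then have "y + (x - y) \<in> E + ball 0 e" by (intro set_plus_intro) (auto simp: norm_minus_commute)
      then show ?thesis using True U by (auto simp: indicator_def)
    qed (use supp in \<open>auto simp: indicator_def not_less\<close>)
  qed
  also have "\<dots> = (\<integral>\<^sup>+x. indicator (U - E) x * 1 \<partial>lborel)"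
    by (intro nn_integral_cong) (simp add: nn_integral_cmult one_shift)
  also have "\<dots> = emeasure lborel (U - E)" by simp
  also have "\<dots> = ennreal (measure lborel U - measure lborel E)"
  proof -
    have "emeasure lborel (U - E) = ennreal (measure lborel (U - E))"
      using fin emeasure_mono[of "U - E" U lborel] by (intro emeasure_eq_ennreal_measure) (auto simp: top_unique)
    also have "measure lborel (U - E) = measure lborel U - measure lborel E"
      using fin EU by (intro measure_Diff) auto
    finally show ?thesis .
  qed
  finally have wE: "(\<integral>\<^sup>+y. indicator E y * w y \<partial>lborel) \<le> ennreal (measure lborel U - measure lborel E)" .
  let ?N = "{y \<in> E. ?u y \<le> t}"
  have Nf: "emeasure lborel ?N < \<infinity>" using bounded_subset[OF bE] by (intro emeasure_bounded_finite) auto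
  have "ennreal ((1 - t) * measure lborel ?N) = ennreal (1 - t) * emeasure lborel ?N"
    using t Nf by (simp add: ennreal_mult emeasure_eq_ennreal_measure)
  also have "\<dots> = (\<integral>\<^sup>+y. ennreal (1 - t) * indicator ?N y \<partial>lborel)"
    by (intro nn_integral_cmult_indicator[symmetric]) measurable
  also have "\<dots> \<le> (\<integral>\<^sup>+y. indicator E y * w y \<partial>lborel)"
  proof (rule nn_integral_mono)
    fix y
    have "ennreal (1 - t) \<le> w y" if "?u y \<le> t"
    proof (rule ccontr)
      assume "\<not> ennreal (1 - t) \<le> w y"
      then have "w y < ennreal (1 - t)" by simp
      then obtain r where r: "w y = ennreal r" "0 \<le> r" "r < 1 - t"
        by (cases "w y") (auto simp: ennreal_less_iff)
      have "0 \<le> ?u y" unfolding conv_def using nonneg by (intro integral_nonneg_AE) auto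
      then have "?u y + r = 1"
        using uw[of y] r by (simp flip: ennreal_plus)
      then show False using that r by simp
    qed
    then show "ennreal (1 - t) * indicator ?N y \<le> indicator E y * w y"
      by (auto simp: indicator_def)
  qed
  also have "\<dots> \<le> ennreal (measure lborel U - measure lborel E)" by (rule wE)
  finally have "(1 - t) * measure lborel ?N \<le> measure lborel U - measure lborel E"
    using EU U Eb fin by (subst (asm) ennreal_le_iff) (auto intro!: measure_mono_fmeasurable fmeasurableI)
  then have N: "measure lborel ?N \<le> (measure lborel U - measure lborel E) / (1 - t)"
    using t by (simp add: pos_le_divide_eq mult.commute)
  have "measure lborel E - measure lborel ?N = measure lborel (E - ?N)"
    using fin by (intro measure_Diff[symmetric]) auto
  also have "\<dots> \<le> measure lborel {y. t < ?u y}"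
  proof (rule measure_mono_fmeasurable)
    obtain R where "\<forall>x\<in>E. norm x \<le> R" using bE unfolding bounded_iff by (elim exE)
    then have "?u y = 0" if "R + e < norm y" for y
      using that by (intro conv_support(1)[of R]) (auto simp: indicator_def)
    then have "{y. t < ?u y} \<subseteq> cball 0 (R + e)" using t by (force simp: not_less[symmetric])
    then have "emeasure lborel {y. t < ?u y} < \<infinity>"
      using bounded_cball bounded_subset emeasure_bounded_finite by blast
    then show "{y. t < ?u y} \<in> fmeasurable lborel" by (intro fmeasurableI) auto
  qed auto
  finally show ?thesis using N by simp
qed

end

section \<open>An explicit mollifier\<close>

text \<open>The squared positive part is C^1 with Lipschitz derivative 2 max 0 a, hence its
  first-order Taylor remainder is quadratic. This is the source of the axiom \<open>quad\<close> of
  \<open>mollifier\<close>.\<close>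

lemma positive_part_square_quad:
  fixes a b :: real
  shows "\<bar>(max 0 (a + b))\<^sup>2 - (max 0 a)\<^sup>2 - 2 * max 0 a * b\<bar> \<le> b\<^sup>2"
proof (cases "a \<ge> 0"; cases "a + b \<ge> 0")
  assume "a \<ge> 0" "a + b \<ge> 0"
  then show ?thesis by (simp add: max_def power2_eq_square algebra_simps)
next
  assume "a \<ge> 0" "\<not> a + b \<ge> 0"
  then have "0 \<le> a * (- a - 2 * b)" by (intro mult_nonneg_nonneg) auto
  moreover have "a * (- a - 2 * b) \<le> b\<^sup>2"
    using zero_le_power2[of "a + b"] by (simp add: power2_eq_square algebra_simps)
  ultimately show ?thesis using \<open>a \<ge> 0\<close> \<open>\<not> a + b \<ge> 0\<close> by (simp add: max_def power2_eq_square algebra_simps)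
next
  assume "\<not> a \<ge> 0" "a + b \<ge> 0"
  then have "(a + b)\<^sup>2 \<le> b\<^sup>2" by (intro power_mono) auto
  then show ?thesis using \<open>\<not> a \<ge> 0\<close> \<open>a + b \<ge> 0\<close> by (simp add: max_def)
next
  assume "\<not> a \<ge> 0" "\<not> a + b \<ge> 0"
  then show ?thesis by (simp add: max_def)
qed

context
  fixes e :: real
  assumes e: "0 < e"
begin

text \<open>The mollifier is \<open>p\<close> squared, normalised. \<open>p\<close> itself has a
  kink on the sphere of radius \<open>e\<close>; its square has the gradient -4 p(z) z, which is
  Lipschitz.\<close>

private definition "p z = max 0 (e\<^sup>2 - (norm z)\<^sup>2)" for z :: "'a::euclidean_space"

private lemma p_0: "e \<le> norm z \<Longrightarrow> p z = 0"
  using e power_mono[of e "norm z" 2] by (simp add: p_def)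

private lemma p_nonneg: "0 \<le> p z" and p_le: "p z \<le> e\<^sup>2"
  by (auto simp: p_def)

private lemma p_lip: "\<bar>p z - p w\<bar> \<le> 2 * e * norm (z - w)"
proof -
  \<comment> \<open>With the norm truncated at \<open>e\<close>, which is 1-Lipschitz and at most
    \<open>e\<close>, a difference of values of \<open>p\<close> becomes a difference of two
    squares.\<close>
  have eq: "p z = e\<^sup>2 - (min e (norm z))\<^sup>2" for z :: 'a
    using e p_0[of z] power_mono[of "norm z" e 2] by (cases "norm z \<le> e") (auto simp: p_def min_def)
  have "\<bar>p z - p w\<bar> = \<bar>min e (norm z) - min e (norm w)\<bar> * (min e (norm z) + min e (norm w))"
  proof -
    have "p z - p w = - ((min e (norm z) - min e (norm w)) * (min e (norm z) + min e (norm w)))"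
      by (simp add: eq power2_eq_square algebra_simps)
    then show ?thesis using e by (simp add: abs_mult)
  qed
  also have "\<dots> \<le> norm (z - w) * (e + e)"
  proof (rule mult_mono)
    show "\<bar>min e (norm z) - min e (norm w)\<bar> \<le> norm (z - w)"
      using norm_triangle_ineq3[of z w] by (auto simp: min_def)
  qed (use e in auto)
  finally show ?thesis by (simp add: mult_ac)
qed

private lemma pz_lip: "norm (p z *\<^sub>R z - p w *\<^sub>R w) \<le> 3 * e\<^sup>2 * norm (z - w)"
proof -
  have *: "norm (p z *\<^sub>R z - p w *\<^sub>R w) \<le> 3 * e\<^sup>2 * norm (z - w)" if "norm w \<le> e" for z w :: 'a
  proof -
    have "p z *\<^sub>R z - p w *\<^sub>R w = p z *\<^sub>R (z - w) + (p z - p w) *\<^sub>R w"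
      by (simp add: algebra_simps)
    also have "norm \<dots> \<le> p z * norm (z - w) + \<bar>p z - p w\<bar> * norm w"
      by (rule norm_triangle_le) (simp add: p_nonneg)
    also have "\<dots> \<le> e\<^sup>2 * norm (z - w) + (2 * e * norm (z - w)) * e"
      using e that by (intro add_mono mult_mono p_le p_lip) auto
    finally show ?thesis by (simp add: power2_eq_square algebra_simps)
  qed
  consider "norm w \<le> e" | "norm z \<le> e" | "e < norm z" "e < norm w" by linarith
  then show ?thesis
  proof cases
    case 2
    then show ?thesis using *[of z w] by (simp add: norm_minus_commute)
  next
    case 3
    then show ?thesis by (simp add: p_0)
  qed (rule *)
qed

text \<open>If norm z > e + 1, then \<open>z\<close> and \<open>z + v\<close> both lie outside the
  support, as \<open>v\<close> has norm at most 1. Otherwise let \<open>b\<close> be the increment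
  of e^2 - |z|^2. The first constant bounds b^2, since |b| <= (2 e + 3) |v|; the second pays for
  replacing \<open>b\<close> by its linear part -2 (z, v).\<close>

private lemma p_quad:
  assumes "norm v \<le> 1"
  shows "\<bar>(p (z + v))\<^sup>2 - (p z)\<^sup>2 - (- (4 * p z)) * (z \<bullet> v)\<bar> \<le> ((2 * e + 3)\<^sup>2 + 2 * e\<^sup>2) * (norm v)\<^sup>2"
proof (cases "norm z \<le> e + 1")
  case False
  then have "e \<le> norm (z + v)" using assms norm_triangle_ineq4[of "z + v" v] by simp
  then show ?thesis using False by (simp add: p_0)
next
  case True
  define b where "b = - (2 * (z \<bullet> v) + (norm v)\<^sup>2)"
  have zv: "e\<^sup>2 - (norm (z + v))\<^sup>2 = (e\<^sup>2 - (norm z)\<^sup>2) + b"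
    by (simp add: b_def power2_norm_eq_inner inner_add_left inner_add_right inner_commute)
  have "\<bar>z \<bullet> v\<bar> \<le> (e + 1) * norm v"
    using Cauchy_Schwarz_ineq2[of z v] True by (meson mult_right_mono norm_ge_zero order_trans)
  moreover have "(norm v)\<^sup>2 \<le> norm v" using assms by (simp add: power2_eq_square mult_left_le)
  ultimately have "\<bar>b\<bar> \<le> 2 * ((e + 1) * norm v) + norm v"
    unfolding b_def using norm_ge_zero[of v] zero_le_power2[of "norm v"] by linarith
  then have "\<bar>b\<bar> \<le> (2 * e + 3) * norm v" by (simp add: algebra_simps)
  then have b2: "b\<^sup>2 \<le> (2 * e + 3)\<^sup>2 * (norm v)\<^sup>2"
    using power_mono[of "\<bar>b\<bar>" "(2 * e + 3) * norm v" 2] by (simp add: power_mult_distrib)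
  have "\<bar>(p (z + v))\<^sup>2 - (p z)\<^sup>2 - 2 * p z * b\<bar> \<le> b\<^sup>2"
    unfolding p_def zv by (rule positive_part_square_quad)
  moreover have "(p (z + v))\<^sup>2 - (p z)\<^sup>2 - (- (4 * p z)) * (z \<bullet> v)
      = ((p (z + v))\<^sup>2 - (p z)\<^sup>2 - 2 * p z * b) - 2 * p z * (norm v)\<^sup>2"
    by (simp add: b_def algebra_simps)
  moreover have "\<bar>2 * p z * (norm v)\<^sup>2\<bar> \<le> 2 * e\<^sup>2 * (norm v)\<^sup>2"
    using p_nonneg[of z] p_le[of z] by (simp add: abs_mult mult_right_mono)
  ultimately show ?thesis using b2 by (simp add: distrib_right)
qed

lemma mollifier_exists: "\<exists>\<rho> (g :: 'a::euclidean_space \<Rightarrow> 'a) C L. mollifier \<rho> g e C L"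
proof -
  have pc: "continuous_on UNIV (p :: 'a \<Rightarrow> real)" unfolding p_def by (intro continuous_intros)
  then have [measurable]: "(p :: 'a \<Rightarrow> real) \<in> borel_measurable borel"
    by (rule borel_measurable_continuous_onI)
  have b: "ennreal ((p z)\<^sup>2) \<le> ennreal (e ^ 4) * indicator (cball 0 e) z" for z :: 'a
    using p_0[of z] power_mono[OF p_le[of z] p_nonneg, of 2] by (auto simp: indicator_def intro!: ennreal_leI)
  have "(\<integral>\<^sup>+z. ennreal ((p (z::'a))\<^sup>2) \<partial>lborel) \<le> (\<integral>\<^sup>+z. ennreal (e ^ 4) * indicator (cball (0::'a) e) z \<partial>lborel)"
    by (intro nn_integral_mono b)
  also have "\<dots> = ennreal (e ^ 4) * emeasure lborel (cball (0::'a) e)"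
    by (rule nn_integral_cmult_indicator) auto
  also have "\<dots> < \<infinity>" using emeasure_bounded_finite[of "cball (0::'a) e"] by (simp add: ennreal_mult_less_top)
  finally have fin: "(\<integral>\<^sup>+z. ennreal ((p (z::'a))\<^sup>2) \<partial>lborel) < \<infinity>" .
  have nz: "(\<integral>\<^sup>+z. ennreal ((p (z::'a))\<^sup>2) \<partial>lborel) \<noteq> 0"
  proof
    assume "(\<integral>\<^sup>+z. ennreal ((p (z::'a))\<^sup>2) \<partial>lborel) = 0"
    then have "AE z in lborel. ennreal ((p (z::'a))\<^sup>2) = 0"
      by (subst (asm) nn_integral_0_iff_AE) auto
    then have "AE z in lborel. (z::'a) \<notin> ball 0 e"
    proof eventually_elim
      case (elim z)
      then have "p z = 0" using p_nonneg[of z] by simp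
      then have "e\<^sup>2 \<le> (norm z)\<^sup>2" by (auto simp: p_def max_def split: if_splits)
      then show ?case using power_less_imp_less_base[of "norm z" 2 e] e
        by (auto simp: not_less intro: power2_le_imp_le)
    qed
    then have "emeasure lborel (ball (0::'a) e) = 0"
      by (subst (asm) AE_iff_measurable[OF _ refl]) (auto simp: ball_def)
    moreover have "\<not> negligible (ball (0::'a) e)" using open_not_negligible[of "ball (0::'a) e"] e by auto
    ultimately show False by (simp add: negligible_iff_emeasure0)
  qed
  define I where "I = enn2real (\<integral>\<^sup>+z. ennreal ((p (z::'a))\<^sup>2) \<partial>lborel)"
  have I: "I > 0" "(\<integral>\<^sup>+z. ennreal ((p (z::'a))\<^sup>2) \<partial>lborel) = ennreal I"
    using fin nz by (auto simp: I_def enn2real_positive_iff zero_less_iff_neq_zero)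
  \<comment> \<open>The constants are those of \<open>p_quad\<close> and \<open>pz_lip\<close>,
    divided by the normalising integral \<open>I\<close>; the factor 4 of the gradient makes 12 out
    of 3.\<close>
  have "mollifier (\<lambda>z::'a. (p z)\<^sup>2 / I) (\<lambda>z. (- (4 * p z) / I) *\<^sub>R z) e (((2 * e + 3)\<^sup>2 + 2 * e\<^sup>2) / I) (12 * e\<^sup>2 / I)"
  proof
    fix z v w :: 'a
    show "0 < e" by (rule e)
    show "0 \<le> (p z)\<^sup>2 / I" using I by simp
    show "(p z)\<^sup>2 / I = 0" "(- (4 * p z) / I) *\<^sub>R z = 0" if "e \<le> norm z" using p_0[OF that] by auto
    show "(p (- z))\<^sup>2 / I = (p z)\<^sup>2 / I" "(- (4 * p (- z)) / I) *\<^sub>R (- z) = - ((- (4 * p z) / I) *\<^sub>R z)"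
      by (simp_all add: p_def)
    show "\<bar>(p (z + v))\<^sup>2 / I - (p z)\<^sup>2 / I - ((- (4 * p z) / I) *\<^sub>R z) \<bullet> v\<bar>
        \<le> (((2 * e + 3)\<^sup>2 + 2 * e\<^sup>2) / I) * (norm v)\<^sup>2" if "norm v \<le> 1"
    proof -
      have "\<bar>(p (z + v))\<^sup>2 / I - (p z)\<^sup>2 / I - ((- (4 * p z) / I) *\<^sub>R z) \<bullet> v\<bar>
         = \<bar>(p (z + v))\<^sup>2 - (p z)\<^sup>2 - (- (4 * p z)) * (z \<bullet> v)\<bar> / I"
        using I by (simp add: diff_divide_distrib add_divide_distrib abs_div_pos)
      then show ?thesis using p_quad[OF that, of z] I by (simp add: divide_right_mono)
    qed
    have "(- (4 * p z) / I) *\<^sub>R z - (- (4 * p w) / I) *\<^sub>R w = (- 4 / I) *\<^sub>R (p z *\<^sub>R z - p w *\<^sub>R w)"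
      by (simp add: scaleR_right_diff_distrib)
    then have "norm ((- (4 * p z) / I) *\<^sub>R z - (- (4 * p w) / I) *\<^sub>R w) = (4 / I) * norm (p z *\<^sub>R z - p w *\<^sub>R w)"
      using I by simp
    also have "\<dots> \<le> (4 / I) * (3 * e\<^sup>2 * norm (z - w))"
      using I by (intro mult_left_mono pz_lip) auto
    finally show "norm ((- (4 * p z) / I) *\<^sub>R z - (- (4 * p w) / I) *\<^sub>R w) \<le> 12 * e\<^sup>2 / I * norm (z - w)"
      by simp
    have "(\<integral>\<^sup>+z. ennreal ((p (z::'a))\<^sup>2 / I) \<partial>lborel) = (\<integral>\<^sup>+z. ennreal ((p (z::'a))\<^sup>2) / ennreal I \<partial>lborel)"
      using I by (intro nn_integral_cong) (simp add: divide_ennreal)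
    also have "\<dots> = (\<integral>\<^sup>+z. ennreal ((p (z::'a))\<^sup>2) \<partial>lborel) / ennreal I"
      by (rule nn_integral_divide) measurable
    also have "\<dots> = 1" unfolding I(2) using I(1) by (simp add: divide_ennreal)
    finally show "(\<integral>\<^sup>+z. ennreal ((p (z::'a))\<^sup>2 / I) \<partial>lborel) = 1" .
  qed
  then show ?thesis by blast
qed

end

section \<open>The isoperimetric inequality for compact sets\<close>

text \<open>Outer regularity gives an open set of nearly the same volume, and by compactness it
  contains a whole neighbourhood of \<open>E\<close>.\<close>

lemma neighbourhood_measure:
  fixes E :: "'a::euclidean_space set"
  assumes E: "compact E" "E \<noteq> {}" and \<eta>: "0 < \<eta>"
  obtains e where "0 < e" "measure lborel (E + ball 0 e) \<le> measure lborel E + \<eta>"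
proof -
  have "E \<in> sets lebesgue" using E by (simp add: lmeasurable_compact fmeasurableD)
  then obtain V where V: "open V" "E \<subseteq> V" "V - E \<in> lmeasurable" "emeasure lebesgue (V - E) < ennreal \<eta>"
    using sets_lebesgue_outer_open \<eta> by metis
  obtain e where e: "e > 0" "{x. infdist x E \<le> e} \<subseteq> V"
    using compact_in_open_separated[OF E(2,1) V(1,2)] by blast
  let ?U = "E + ball 0 e"
  have "?U \<subseteq> V"
  proof
    fix x assume "x \<in> ?U"
    then obtain a b where ab: "x = a + b" "a \<in> E" "norm b < e" by (auto simp: set_plus_def)
    then have "infdist x E \<le> dist x a" by (intro infdist_le)
    then show "x \<in> V" using e ab by (auto simp: dist_norm)
  qed
  have oU: "open ?U" using open_set_plus[OF open_ball, of 0 e E] by (simp add: add.commute)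
  have bU: "bounded ?U" using E by (intro bounded_set_plus) (auto simp: compact_imp_bounded)
  have Eb: "E \<in> sets borel" "bounded E" using E by (auto simp: compact_imp_closed compact_imp_bounded borel_closed)
  have EU: "E \<subseteq> ?U"
  proof
    fix x assume "x \<in> E"
    then have "x + 0 \<in> ?U" using e by (intro set_plus_intro) auto
    then show "x \<in> ?U" by simp
  qed
  have "measure lborel ?U - measure lborel E = measure lborel (?U - E)"
    using emeasure_bounded_finite[OF bU] emeasure_bounded_finite[OF Eb(2)] oU Eb EU
    by (intro measure_Diff[symmetric]) auto
  also have "\<dots> = measure lebesgue (?U - E)" using oU Eb by simp
  also have "\<dots> \<le> measure lebesgue (V - E)"
    using V \<open>?U \<subseteq> V\<close> oU Eb by (intro measure_mono_fmeasurable) auto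
  also have "\<dots> \<le> \<eta>"
    using V(4) \<eta> by (simp add: emeasure_eq_measure2[OF V(3)] ennreal_less_iff)
  finally show thesis using e by (intro that[of e]) auto
qed

text \<open>The number s < 1 acts twice: only levels below \<open>s\<close> are used, and each
  superlevel set of the mollified indicator is required to keep the fraction \<open>s\<close> of the
  volume of \<open>E\<close>. For every such \<open>s\<close> a fine enough mollification works, so
  the limit is taken in \<open>s\<close> and not in the mollification radius.\<close>

theorem isoperimetric_inequality:
  fixes E :: "'a::euclidean_space set"
  assumes E: "compact E" and pos: "0 < measure lborel E"
  shows "ennreal (DIM('a) * root DIM('a) (unit_ball_vol DIM('a)) * root DIM('a) (measure lborel E) ^ (DIM('a) - 1))
    \<le> perimeter E"
proof (rule tendsto_upperbound)
  let ?n = "DIM('a)" and ?m = "measure lborel E"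
  define K where "K s = ?n * root ?n (unit_ball_vol ?n) * s * root ?n (s * ?m) ^ (?n - 1)" for s :: real
  have "(K \<longlongrightarrow> ?n * root ?n (unit_ball_vol ?n) * 1 * root ?n (1 * ?m) ^ (?n - 1)) (at_left 1)"
    unfolding K_def by (intro tendsto_intros)
  then show "((\<lambda>s. ennreal (K s)) \<longlongrightarrow> ennreal (?n * root ?n (unit_ball_vol ?n) * root ?n ?m ^ (?n - 1))) (at_left 1)"
    by (intro tendsto_ennrealI) simp
  have "ennreal (K s) \<le> perimeter E" if s: "0 < s" "s < 1" for s
  proof -
    have Eb: "E \<in> sets borel" "bounded E" using E by (auto simp: compact_imp_closed compact_imp_bounded borel_closed)
    have ne: "E \<noteq> {}" using pos by auto
    \<comment> \<open>Chosen so that the Chebyshev loss \<eta> / (1 - t) is at most the tolerated (1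
      - s) m for all levels t < s, where m is the volume of \<open>E\<close>.\<close>
    define \<eta> where "\<eta> = (?m - s * ?m) * (1 - s)"
    have \<eta>: "\<eta> > 0" using s pos by (simp add: \<eta>_def)
    obtain e where e: "0 < e" and U: "measure lborel (E + ball 0 e) \<le> ?m + \<eta>"
      using neighbourhood_measure[OF E ne \<eta>] by blast
    obtain \<rho> and g :: "'a \<Rightarrow> 'a" and C L where "mollifier \<rho> g e C L" using mollifier_exists[OF e] by blast
    then interpret mollifier \<rho> g e C L .
    have i: "integrable lborel (indicat_real E)" using emeasure_bounded_finite[OF Eb(2)] Eb by auto
    obtain R where "\<forall>x\<in>E. norm x \<le> R" using Eb(2) unfolding bounded_iff by (elim exE)
    then have R: "indicat_real E x = 0" if "R < norm x" for x using that by (auto simp: indicator_def)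
    have "K s \<le> (\<integral>x. norm (grad E x) \<partial>lborel)"
      unfolding K_def
    proof (rule integral_gradient_ge)
      show "(conv (indicat_real E) has_derivative (\<bullet>) (grad E y)) (at y)" for y
        using conv_has_derivative[OF i, of y] by (simp add: dconv_indicator[OF Eb, abs_def])
      show "continuous_on UNIV (grad E)" by (rule grad_continuous[OF Eb])
      show "conv (indicat_real E) y = 0" if "R + e < norm y" for y
        by (rule conv_support(1)[of R "indicat_real E" y, OF R that])
      show "grad E y = 0" if "R + e < norm y" for y
        using conv_support(2)[of R "indicat_real E" y "grad E y", OF R that] by (simp add: dconv_indicator[OF Eb])
      show "0 \<le> conv (indicat_real E) y" for y
        unfolding conv_def using nonneg by (intro integral_nonneg_AE) auto
      show "0 < s" "0 < s * ?m" using s pos by auto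
      fix t assume t: "0 < t" "t < s"
      have oU: "open (E + ball 0 e)" using open_set_plus[OF open_ball, of 0 e E] by (simp add: add.commute)
      have "(measure lborel (E + ball 0 e) - ?m) / (1 - t) \<le> \<eta> / (1 - t)"
        using U s t by (intro divide_right_mono) auto
      also have "\<dots> \<le> \<eta> / (1 - s)" using \<eta> s t by (intro divide_left_mono) auto
      also have "\<dots> = ?m - s * ?m" using s by (simp add: \<eta>_def)
      finally have "s * ?m \<le> ?m - (measure lborel (E + ball 0 e) - ?m) / (1 - t)" by simp
      also have "\<dots> \<le> measure lborel {y. t < conv (indicat_real E) y}"
        using oU Eb s t by (intro conv_level_measure E bounded_set_plus borel_open) auto
      finally show "s * ?m \<le> measure lborel {y. t < conv (indicat_real E) y}" .
    qed
    then show ?thesis using perimeter_ge_grad[OF Eb] by (meson ennreal_leI order_trans)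
  qed
  then show "\<forall>\<^sub>F s in at_left 1. ennreal (K s) \<le> perimeter E"
    using eventually_at_left_real[of 0 "1::real"] by (auto elim: eventually_mono)
qed simp

section \<open>The perimeter of balls\<close>

lemma integrable_const_indicator_bounded:
  fixes S :: "'a::euclidean_space set" and k :: real
  assumes "S \<in> sets borel" "bounded S"
  shows "integrable lborel (\<lambda>x. k * indicator S x)"
  using assms emeasure_bounded_finite[of S]
  by (intro integrable_mult_right integrable_real_indicator) auto

lemma integral_lborel_translation:
  fixes f :: "'a::euclidean_space \<Rightarrow> real"
  assumes "f \<in> borel_measurable borel"
  shows "(\<integral>x. f (x + c) \<partial>lborel) = (\<integral>x. f x \<partial>lborel)"
proof -
  have "(\<integral>x. f x \<partial>lborel) = (\<integral>x. f x \<partial>distr lborel borel ((+) c))"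
    by (simp add: lborel_distr_plus)
  also have "\<dots> = (\<integral>x. f (c + x) \<partial>lborel)"
    using assms by (subst integral_distr) auto
  finally show ?thesis by (simp add: add.commute)
qed

lemma has_derivative_difference_quotient:
  fixes f :: "'a::euclidean_space \<Rightarrow> real"
  assumes F: "(f has_derivative F) (at x)"
  shows "(\<lambda>n. real (Suc n) * (f (x + (1 / real (Suc n)) *\<^sub>R b) - f x)) \<longlonglongrightarrow> F b"
proof -
  have "((\<lambda>t. f (x + t *\<^sub>R b)) has_derivative (\<lambda>t. F (t *\<^sub>R b))) (at 0)"
    by (rule has_derivative_compose[where g=f]) (auto intro!: derivative_eq_intros simp: F)
  moreover have "(\<lambda>t. F (t *\<^sub>R b)) = (\<lambda>t. F b * t)"
    using F by (auto simp: has_derivative_def linear_simps(5) mult.commute)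
  ultimately have "((\<lambda>t. f (x + t *\<^sub>R b)) has_field_derivative F b) (at 0)"
    by (simp add: has_field_derivative_def)
  then have lim: "(\<lambda>h. (f (x + h *\<^sub>R b) - f x) / h) \<midarrow>0\<rightarrow> F b"
    by (simp add: DERIV_def)
  have "(\<lambda>n. (f (x + (1 / real (Suc n)) *\<^sub>R b) - f x) / (1 / real (Suc n))) \<longlonglongrightarrow> F b"
  proof (rule filterlim_compose[OF lim])
    show "filterlim (\<lambda>n. 1 / real (Suc n)) (at 0) sequentially"
      using LIMSEQ_inverse_real_of_nat by (simp add: filterlim_at inverse_eq_divide)
  qed
  then show ?thesis by (simp add: mult.commute)
qed

text \<open>Difference quotients have integral 0 by translation invariance, and the Lipschitz bound
  dominates them, so the limit has integral 0 as well. Differentiability almost everywhere suffices,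
  which admits functions with kinks such as \<open>cutoff\<close>.\<close>

lemma integral_directional_derivative_eq_0:
  fixes f f' :: "'a::euclidean_space \<Rightarrow> real"
  assumes lip: "\<And>x y. \<bar>f x - f y\<bar> \<le> L * norm (x - y)"
    and supp: "\<And>x. R < norm x \<Longrightarrow> f x = 0"
    and d: "AE x in lborel. \<exists>F. (f has_derivative F) (at x) \<and> F b = f' x"
    and [measurable]: "f' \<in> borel_measurable borel"
  shows "integrable lborel f'" "(\<integral>x. f' x \<partial>lborel) = 0"
proof -
  define s where "s n x = real (Suc n) * (f (x + (1 / real (Suc n)) *\<^sub>R b) - f x)" for n x
  have L: "0 \<le> L * norm b" using lip[of b 0] abs_ge_zero order_trans by (metis diff_zero)
  have fc: "continuous_on UNIV f"
  proof (rule lipschitz_on_continuous_on[of "\<bar>L\<bar>"], rule lipschitz_onI)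
    show "dist (f x) (f y) \<le> \<bar>L\<bar> * dist x y" for x y
      using lip[of x y] by (simp add: dist_norm) (meson abs_ge_self mult_right_mono norm_ge_zero order_trans)
  qed simp
  then have [measurable]: "f \<in> borel_measurable borel" by (rule borel_measurable_continuous_onI)
  have [measurable]: "s n \<in> borel_measurable borel" for n unfolding s_def by measurable
  \<comment> \<open>The steps (1 / Suc n) b are no longer than \<open>b\<close>, so every difference
    quotient vanishes outside radius R + norm b.\<close>
  let ?w = "\<lambda>x. (L * norm b) * indicator (cball 0 (R + norm b)) x"
  have w: "integrable lborel ?w" by (rule integrable_const_indicator_bounded) auto
  have lim: "AE x in lborel. (\<lambda>n. s n x) \<longlonglongrightarrow> f' x"
    using d
  proof eventually_elim
    case (elim x)
    then obtain F where "(f has_derivative F) (at x)" "F b = f' x" by blast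
    then show ?case using has_derivative_difference_quotient[of f F x b] by (simp add: s_def)
  qed
  have bd: "norm (s n x) \<le> ?w x" for n x
  proof (cases "norm x \<le> R + norm b")
    case True
    have "\<bar>f (x + (1 / real (Suc n)) *\<^sub>R b) - f x\<bar> \<le> L * norm ((1 / real (Suc n)) *\<^sub>R b)"
      using lip[of "x + (1 / real (Suc n)) *\<^sub>R b" x] by simp
    then have "real (Suc n) * \<bar>f (x + (1 / real (Suc n)) *\<^sub>R b) - f x\<bar> \<le> real (Suc n) * (L * norm ((1 / real (Suc n)) *\<^sub>R b))"
      by (intro mult_left_mono) auto
    also have "\<dots> = L * norm b" by simp
    finally show ?thesis using True by (simp add: s_def abs_mult)
  next
    case False
    have "norm ((1 / real (Suc n)) *\<^sub>R b) \<le> norm b" by (simp add: divide_le_eq mult_left_le algebra_simps)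
    then have "R < norm (x + (1 / real (Suc n)) *\<^sub>R b)"
      using False norm_triangle_ineq4[of "x + (1 / real (Suc n)) *\<^sub>R b" "(1 / real (Suc n)) *\<^sub>R b"] by simp
    moreover have "R < norm x" using False norm_ge_zero[of b] by linarith
    ultimately show ?thesis using False supp by (simp add: s_def)
  qed
  show "integrable lborel f'"
    by (rule integrable_dominated_convergence[where s=s and w="?w"]) (use w lim bd in auto)
  have "(\<lambda>n. \<integral>x. s n x \<partial>lborel) \<longlonglongrightarrow> (\<integral>x. f' x \<partial>lborel)"
    by (rule integral_dominated_convergence[where w="?w"]) (use w lim bd in auto)
  moreover have "(\<integral>x. s n x \<partial>lborel) = 0" for n
  proof -
    have "compact (f ` cball 0 R)" by (intro compact_continuous_image continuous_on_subset[OF fc]) auto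
    then obtain B where B: "\<And>x. norm x \<le> R \<Longrightarrow> \<bar>f x\<bar> \<le> B"
      using compact_imp_bounded[of "f ` cball 0 R"] unfolding bounded_real by force
    have fi: "integrable lborel f"
    proof (rule Bochner_Integration.integrable_bound)
      show "integrable lborel (\<lambda>x. B * indicator (cball (0::'a) R) x)"
        by (rule integrable_const_indicator_bounded) auto
      show "AE x in lborel. norm (f x) \<le> norm (B * indicator (cball (0::'a) R) x)"
        using B supp by (auto simp: indicator_def not_le intro: order_trans[OF B abs_ge_self])
    qed simp
    have fi2: "integrable lborel (\<lambda>x. f (x + c))" for c
    proof -
      have "integrable (distr lborel borel ((+) c)) f" using fi by (simp add: lborel_distr_plus)
      then have "integrable lborel (\<lambda>x. f (c + x))" by (subst (asm) integrable_distr_eq) auto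
      then show ?thesis by (simp add: add.commute)
    qed
    show ?thesis unfolding s_def using fi fi2 integral_lborel_translation[of f] by simp
  qed
  ultimately show "(\<integral>x. f' x \<partial>lborel) = 0" using LIMSEQ_unique[OF _ tendsto_const[of 0]] by simp
qed

text \<open>The uniform bound on the derivative comes from compactness inside the support ball;
  outside, the field vanishes on an open set and so does its derivative.\<close>

lemma C1c_fieldsE:
  fixes \<phi> :: "'a::euclidean_space \<Rightarrow> 'a"
  assumes "\<phi> \<in> C1c_fields"
  obtains D R M where "\<And>x. (\<phi> has_derivative D x) (at x)" "\<And>x. R < norm x \<Longrightarrow> \<phi> x = 0"
    "0 \<le> M" "\<And>x v. norm (D x v) \<le> M * norm v" "\<And>v. continuous_on UNIV (\<lambda>x. D x v)"
proof -
  obtain \<phi>' :: "'a \<Rightarrow> 'a \<Rightarrow>\<^sub>L 'a" where d: "\<And>x. (\<phi> has_derivative blinfun_apply (\<phi>' x)) (at x)"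
    and c: "continuous_on UNIV \<phi>'" and k: "compact (closure {x. \<phi> x \<noteq> 0})"
    using assms unfolding C1c_fields_def by blast
  have "bounded {x. \<phi> x \<noteq> 0}" by (rule bounded_subset[OF compact_imp_bounded[OF k] closure_subset])
  then obtain R where "\<forall>x\<in>{x. \<phi> x \<noteq> 0}. norm x \<le> R" unfolding bounded_iff by (elim exE)
  then have R: "\<phi> x = 0" if "R < norm x" for x using that by fastforce
  have "compact (\<phi>' ` cball 0 R)" by (intro compact_continuous_image continuous_on_subset[OF c]) auto
  then obtain B where B: "\<And>x. norm x \<le> R \<Longrightarrow> norm (\<phi>' x) \<le> B"
    using compact_imp_bounded[of "\<phi>' ` cball 0 R"] unfolding bounded_iff by force
  have z: "\<phi>' x = 0" if x: "R < norm x" for x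
  proof -
    have "(\<phi> has_derivative (\<lambda>v. 0)) (at x)"
    proof (rule has_derivative_transform_within_open[where s="{x. R < norm x}"])
      show "open {x::'a. R < norm x}" by (intro open_Collect_less continuous_intros)
    qed (use x R in auto)
    then have "blinfun_apply (\<phi>' x) = (\<lambda>v. 0)" using d has_derivative_unique by blast
    then show ?thesis by (intro blinfun_eqI) simp
  qed
  have M: "norm (\<phi>' x) \<le> max 0 B" for x
    using B[of x] z[of x] by (cases "R < norm x") auto
  show thesis
  proof (rule that[of "\<lambda>x. blinfun_apply (\<phi>' x)" R "max 0 B"])
    show "norm (blinfun_apply (\<phi>' x) v) \<le> max 0 B * norm v" for x v
      using norm_blinfun[of "\<phi>' x" v] M[of x] by (meson mult_right_mono norm_ge_zero order_trans)
    show "continuous_on UNIV (\<lambda>x. blinfun_apply (\<phi>' x) v)" for v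
      by (intro bounded_bilinear.continuous_on[OF bounded_bilinear_blinfun_apply] c continuous_on_const)
  qed (use d R in auto)
qed

section \<open>Radial cutoffs and the divergence theorem on balls\<close>

definition cutoff :: "'a::euclidean_space \<Rightarrow> real \<Rightarrow> real \<Rightarrow> 'a \<Rightarrow> real" where
  "cutoff c r \<epsilon> x = min 1 (max 0 ((r + \<epsilon> - norm (x - c)) / \<epsilon>))"

text \<open>The gradient of \<open>cutoff\<close> off the two spheres of radii r and r + \<epsilon>,
  where \<open>cutoff\<close> has its kinks. The value 0 on them is a convention; they are
  null.\<close>

definition cutoff_grad :: "'a::euclidean_space \<Rightarrow> real \<Rightarrow> real \<Rightarrow> 'a \<Rightarrow> 'a" where
  "cutoff_grad c r \<epsilon> x = (if r < norm (x - c) \<and> norm (x - c) < r + \<epsilon> then - (1 / \<epsilon>) *\<^sub>R sgn (x - c) else 0)"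

lemma cutoff_eq_0: "0 < \<epsilon> \<Longrightarrow> r + \<epsilon> \<le> norm (x - c) \<Longrightarrow> cutoff c r \<epsilon> x = 0"
  and cutoff_eq_1: "0 < \<epsilon> \<Longrightarrow> norm (x - c) \<le> r \<Longrightarrow> cutoff c r \<epsilon> x = 1"
  by (auto simp: cutoff_def max_absorb1 divide_le_0_iff min_def max_def pos_divide_le_eq field_simps)

lemma cutoff_lipschitz:
  assumes "0 < \<epsilon>"
  shows "\<bar>cutoff c r \<epsilon> x - cutoff c r \<epsilon> y\<bar> \<le> (1 / \<epsilon>) * norm (x - y)"
proof -
  have "\<bar>cutoff c r \<epsilon> x - cutoff c r \<epsilon> y\<bar> \<le> \<bar>(r + \<epsilon> - norm (x - c)) / \<epsilon> - (r + \<epsilon> - norm (y - c)) / \<epsilon>\<bar>"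
    unfolding cutoff_def by linarith
  also have "\<dots> = \<bar>norm (y - c) - norm (x - c)\<bar> / \<epsilon>"
  proof -
    have "(r + \<epsilon> - norm (x - c)) / \<epsilon> - (r + \<epsilon> - norm (y - c)) / \<epsilon> = (norm (y - c) - norm (x - c)) / \<epsilon>"
      by (simp add: diff_divide_distrib)
    then show ?thesis using assms by (simp add: abs_divide)
  qed
  also have "\<dots> \<le> norm (x - y) / \<epsilon>"
    using assms norm_triangle_ineq3[of "y - c" "x - c"]
    by (intro divide_right_mono) (auto simp: norm_minus_commute)
  finally show ?thesis by simp
qed

lemma cutoff_has_derivative:
  assumes \<epsilon>: "0 < \<epsilon>" and r: "0 < r" and x: "norm (x - c) \<noteq> r" "norm (x - c) \<noteq> r + \<epsilon>"
  shows "(cutoff c r \<epsilon> has_derivative (\<lambda>v. cutoff_grad c r \<epsilon> x \<bullet> v)) (at x)"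
proof -
  consider "norm (x - c) < r" | "r < norm (x - c)" "norm (x - c) < r + \<epsilon>" | "r + \<epsilon> < norm (x - c)"
    using x by linarith
  then show ?thesis
  proof cases
    case 1
    have "((\<lambda>x. 1 :: real) has_derivative (\<lambda>v. 0)) (at x)" by simp
    then have "(cutoff c r \<epsilon> has_derivative (\<lambda>v. 0)) (at x)"
    proof (rule has_derivative_transform_within_open[where s="{x. norm (x - c) < r}"])
      show "open {x. norm (x - c) < r}" by (intro open_Collect_less continuous_intros)
    qed (use 1 \<epsilon> in \<open>auto simp: cutoff_def\<close>)
    then show ?thesis using 1 by (simp add: cutoff_grad_def)
  next
    case 2
    have "x - c \<noteq> 0" using 2 r by auto
    have "((\<lambda>x. norm (x - c)) has_derivative (\<lambda>v. sgn (x - c) \<bullet> v)) (at x)"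
      by (rule has_derivative_compose[where g=norm, THEN has_derivative_eq_rhs])
        (auto intro!: derivative_eq_intros has_derivative_norm[OF \<open>x - c \<noteq> 0\<close>] simp: inner_commute)
    then have "((\<lambda>x. (r + \<epsilon> - norm (x - c)) / \<epsilon>) has_derivative (\<lambda>v. (0 - sgn (x - c) \<bullet> v) / \<epsilon>)) (at x)"
      by (intro has_derivative_diff has_derivative_const bounded_linear.has_derivative[OF bounded_linear_divide])
    then have "(cutoff c r \<epsilon> has_derivative (\<lambda>v. (0 - sgn (x - c) \<bullet> v) / \<epsilon>)) (at x)"
    proof (rule has_derivative_transform_within_open[where s="{x. r < norm (x - c)} \<inter> {x. norm (x - c) < r + \<epsilon>}"])
      show "open ({x. r < norm (x - c)} \<inter> {x. norm (x - c) < r + \<epsilon>})"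
        by (intro open_Int open_Collect_less continuous_intros)
    qed (use 2 \<epsilon> in \<open>auto simp: cutoff_def\<close>)
    moreover have "(\<lambda>v. (0 - sgn (x - c) \<bullet> v) / \<epsilon>) = (\<lambda>v. cutoff_grad c r \<epsilon> x \<bullet> v)"
      using 2 by (simp add: cutoff_grad_def fun_eq_iff)
    ultimately show ?thesis by simp
  next
    case 3
    have "((\<lambda>x. 0 :: real) has_derivative (\<lambda>v. 0)) (at x)" by simp
    then have "(cutoff c r \<epsilon> has_derivative (\<lambda>v. 0)) (at x)"
    proof (rule has_derivative_transform_within_open[where s="{x. r + \<epsilon> < norm (x - c)}"])
      show "open {x. r + \<epsilon> < norm (x - c)}" by (intro open_Collect_less continuous_intros)
    qed (use 3 \<epsilon> in \<open>auto simp: cutoff_eq_0\<close>)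
    then show ?thesis using 3 by (simp add: cutoff_grad_def)
  qed
qed

text \<open>
  Integrating the divergence of \<open>cutoff c r \<epsilon> * \<phi>\<close>, a Lipschitz field with compact support, gives 0.
\<close>
lemma cutoff_divergence:
  fixes \<phi> :: "'a::euclidean_space \<Rightarrow> 'a"
  assumes D: "\<And>x. (\<phi> has_derivative D x) (at x)" and R: "\<And>x. R < norm x \<Longrightarrow> \<phi> x = 0"
    and M: "0 \<le> M" "\<And>x v. norm (D x v) \<le> M * norm v" and Dc: "\<And>v. continuous_on UNIV (\<lambda>x. D x v)"
    and b1: "\<And>x. norm (\<phi> x) \<le> 1" and \<epsilon>: "0 < \<epsilon>" and r: "0 < r"
  shows "(\<integral>x. cutoff c r \<epsilon> x * divergence \<phi> x \<partial>lborel) \<le> measure lborel (ball c (r + \<epsilon>) - ball c r) / \<epsilon>"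
proof -
  let ?\<eta> = "cutoff c r \<epsilon>" and ?H = "cutoff_grad c r \<epsilon>"
  define A where "A = ball c (r + \<epsilon>) - ball c r"
  have phic: "continuous_on UNIV \<phi>"
    by (intro continuous_at_imp_continuous_on ballI has_derivative_continuous[OF D])
  have [measurable]: "\<phi> \<in> borel_measurable borel" using phic by (rule borel_measurable_continuous_onI)
  have [measurable]: "(\<lambda>x. D x v) \<in> borel_measurable borel" for v using Dc by (rule borel_measurable_continuous_onI)
  have [measurable]: "?\<eta> \<in> borel_measurable borel" unfolding cutoff_def by measurable
  have [measurable]: "?H \<in> borel_measurable borel" unfolding cutoff_grad_def sgn_div_norm by measurable
  have \<eta>01: "0 \<le> ?\<eta> x" "?\<eta> x \<le> 1" for x by (auto simp: cutoff_def)
  have div: "divergence \<phi> x = (\<Sum>b\<in>Basis. D x b \<bullet> b)" for x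
    using frechet_derivative_at[OF D[of x]] by (simp add: divergence_def)
  \<comment> \<open>The product rule for the derivative along \<open>b\<close> of the component of
    the truncated field along \<open>b\<close>; the sum over the basis is its divergence.\<close>
  define f' where "f' b x = ?\<eta> x * (D x b \<bullet> b) + (?H x \<bullet> b) * (\<phi> x \<bullet> b)" for b x
  have [measurable]: "f' b \<in> borel_measurable borel" for b unfolding f'_def by measurable
  have phil: "norm (\<phi> x - \<phi> y) \<le> M * norm (x - y)" for x y
  proof (rule differentiable_bound[of UNIV \<phi> D])
    show "onorm (D z) \<le> M" for z by (rule onorm_bound) (use M in auto)
  qed (use D in auto)
  have *: "integrable lborel (f' b) \<and> (\<integral>x. f' b x \<partial>lborel) = 0" if b: "b \<in> Basis" for b
  proof -
    let ?f = "\<lambda>x. ?\<eta> x * (\<phi> x \<bullet> b)"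
    have 1: "\<bar>?f x - ?f y\<bar> \<le> (M + 1 / \<epsilon>) * norm (x - y)" for x y
    proof -
      have "?f x - ?f y = ?\<eta> x * ((\<phi> x - \<phi> y) \<bullet> b) + (?\<eta> x - ?\<eta> y) * (\<phi> y \<bullet> b)"
        by (simp add: inner_diff_left algebra_simps)
      also have "\<bar>\<dots>\<bar> \<le> ?\<eta> x * \<bar>(\<phi> x - \<phi> y) \<bullet> b\<bar> + \<bar>?\<eta> x - ?\<eta> y\<bar> * \<bar>\<phi> y \<bullet> b\<bar>"
        using \<eta>01[of x] by (intro order_trans[OF abs_triangle_ineq]) (simp add: abs_mult)
      also have "\<dots> \<le> 1 * (M * norm (x - y)) + ((1 / \<epsilon>) * norm (x - y)) * 1"
        using \<eta>01 order_trans[OF Basis_le_norm[OF b] phil] order_trans[OF Basis_le_norm[OF b] b1]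
          cutoff_lipschitz[OF \<epsilon>] \<epsilon>
        by (intro add_mono mult_mono) auto
      finally show ?thesis by (simp add: algebra_simps)
    qed
    have 3: "AE x in lborel. \<exists>F. (?f has_derivative F) (at x) \<and> F b = f' b x"
    proof -
      have "AE x in lborel. x \<notin> sphere c r \<union> sphere c (r + \<epsilon>)"
        using negligible_sphere[of c r] negligible_sphere[of c "r + \<epsilon>"]
        by (intro AE_not_in) (auto simp: negligible_iff_null_sets null_sets_completion_iff intro!: null_sets.Un)
      then show ?thesis
      proof eventually_elim
        case (elim x)
        then have x: "norm (x - c) \<noteq> r" "norm (x - c) \<noteq> r + \<epsilon>" by (auto simp: dist_norm norm_minus_commute)
        have "((\<lambda>x. \<phi> x \<bullet> b) has_derivative (\<lambda>v. D x v \<bullet> b)) (at x)"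
          by (rule bounded_linear.has_derivative[OF bounded_linear_inner_left D])
        then have "(?f has_derivative (\<lambda>v. ?\<eta> x * (D x v \<bullet> b) + (?H x \<bullet> v) * (\<phi> x \<bullet> b))) (at x)"
          by (rule has_derivative_mult[OF cutoff_has_derivative[OF \<epsilon> r x]])
        then show ?case
          by (intro exI[of _ "\<lambda>v. ?\<eta> x * (D x v \<bullet> b) + (?H x \<bullet> v) * (\<phi> x \<bullet> b)"]) (simp add: f'_def)
      qed
    qed
    show ?thesis
      using integral_directional_derivative_eq_0[OF 1 _ 3, of R] R by auto
  qed
  have sum: "(\<Sum>b\<in>Basis. f' b x) = ?\<eta> x * divergence \<phi> x + ?H x \<bullet> \<phi> x" for x
    unfolding f'_def div sum.distrib sum_distrib_left by (subst euclidean_inner[of "?H x"]) (rule refl)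
  have "integrable lborel (\<lambda>x. \<Sum>b\<in>Basis. f' b x)" "(\<integral>x. (\<Sum>b\<in>Basis. f' b x) \<partial>lborel) = 0"
    using * by (auto simp: Bochner_Integration.integral_sum)
  then have tot: "integrable lborel (\<lambda>x. ?\<eta> x * divergence \<phi> x + ?H x \<bullet> \<phi> x)"
    "(\<integral>x. ?\<eta> x * divergence \<phi> x + ?H x \<bullet> \<phi> x \<partial>lborel) = 0" by (simp_all add: sum)
  have Af: "integrable lborel (\<lambda>x. (1 / \<epsilon>) * indicator A x)"
    unfolding A_def by (rule integrable_const_indicator_bounded) (auto simp: bounded_diff)
  have Hb: "\<bar>?H x \<bullet> \<phi> x\<bar> \<le> (1 / \<epsilon>) * indicator A x" for x
  proof (cases "x \<in> A")
    case True
    have "\<bar>?H x \<bullet> \<phi> x\<bar> \<le> norm (?H x) * norm (\<phi> x)" by (rule Cauchy_Schwarz_ineq2)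
    also have "\<dots> \<le> (1 / \<epsilon>) * 1"
      using b1 \<epsilon> by (intro mult_mono) (auto simp: cutoff_grad_def norm_sgn)
    finally show ?thesis using True by simp
  next
    case False
    then have "?H x = 0" by (auto simp: A_def cutoff_grad_def dist_norm norm_minus_commute)
    then show ?thesis using False by simp
  qed
  have Hi: "integrable lborel (\<lambda>x. ?H x \<bullet> \<phi> x)"
    by (rule Bochner_Integration.integrable_bound[OF Af]) (use Hb \<epsilon> in \<open>auto simp: abs_mult\<close>)
  have di: "integrable lborel (\<lambda>x. ?\<eta> x * divergence \<phi> x)"
    using Bochner_Integration.integrable_diff[OF tot(1) Hi] by simp
  have "(\<integral>x. ?\<eta> x * divergence \<phi> x \<partial>lborel) = (\<integral>x. - (?H x \<bullet> \<phi> x) \<partial>lborel)"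
    using tot(2) di Hi by simp
  also have "\<dots> \<le> (\<integral>x. (1 / \<epsilon>) * indicator A x \<partial>lborel)"
  proof (rule integral_mono)
    show "- (?H x \<bullet> \<phi> x) \<le> (1 / \<epsilon>) * indicator A x" for x using Hb[of x] by linarith
  qed (use Hi Af in auto)
  also have "\<dots> = measure lborel A / \<epsilon>" by (simp add: A_def)
  finally show ?thesis by (simp add: A_def)
qed

text \<open>Gauss's theorem as an inequality, with no surface measure: the flux through the sphere
  is replaced by the volume of the annulus of width \<epsilon> divided by \<epsilon>. As \<epsilon>
  tends to 0 this becomes the derivative of the volume of the ball in the radius.\<close>

lemma integral_divergence_ball_le:
  fixes \<phi> :: "'a::euclidean_space \<Rightarrow> 'a"
  assumes \<phi>: "\<phi> \<in> C1c_fields" and b1: "\<And>x. norm (\<phi> x) \<le> 1" and r: "0 < r"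
  shows "integrable lborel (\<lambda>x. indicator (ball c r) x * divergence \<phi> x)"
    "(\<integral>x. indicator (ball c r) x * divergence \<phi> x \<partial>lborel) \<le> DIM('a) * unit_ball_vol DIM('a) * r ^ (DIM('a) - 1)"
proof -
  obtain D R M where D: "\<And>x. (\<phi> has_derivative D x) (at x)" and R: "\<And>x. R < norm x \<Longrightarrow> \<phi> x = 0"
    and M: "0 \<le> M" "\<And>x v. norm (D x v) \<le> M * norm v" and Dc: "\<And>v. continuous_on UNIV (\<lambda>x. D x v)"
    using C1c_fieldsE[OF \<phi>] by metis
  let ?n = "DIM('a)" and ?B = "ball c r"
  have div: "divergence \<phi> x = (\<Sum>b\<in>Basis. D x b \<bullet> b)" for x
    using frechet_derivative_at[OF D[of x]] by (simp add: divergence_def)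
  have [measurable]: "(\<lambda>x. D x v) \<in> borel_measurable borel" for v using Dc by (rule borel_measurable_continuous_onI)
  have dm[measurable]: "divergence \<phi> \<in> borel_measurable borel"
    unfolding div[abs_def] by measurable
  have db: "\<bar>divergence \<phi> x\<bar> \<le> ?n * M" for x
  proof -
    have "\<bar>divergence \<phi> x\<bar> \<le> (\<Sum>b\<in>(Basis::'a set). \<bar>D x b \<bullet> b\<bar>)" unfolding div by (rule sum_abs)
    also have "\<dots> \<le> (\<Sum>b\<in>(Basis::'a set). M)"
    proof (rule sum_mono)
      fix b :: 'a assume "b \<in> Basis"
      then show "\<bar>D x b \<bullet> b\<bar> \<le> M" using Basis_le_norm[of b "D x b"] M(2)[of x b] by simp
    qed
    finally show ?thesis by simp
  qed
  have bi: "integrable lborel (\<lambda>x. h x * divergence \<phi> x)"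
    if "h \<in> borel_measurable borel" "\<And>x. \<bar>h x\<bar> \<le> indicator S x" "bounded S" "S \<in> sets borel" for h S
  proof (rule Bochner_Integration.integrable_bound)
    show "integrable lborel (\<lambda>x. (?n * M) * indicator S x)"
      using that by (intro integrable_const_indicator_bounded)
    have "\<bar>h x * divergence \<phi> x\<bar> \<le> indicator S x * (?n * M)" for x
      unfolding abs_mult using that db by (intro mult_mono) auto
    then show "AE x in lborel. norm (h x * divergence \<phi> x) \<le> norm ((?n * M) * indicator S x)"
      using M by (auto simp: abs_mult mult.commute)
  qed (use that in measurable)
  show Bi: "integrable lborel (\<lambda>x. indicator ?B x * divergence \<phi> x)"
    by (rule bi[of _ ?B]) (auto intro: borel_measurable_indicator)
  \<comment> \<open>The first term comes from \<open>cutoff_divergence\<close>. The second is the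
    cost of replacing the indicator by the cutoff: they differ only on the annulus, where the
    divergence is at most d M, and it vanishes with \<epsilon>.\<close>
  have le: "(\<integral>x. indicator ?B x * divergence \<phi> x \<partial>lborel)
      \<le> unit_ball_vol ?n * (((r + \<epsilon>) ^ ?n - r ^ ?n) / \<epsilon>) + ?n * M * unit_ball_vol ?n * ((r + \<epsilon>) ^ ?n - r ^ ?n)" if \<epsilon>: "0 < \<epsilon>" for \<epsilon>
  proof -
    let ?\<eta> = "cutoff c r \<epsilon>"
    define A where "A = ball c (r + \<epsilon>) - ball c r"
    have Af: "integrable lborel (\<lambda>x. (?n * M) * indicator A x)"
      unfolding A_def by (rule integrable_const_indicator_bounded) (auto simp: bounded_diff)
    have mA: "measure lborel A = unit_ball_vol ?n * ((r + \<epsilon>) ^ ?n - r ^ ?n)"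
    proof -
      have "measure lborel A = measure lborel (ball c (r + \<epsilon>)) - measure lborel (ball c r)"
        unfolding A_def using \<epsilon> emeasure_bounded_finite[of "ball c (r + \<epsilon>)"] emeasure_bounded_finite[of "ball c r"]
        by (intro measure_Diff) (auto simp: top.not_eq_extremum)
      then show ?thesis using r \<epsilon> by (simp add: content_ball algebra_simps)
    qed
    have [measurable]: "?\<eta> \<in> borel_measurable borel" unfolding cutoff_def by measurable
    have \<eta>B: "\<bar>?\<eta> x - indicator ?B x\<bar> \<le> indicator A x" for x
    proof -
      have "?\<eta> x = 1" if "norm (x - c) < r" using that \<epsilon> by (simp add: cutoff_eq_1)
      moreover have "?\<eta> x = 0" if "r + \<epsilon> \<le> norm (x - c)" using that \<epsilon> by (simp add: cutoff_eq_0)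
      moreover have "0 \<le> ?\<eta> x" "?\<eta> x \<le> 1" by (auto simp: cutoff_def)
      ultimately show ?thesis
        by (auto simp: A_def indicator_def dist_norm norm_minus_commute not_less)
    qed
    have i1: "integrable lborel (\<lambda>x. (?\<eta> x - indicator ?B x) * divergence \<phi> x)"
    proof (rule bi[of _ A])
      show "(\<lambda>x. ?\<eta> x - indicator ?B x) \<in> borel_measurable borel"
        by (intro borel_measurable_diff borel_measurable_indicator) auto
    qed (use \<eta>B in \<open>auto simp: A_def bounded_diff\<close>)
    have i2: "integrable lborel (\<lambda>x. ?\<eta> x * divergence \<phi> x)"
      using Bochner_Integration.integrable_add[OF i1 Bi] by (simp add: algebra_simps)
    have "(\<integral>x. indicator ?B x * divergence \<phi> x \<partial>lborel)
      = (\<integral>x. ?\<eta> x * divergence \<phi> x - (?\<eta> x - indicator ?B x) * divergence \<phi> x \<partial>lborel)"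
      by (simp add: algebra_simps)
    also have "\<dots> = (\<integral>x. ?\<eta> x * divergence \<phi> x \<partial>lborel) - (\<integral>x. (?\<eta> x - indicator ?B x) * divergence \<phi> x \<partial>lborel)"
      by (rule Bochner_Integration.integral_diff[OF i2 i1])
    also have "\<dots> \<le> measure lborel A / \<epsilon> + (?n * M) * measure lborel A"
    proof -
      have "- (\<integral>x. (?\<eta> x - indicator ?B x) * divergence \<phi> x \<partial>lborel) = (\<integral>x. - ((?\<eta> x - indicator ?B x) * divergence \<phi> x) \<partial>lborel)"
        by simp
      also have "\<dots> \<le> (\<integral>x. (?n * M) * indicator A x \<partial>lborel)"
      proof (rule integral_mono)
        fix x
        have "\<bar>(?\<eta> x - indicator ?B x) * divergence \<phi> x\<bar> \<le> indicator A x * (?n * M)"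
          unfolding abs_mult using \<eta>B db by (intro mult_mono) auto
        then show "- ((?\<eta> x - indicator ?B x) * divergence \<phi> x) \<le> (?n * M) * indicator A x"
          by (simp add: mult.commute abs_le_iff)
      qed (use i1 Af in auto)
      also have "\<dots> = (?n * M) * measure lborel A" by (simp add: A_def)
      finally have "- (\<integral>x. (?\<eta> x - indicator ?B x) * divergence \<phi> x \<partial>lborel) \<le> (?n * M) * measure lborel A" .
      moreover have "(\<integral>x. ?\<eta> x * divergence \<phi> x \<partial>lborel) \<le> measure lborel A / \<epsilon>"
        unfolding A_def by (rule cutoff_divergence[OF D R M Dc b1 \<epsilon> r])
      ultimately show ?thesis by simp
    qed
    finally show ?thesis unfolding mA by (simp add: mult_ac)
  qed
  show "(\<integral>x. indicator ?B x * divergence \<phi> x \<partial>lborel) \<le> ?n * unit_ball_vol ?n * r ^ (?n - 1)"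
  proof (rule tendsto_lowerbound)
    have "((\<lambda>x. x ^ ?n) has_field_derivative ?n * r ^ (?n - 1)) (at r)"
      by (auto intro!: derivative_eq_intros)
    then have "((\<lambda>\<epsilon>. ((r + \<epsilon>) ^ ?n - r ^ ?n) / \<epsilon>) \<longlongrightarrow> ?n * r ^ (?n - 1)) (at_right 0)"
      by (auto simp: DERIV_def intro: tendsto_mono at_le)
    then have "((\<lambda>\<epsilon>. unit_ball_vol ?n * (((r + \<epsilon>) ^ ?n - r ^ ?n) / \<epsilon>) + ?n * M * unit_ball_vol ?n * ((r + \<epsilon>) ^ ?n - r ^ ?n))
      \<longlongrightarrow> unit_ball_vol ?n * (?n * r ^ (?n - 1)) + ?n * M * unit_ball_vol ?n * ((r + 0) ^ ?n - r ^ ?n)) (at_right 0)"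
      by (intro tendsto_intros)
    then show "((\<lambda>\<epsilon>. unit_ball_vol ?n * (((r + \<epsilon>) ^ ?n - r ^ ?n) / \<epsilon>) + ?n * M * unit_ball_vol ?n * ((r + \<epsilon>) ^ ?n - r ^ ?n))
      \<longlongrightarrow> ?n * unit_ball_vol ?n * r ^ (?n - 1)) (at_right 0)" by (simp add: mult_ac)
    show "\<forall>\<^sub>F \<epsilon> in at_right 0. (\<integral>x. indicator ?B x * divergence \<phi> x \<partial>lborel)
      \<le> unit_ball_vol ?n * (((r + \<epsilon>) ^ ?n - r ^ ?n) / \<epsilon>) + ?n * M * unit_ball_vol ?n * ((r + \<epsilon>) ^ ?n - r ^ ?n)"
      using eventually_at_right_less[of "0::real"] le by (auto elim!: eventually_mono)
  qed simp
qed

lemma divergence_measurable: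
  fixes \<phi> :: "'a::euclidean_space \<Rightarrow> 'a"
  assumes "\<phi> \<in> C1c_fields"
  shows "divergence \<phi> \<in> borel_measurable borel"
proof -
  obtain D where D: "\<And>x. (\<phi> has_derivative D x) (at x)" and Dc: "\<And>v. continuous_on UNIV (\<lambda>x. D x v)"
    using C1c_fieldsE[OF assms] by metis
  have "divergence \<phi> x = (\<Sum>b\<in>Basis. D x b \<bullet> b)" for x
    using frechet_derivative_at[OF D[of x]] by (simp add: divergence_def)
  moreover have [measurable]: "(\<lambda>x. D x v) \<in> borel_measurable borel" for v
    using Dc by (rule borel_measurable_continuous_onI)
  ultimately show ?thesis by (simp add: fun_eq_iff[symmetric] cong: measurable_cong)
qed

lemma perimeter_lborel:
  fixes E :: "'a::euclidean_space set"
  assumes "E \<in> sets borel"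
  shows "perimeter E = (SUP \<phi>\<in>{\<phi> \<in> C1c_fields. \<forall>x. norm (\<phi> x) \<le> 1}.
    ennreal (\<integral>x. indicator E x * divergence \<phi> x \<partial>lborel))"
  unfolding perimeter_def total_variation_def
proof (intro SUP_cong refl arg_cong[where f=ennreal])
  fix \<phi> :: "'a \<Rightarrow> 'a" assume "\<phi> \<in> {\<phi> \<in> C1c_fields. \<forall>x. norm (\<phi> x) \<le> 1}"
  then have [measurable]: "divergence \<phi> \<in> borel_measurable borel" by (simp add: divergence_measurable)
  have [measurable]: "E \<in> sets borel" by fact
  show "(\<integral>x. indicator E x * divergence \<phi> x \<partial>lebesgue) = (\<integral>x. indicator E x * divergence \<phi> x \<partial>lborel)"
    by (rule integral_completion) measurable
qed

lemma perimeter_AE_eq: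
  fixes E F :: "'a::euclidean_space set"
  assumes EF: "E \<in> sets borel" "F \<in> sets borel" and ae: "AE x in lborel. x \<in> E \<longleftrightarrow> x \<in> F"
  shows "perimeter E = perimeter F"
  unfolding perimeter_lborel[OF EF(1)] perimeter_lborel[OF EF(2)]
proof (intro SUP_cong refl arg_cong[where f=ennreal] integral_cong_AE)
  fix \<phi> :: "'a \<Rightarrow> 'a" assume "\<phi> \<in> {\<phi> \<in> C1c_fields. \<forall>x. norm (\<phi> x) \<le> 1}"
  then have [measurable]: "divergence \<phi> \<in> borel_measurable borel" by (simp add: divergence_measurable)
  note [measurable] = EF
  show "(\<lambda>x. indicat_real E x * divergence \<phi> x) \<in> borel_measurable lborel"
    "(\<lambda>x. indicat_real F x * divergence \<phi> x) \<in> borel_measurable lborel" by measurable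
  show "AE x in lborel. indicat_real E x * divergence \<phi> x = indicat_real F x * divergence \<phi> x"
    using ae by eventually_elim (simp add: indicator_def)
qed

lemma sphere_null_sets_lborel: "sphere (c::'a::euclidean_space) r \<in> null_sets lborel"
  using negligible_sphere[of c r] by (auto simp: negligible_iff_null_sets null_sets_completion_iff)

text \<open>For each single test field the integral splits over the balls, and each part obeys the
  bound for its own ball. Closed balls make the union compact, while the bound is for open ones; the
  spheres between them are null.\<close>

lemma perimeter_disjoint_cballs_le:
  fixes c :: "nat \<Rightarrow> 'a::euclidean_space"
  assumes I: "finite I" and r: "\<And>i. i \<in> I \<Longrightarrow> 0 < r i"
    and dj: "disjoint_family_on (\<lambda>i. cball (c i) (r i)) I"
  shows "perimeter (\<Union>i\<in>I. cball (c i) (r i)) \<le> ennreal (\<Sum>i\<in>I. DIM('a) * unit_ball_vol DIM('a) * r i ^ (DIM('a) - 1))"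
proof -
  let ?E = "\<Union>i\<in>I. cball (c i) (r i)"
  have Eb: "?E \<in> sets borel" using I by (intro sets.finite_UN) auto
  show ?thesis
    unfolding perimeter_lborel[OF Eb]
  proof (rule SUP_least, rule ennreal_leI)
    fix \<phi> :: "'a \<Rightarrow> 'a" assume "\<phi> \<in> {\<phi> \<in> C1c_fields. \<forall>x. norm (\<phi> x) \<le> 1}"
    then have \<phi>: "\<phi> \<in> C1c_fields" and b1: "\<And>x. norm (\<phi> x) \<le> 1" by auto
    have [measurable]: "divergence \<phi> \<in> borel_measurable borel" using \<phi> by (rule divergence_measurable)
    note [measurable] = Eb
    have int: "integrable lborel (\<lambda>x. indicator (ball (c i) (r i)) x * divergence \<phi> x)" if "i \<in> I" for i
      using integral_divergence_ball_le(1)[OF \<phi> b1 r[OF that]] .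
    have "(\<Union>i\<in>I. sphere (c i) (r i)) \<in> null_sets lborel"
      using I sphere_null_sets_lborel by (intro null_sets.finite_UN) auto
    then have ae: "AE x in lborel. x \<notin> (\<Union>i\<in>I. sphere (c i) (r i))" by (rule AE_not_in)
    have "(\<integral>x. indicator ?E x * divergence \<phi> x \<partial>lborel)
        = (\<integral>x. (\<Sum>i\<in>I. indicator (ball (c i) (r i)) x * divergence \<phi> x) \<partial>lborel)"
    proof (rule integral_cong_AE)
      show "(\<lambda>x. indicat_real ?E x * divergence \<phi> x) \<in> borel_measurable lborel" by measurable
      show "(\<lambda>x. \<Sum>i\<in>I. indicat_real (ball (c i) (r i)) x * divergence \<phi> x) \<in> borel_measurable lborel"
        by (intro borel_measurable_sum borel_measurable_integrable int)
      show "AE x in lborel. indicat_real ?E x * divergence \<phi> x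
          = (\<Sum>i\<in>I. indicat_real (ball (c i) (r i)) x * divergence \<phi> x)"
        using ae
      proof eventually_elim
        case (elim x)
        have "indicat_real ?E x = (\<Sum>i\<in>I. indicat_real (cball (c i) (r i)) x)"
          using indicator_UN_disjoint[OF I dj, of x] .
        also have "\<dots> = (\<Sum>i\<in>I. indicat_real (ball (c i) (r i)) x)"
          using elim by (intro sum.cong refl) (auto simp: indicator_def)
        finally show ?case by (simp add: sum_distrib_right)
      qed
    qed
    also have "\<dots> = (\<Sum>i\<in>I. \<integral>x. indicator (ball (c i) (r i)) x * divergence \<phi> x \<partial>lborel)"
      using int by (rule Bochner_Integration.integral_sum)
    also have "\<dots> \<le> (\<Sum>i\<in>I. DIM('a) * unit_ball_vol DIM('a) * r i ^ (DIM('a) - 1))"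
      using integral_divergence_ball_le(2)[OF \<phi> b1 r] by (intro sum_mono)
    finally show "(\<integral>x. indicator ?E x * divergence \<phi> x \<partial>lborel)
      \<le> (\<Sum>i\<in>I. DIM('a) * unit_ball_vol DIM('a) * r i ^ (DIM('a) - 1))" .
  qed
qed

lemma root_mult_power_pred:
  assumes "0 < n" "0 \<le> x"
  shows "root n x * root n x ^ (n - 1) = x"
  using assms by (metis power_eq_if not_less0 real_root_pow_pos2)

text \<open>The upper bound is the divergence estimate for a family of one ball. The lower bound is
  the isoperimetric inequality, which the ball satisfies with equality.\<close>

lemma perimeter_unit_ball:
  "perimeter (ball (0::'a::euclidean_space) 1) = ennreal (DIM('a) * unit_ball_vol DIM('a))"
proof (rule antisym)
  let ?n = "DIM('a)" and ?w = "unit_ball_vol (real DIM('a))"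
  have "AE x in lborel. x \<notin> sphere (0::'a) 1" by (intro AE_not_in sphere_null_sets_lborel)
  have eq: "perimeter (ball (0::'a) 1) = perimeter (cball (0::'a) 1)"
  proof (intro perimeter_AE_eq)
    show "AE x in lborel. x \<in> ball (0::'a) 1 \<longleftrightarrow> x \<in> cball 0 1"
      using \<open>AE x in lborel. x \<notin> sphere (0::'a) 1\<close> by eventually_elim auto
  qed auto
  have "perimeter (\<Union>i\<in>{0::nat}. cball ((\<lambda>_. 0::'a) i) ((\<lambda>_. 1) i)) \<le> ennreal (\<Sum>i\<in>{0::nat}. ?n * ?w * (\<lambda>_. 1) i ^ (?n - 1))"
    by (rule perimeter_disjoint_cballs_le) (auto simp: disjoint_family_on_def)
  then show "perimeter (ball (0::'a) 1) \<le> ennreal (?n * ?w)" by (simp add: eq)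
  have m: "measure lborel (cball (0::'a) 1) = ?w" by (simp add: content_cball)
  have "root ?n ?w * root ?n ?w ^ (?n - 1) = ?w" by (rule root_mult_power_pred) auto
  then have k: "?n * root ?n ?w * root ?n ?w ^ (?n - 1) = ?n * ?w" by (simp only: mult.assoc)
  have "ennreal (?n * root ?n ?w * root ?n ?w ^ (?n - 1)) \<le> perimeter (cball (0::'a) 1)"
    using isoperimetric_inequality[of "cball (0::'a) 1"] by (simp add: m)
  then show "ennreal (?n * ?w) \<le> perimeter (ball (0::'a) 1)"
    unfolding k eq .
qed

section \<open>Many small balls far apart\<close>

text \<open>\<open>y\<close> lies in exactly one dyadic shell s / 2^(k+1) < |x - y| <= s / 2^k,
  found with the least n such that s / 2^n < |x - y|. The term of that shell alone dominates the
  kernel, so no polar coordinates are involved.\<close>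

lemma riesz_kernel_dyadic_le:
  fixes x y :: "'a::euclidean_space"
  assumes s: "0 < s" and \<alpha>: "0 < \<alpha>" and y: "y \<noteq> x" "y \<in> cball x s"
  shows "riesz_kernel \<alpha> x y \<le> (\<Sum>k. ennreal ((2 ^ Suc k / s) powr \<alpha>) * indicator (cball x (s / 2 ^ k)) y)"
proof -
  define \<rho> where "\<rho> = norm (x - y)"
  have \<rho>: "0 < \<rho>" "\<rho> \<le> s" using y by (auto simp: \<rho>_def dist_norm)
  have "\<exists>n. s / 2 ^ n < \<rho>"
  proof -
    obtain n where "s / \<rho> < 2 ^ n" using real_arch_pow[of 2 "s / \<rho>"] by auto
    then show ?thesis using \<rho> by (intro exI[of _ n]) (simp add: field_simps)
  qed
  then have n: "s / 2 ^ (LEAST n. s / 2 ^ n < \<rho>) < \<rho>" by (rule LeastI_ex)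
  then have "(LEAST n. s / 2 ^ n < \<rho>) \<noteq> 0" using \<rho> by (metis div_by_1 not_le power_0)
  then obtain k where k: "(LEAST n. s / 2 ^ n < \<rho>) = Suc k" using not0_implies_Suc by blast
  have lo: "s / 2 ^ Suc k < \<rho>" using n k by simp
  have hi: "\<rho> \<le> s / 2 ^ k" using not_less_Least[of k "\<lambda>n. s / 2 ^ n < \<rho>"] k by simp
  have "riesz_kernel \<alpha> x y = ennreal ((1 / \<rho>) powr \<alpha>)"
    using y \<rho> by (simp add: riesz_kernel_off_diagonal \<rho>_def powr_divide)
  also have "\<dots> \<le> ennreal ((2 ^ Suc k / s) powr \<alpha>)"
    using lo \<rho> s \<alpha> by (intro ennreal_leI powr_mono2) (auto simp: field_simps)
  also have "\<dots> = ennreal ((2 ^ Suc k / s) powr \<alpha>) * indicator (cball x (s / 2 ^ k)) y"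
    using hi by (simp add: \<rho>_def dist_norm)
  also have "\<dots> = (\<Sum>k\<in>{k}. ennreal ((2 ^ Suc k / s) powr \<alpha>) * indicator (cball x (s / 2 ^ k)) y)"
    by (simp only: sum.insert[OF finite.emptyI] sum.empty empty_iff not_False_eq_True add_0_right)
  also have "\<dots> \<le> (\<Sum>k. ennreal ((2 ^ Suc k / s) powr \<alpha>) * indicator (cball x (s / 2 ^ k)) y)"
    by (rule sum_le_suminf) auto
  finally show ?thesis .
qed

lemma riesz_kernel_measurable[measurable]: "riesz_kernel \<alpha> x \<in> borel_measurable borel"
  unfolding riesz_kernel_def[abs_def] by measurable

text \<open>Integrating the dyadic bound gives a geometric series of ratio 2^(\<alpha> - d), which
  converges because \<alpha> < d; \<open>C\<close> is its sum with the power of \<open>s\<close>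
  taken out.\<close>

lemma riesz_potential_cball_le:
  fixes x :: "'a::euclidean_space" and \<alpha> s :: real
  assumes s: "0 < s" and \<alpha>: "0 < \<alpha>" "\<alpha> < DIM('a)"
  defines "C \<equiv> 2 powr \<alpha> * unit_ball_vol DIM('a) / (1 - 2 powr (\<alpha> - DIM('a)))"
  shows "(\<integral>\<^sup>+y. riesz_kernel \<alpha> x y * indicator (cball x s) y \<partial>lborel) \<le> ennreal (C * s powr (DIM('a) - \<alpha>))"
proof -
  let ?n = "DIM('a)" and ?w = "unit_ball_vol (real DIM('a))"
  define q where "q = 2 powr (\<alpha> - ?n)"
  have "2 powr (\<alpha> - ?n) < 2 powr 0" using \<alpha>(2) by (intro powr_less_mono) auto
  then have q: "0 < q" "q < 1" by (auto simp: q_def)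
  define A where "A = 2 powr \<alpha> * ?w * s powr (?n - \<alpha>)"
  have A: "0 \<le> A" by (simp add: A_def)
  have summand: "(2 ^ Suc k / s) powr \<alpha> * (?w * (s / 2 ^ k) ^ ?n) = A * q ^ k" for k
  proof -
    have 1: "(2 ^ Suc k / s) powr \<alpha> = 2 powr \<alpha> * 2 powr (k * \<alpha>) * s powr (- \<alpha>)"
    proof -
      have "(2 ^ Suc k / s) powr \<alpha> = (2 powr (Suc k)) powr \<alpha> / s powr \<alpha>"
        using s by (subst powr_realpow) (auto simp: powr_divide)
      also have "(2 powr (Suc k)) powr \<alpha> = 2 powr (\<alpha> + k * \<alpha>)" by (simp add: powr_powr algebra_simps)
      finally show ?thesis by (simp add: powr_add powr_minus divide_inverse)
    qed
    have 2: "(s / 2 ^ k) ^ ?n = s powr ?n * 2 powr (- (k * ?n))"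
    proof -
      have "(s / 2 ^ k) ^ ?n = s ^ ?n / 2 ^ (k * ?n)" by (simp add: power_divide power_mult)
      also have "\<dots> = s powr ?n / 2 powr (k * ?n)" using s by (simp add: powr_realpow[symmetric])
      finally show ?thesis by (simp add: powr_minus divide_inverse)
    qed
    have 3: "q ^ k = 2 powr (k * \<alpha>) * 2 powr (- (k * ?n))"
    proof -
      have "q ^ k = q powr k" using q by (simp add: powr_realpow)
      also have "\<dots> = 2 powr (k * \<alpha> + - (k * ?n))" unfolding q_def powr_powr by (simp add: algebra_simps)
      finally show ?thesis by (simp only: powr_add)
    qed
    have 4: "s powr (?n - \<alpha>) = s powr ?n * s powr (- \<alpha>)" by (simp add: powr_add[symmetric])
    show ?thesis unfolding 1 2 3 A_def 4 by (simp add: mult_ac)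
  qed
  have "(\<integral>\<^sup>+y. riesz_kernel \<alpha> x y * indicator (cball x s) y \<partial>lborel)
      \<le> (\<integral>\<^sup>+y. (\<Sum>k. ennreal ((2 ^ Suc k / s) powr \<alpha>) * indicator (cball x (s / 2 ^ k)) y) \<partial>lborel)"
  proof (rule nn_integral_mono_AE)
    have "AE y in lborel. y \<noteq> x" by (rule AE_lborel_singleton)
    then show "AE y in lborel. riesz_kernel \<alpha> x y * indicator (cball x s) y
        \<le> (\<Sum>k. ennreal ((2 ^ Suc k / s) powr \<alpha>) * indicator (cball x (s / 2 ^ k)) y)"
    proof eventually_elim
      case (elim y)
      then show ?case
        using riesz_kernel_dyadic_le[OF s \<alpha>(1) elim] by (auto simp: indicator_def[of "cball x s"])
    qed
  qed
  also have "\<dots> = (\<Sum>k. \<integral>\<^sup>+y. ennreal ((2 ^ Suc k / s) powr \<alpha>) * indicator (cball x (s / 2 ^ k)) y \<partial>lborel)"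
    by (intro nn_integral_suminf borel_measurable_times_ennreal borel_measurable_const borel_measurable_indicator) auto
  also have "\<dots> = (\<Sum>k. ennreal (A * q ^ k))"
  proof (rule suminf_cong)
    fix k
    have "(\<integral>\<^sup>+y. ennreal ((2 ^ Suc k / s) powr \<alpha>) * indicator (cball x (s / 2 ^ k)) y \<partial>lborel)
        = ennreal ((2 ^ Suc k / s) powr \<alpha>) * emeasure lborel (cball x (s / 2 ^ k))"
      by (rule nn_integral_cmult_indicator) auto
    also have "\<dots> = ennreal ((2 ^ Suc k / s) powr \<alpha> * (?w * (s / 2 ^ k) ^ ?n))"
      using s by (simp add: emeasure_cball ennreal_mult)
    finally show "(\<integral>\<^sup>+y. ennreal ((2 ^ Suc k / s) powr \<alpha>) * indicator (cball x (s / 2 ^ k)) y \<partial>lborel) = ennreal (A * q ^ k)"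
      by (simp only: summand)
  qed
  also have "\<dots> = ennreal (A / (1 - q))"
  proof (rule suminf_ennreal_eq)
    show "0 \<le> A * q ^ k" for k using A q by simp
    show "(\<lambda>k. A * q ^ k) sums (A / (1 - q))"
      using sums_mult[OF geometric_sums, of q A] q by simp
  qed
  also have "A / (1 - q) = C * s powr (?n - \<alpha>)" by (simp add: A_def C_def q_def)
  finally show ?thesis .
qed

text \<open>Up to constants, N r^(d-1) is the total perimeter of \<open>N\<close> balls of radius
  \<open>r\<close> and r^(-\<alpha>) / N is the energy of a unit charge spread over them, with the
  interaction of different balls left out.\<close>

lemma exponents_exist:
  fixes d :: nat and \<alpha> \<delta> :: real
  assumes d: "2 \<le> d" and \<alpha>: "0 < \<alpha>" "\<alpha> < real d - 1" and \<delta>: "0 < \<delta>"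
  obtains N :: nat and r :: real where "0 < N" "0 < r" "r \<le> 1" "N * r ^ (d - 1) < \<delta>" "r powr (- \<alpha>) / N < \<delta>"
proof -
  \<comment> \<open>1 / \<beta> is the midpoint of \<alpha> and d - 1, which puts \<beta> strictly
    between 1 / (d - 1) and 1 / \<alpha>.\<close>
  define \<beta> where "\<beta> = 2 / (\<alpha> + (d - 1))"
  have p: "\<alpha> + (d - 1) > 0" using \<alpha> by simp
  have b1: "1 - \<beta> * (d - 1) < 0" and b2: "\<alpha> * \<beta> - 1 < 0" and b0: "0 < \<beta>"
    using \<alpha> p d by (auto simp: \<beta>_def field_simps of_nat_diff)
  have "((\<lambda>N. real N powr (1 - \<beta> * (d - 1))) \<longlongrightarrow> 0) sequentially"
    "((\<lambda>N. real N powr (\<alpha> * \<beta> - 1)) \<longlongrightarrow> 0) sequentially"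
    by (intro tendsto_neg_powr b1 b2 filterlim_real_sequentially)+
  then have "eventually (\<lambda>N. real N powr (1 - \<beta> * (d - 1)) < \<delta> \<and> real N powr (\<alpha> * \<beta> - 1) < \<delta> \<and> 0 < N) sequentially"
    using \<delta> by (intro eventually_conj order_tendstoD(2)[where a=\<delta>] eventually_gt_at_top)
  then obtain N where N: "real N powr (1 - \<beta> * (d - 1)) < \<delta>" "real N powr (\<alpha> * \<beta> - 1) < \<delta>" "0 < N"
    by (auto simp: eventually_sequentially)
  define r where "r = real N powr (- \<beta>)"
  have N1: "1 \<le> real N" using N(3) by simp
  show thesis
  proof (rule that[of N r])
    show "0 < N" "0 < r" using N by (auto simp: r_def)
    have "real N powr (- \<beta>) \<le> real N powr 0" using N1 b0 by (intro powr_mono) auto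
    then show "r \<le> 1" using N(3) by (simp add: r_def)
    have "r ^ (d - 1) = real N powr (- \<beta> * (d - 1))"
      using N(3) by (simp add: r_def powr_realpow[symmetric] powr_powr)
    then have "N * r ^ (d - 1) = real N powr (1 - \<beta> * (d - 1))"
      using N(3) by (simp add: powr_mult_base)
    then show "N * r ^ (d - 1) < \<delta>" using N by simp
    have "r powr (- \<alpha>) / N = real N powr (\<alpha> * \<beta>) / real N powr 1"
      using N(3) by (simp add: r_def powr_powr mult.commute)
    also have "\<dots> = real N powr (\<alpha> * \<beta> - 1)" by (rule powr_diff[symmetric])
    finally show "r powr (- \<alpha>) / N < \<delta>" using N by simp
  qed
qed

lemma emeasure_disjoint_cballs:
  fixes c :: "nat \<Rightarrow> 'a::euclidean_space"
  assumes I: "finite I" and r: "\<And>i. i \<in> I \<Longrightarrow> 0 \<le> r i"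
    and dj: "disjoint_family_on (\<lambda>i. cball (c i) (r i)) I"
  shows "emeasure lborel (\<Union>i\<in>I. cball (c i) (r i)) = ennreal (\<Sum>i\<in>I. unit_ball_vol DIM('a) * r i ^ DIM('a))"
proof -
  have "emeasure lborel (\<Union>i\<in>I. cball (c i) (r i)) = (\<Sum>i\<in>I. emeasure lborel (cball (c i) (r i)))"
    using I dj by (intro sum_emeasure[symmetric]) auto
  also have "\<dots> = (\<Sum>i\<in>I. ennreal (unit_ball_vol DIM('a) * r i ^ DIM('a)))"
    using r by (intro sum.cong refl) (simp add: emeasure_cball)
  also have "\<dots> = ennreal (\<Sum>i\<in>I. unit_ball_vol DIM('a) * r i ^ DIM('a))"
    using r by (intro sum_ennreal) auto
  finally show ?thesis .
qed

text \<open>The trial measure is the uniform probability on the union of the balls. Its potential at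
  a charged point is a near part, bounded by the potential of a full ball of radius 2 r with density
  1 / V, and a far part of mass at most 1 at distance at least \<open>D\<close>.\<close>

lemma riesz_energy_disjoint_cballs_le:
  fixes c :: "nat \<Rightarrow> 'a::euclidean_space" and N :: nat and \<alpha> r D :: real
  assumes N: "0 < N" "finite I" "card I = N" and r: "0 < r" and \<alpha>: "0 < \<alpha>" "\<alpha> < DIM('a)"
    and D: "0 < D" "\<And>i j. i \<in> I \<Longrightarrow> j \<in> I \<Longrightarrow> i \<noteq> j \<Longrightarrow> D + 2 * r \<le> dist (c i) (c j)"
    and E: "E \<in> sets borel" "(\<Union>i\<in>I. cball (c i) r) \<subseteq> E"
  defines "C \<equiv> 2 powr \<alpha> * unit_ball_vol DIM('a) / (1 - 2 powr (\<alpha> - DIM('a)))"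
  shows "riesz_energy \<alpha> E \<le> ennreal (C * (2 * r) powr (DIM('a) - \<alpha>) / (N * (unit_ball_vol DIM('a) * r ^ DIM('a))) + D powr (- \<alpha>))"
proof -
  let ?n = "DIM('a)" and ?w = "unit_ball_vol (real DIM('a))"
  define T where "T = (\<Union>i\<in>I. cball (c i) r)"
  have [measurable]: "T \<in> sets borel" unfolding T_def using N by (intro sets.finite_UN) auto
  note [measurable] = E(1)
  have sep: "D \<le> dist x y" if "i \<in> I" "j \<in> I" "i \<noteq> j" "x \<in> cball (c i) r" "y \<in> cball (c j) r" for i j x y
  proof -
    have "dist (c i) (c j) \<le> dist (c i) x + dist x y + dist y (c j)"
      using dist_triangle[of "c i" "c j" x] dist_triangle[of x "c j" y] by linarith
    then show ?thesis using D(2)[OF that(1-3)] that(4,5) by (simp add: dist_commute)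
  qed
  have dj: "disjoint_family_on (\<lambda>i. cball (c i) r) I"
    unfolding disjoint_family_on_def
  proof (intro ballI impI)
    fix i j assume "i \<in> I" "j \<in> I" "i \<noteq> j"
    then show "cball (c i) r \<inter> cball (c j) r = {}" using sep[of i j z z for z] D(1) by force
  qed
  define V where "V = N * (?w * r ^ ?n)"
  have V: "V > 0" using N r by (simp add: V_def)
  have eT: "emeasure lborel T = ennreal V"
    using emeasure_disjoint_cballs[OF N(2) _ dj] r N by (simp add: T_def V_def)
  define \<mu> where "\<mu> = density lborel (\<lambda>x. ennreal (1 / V) * indicator T x)"
  have s\<mu>: "sets \<mu> = sets borel" by (simp add: \<mu>_def)
  have \<mu>: "(\<integral>\<^sup>+x. f x \<partial>\<mu>) = (\<integral>\<^sup>+x. ennreal (1 / V) * indicator T x * f x \<partial>lborel)" if "f \<in> borel_measurable borel" for f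
    unfolding \<mu>_def using that by (subst nn_integral_density) auto
  have mass: "(\<integral>\<^sup>+x. ennreal (1 / V) * indicator T x \<partial>lborel) = 1"
  proof -
    have "(\<integral>\<^sup>+x. ennreal (1 / V) * indicator T x \<partial>lborel) = ennreal (1 / V) * emeasure lborel T"
      by (rule nn_integral_cmult_indicator) simp
    then show ?thesis using V by (simp add: eT flip: ennreal_mult)
  qed
  have "emeasure \<mu> E = (\<integral>\<^sup>+x. ennreal (1 / V) * indicator T x * indicator E x \<partial>lborel)"
    unfolding \<mu>_def by (rule emeasure_density) auto
  also have "\<dots> = (\<integral>\<^sup>+x. ennreal (1 / V) * indicator T x \<partial>lborel)"
    using E(2) unfolding T_def[symmetric] by (intro nn_integral_cong) (auto simp: indicator_def)
  finally have \<mu>E: "emeasure \<mu> E = 1" by (simp add: mass)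
  define B where "B = C * (2 * r) powr (?n - \<alpha>) / V + D powr (- \<alpha>)"
  have C: "0 \<le> C"
  proof -
    have "2 powr (\<alpha> - ?n) < 1" using \<alpha> powr_less_mono[of "\<alpha> - ?n" 0 2] by simp
    then show ?thesis by (simp add: C_def)
  qed
  have inner: "(\<integral>\<^sup>+y. riesz_kernel \<alpha> x y \<partial>\<mu>) \<le> ennreal B" if x: "x \<in> T" for x
  proof -
    have [measurable]: "cball x (2 * r) \<in> sets borel" by simp
    \<comment> \<open>A charged point \<open>y\<close> farther than the diameter 2 r from
      \<open>x\<close> lies in another ball than \<open>x\<close>, hence at distance at least
      \<open>D\<close>.\<close>
    have pt: "ennreal (1 / V) * indicator T y * riesz_kernel \<alpha> x y
        \<le> ennreal (1 / V) * (riesz_kernel \<alpha> x y * indicator (cball x (2 * r)) y) + ennreal (D powr (- \<alpha>)) * (ennreal (1 / V) * indicator T y)" for y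
    proof (cases "y \<in> T \<and> y \<notin> cball x (2 * r)")
      case True
      obtain i j where ij: "i \<in> I" "j \<in> I" "x \<in> cball (c i) r" "y \<in> cball (c j) r"
        using x True by (auto simp: T_def)
      have "i \<noteq> j"
      proof
        assume "i = j"
        then have "dist x y \<le> 2 * r" using ij dist_triangle2[of x y "c i"] by (simp add: dist_commute)
        then show False using True by simp
      qed
      then have "D \<le> dist x y" using sep ij by blast
      then have xy: "D \<le> norm (x - y)" "x \<noteq> y" using D(1) by (auto simp: dist_norm)
      have "riesz_kernel \<alpha> x y = ennreal (norm (x - y) powr (- \<alpha>))"
        using xy by (simp add: riesz_kernel_off_diagonal powr_minus_divide)
      also have "\<dots> \<le> ennreal (D powr (- \<alpha>))"
        using xy D(1) \<alpha> by (intro ennreal_leI powr_mono2') auto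
      finally have "ennreal (1 / V) * riesz_kernel \<alpha> x y \<le> ennreal (1 / V) * ennreal (D powr (- \<alpha>))"
        by (rule mult_left_mono) simp
      then show ?thesis using True by (simp add: mult_ac)
    next
      case False
      then show ?thesis by (auto simp: indicator_def)
    qed
    have "(\<integral>\<^sup>+y. riesz_kernel \<alpha> x y \<partial>\<mu>) = (\<integral>\<^sup>+y. ennreal (1 / V) * indicator T y * riesz_kernel \<alpha> x y \<partial>lborel)"
      by (rule \<mu>) simp
    also have "\<dots> \<le> (\<integral>\<^sup>+y. ennreal (1 / V) * (riesz_kernel \<alpha> x y * indicator (cball x (2 * r)) y) + ennreal (D powr (- \<alpha>)) * (ennreal (1 / V) * indicator T y) \<partial>lborel)"
      by (intro nn_integral_mono pt)
    also have "\<dots> = (\<integral>\<^sup>+y. ennreal (1 / V) * (riesz_kernel \<alpha> x y * indicator (cball x (2 * r)) y) \<partial>lborel)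
        + (\<integral>\<^sup>+y. ennreal (D powr (- \<alpha>)) * (ennreal (1 / V) * indicator T y) \<partial>lborel)"
      by (rule nn_integral_add) measurable
    also have "\<dots> = ennreal (1 / V) * (\<integral>\<^sup>+y. riesz_kernel \<alpha> x y * indicator (cball x (2 * r)) y \<partial>lborel)
        + ennreal (D powr (- \<alpha>)) * (\<integral>\<^sup>+y. ennreal (1 / V) * indicator T y \<partial>lborel)"
      by (intro arg_cong2[where f="(+)"] nn_integral_cmult) measurable
    also have "\<dots> = ennreal (1 / V) * (\<integral>\<^sup>+y. riesz_kernel \<alpha> x y * indicator (cball x (2 * r)) y \<partial>lborel)
        + ennreal (D powr (- \<alpha>))"
      by (simp only: mass mult_1_right)
    also have "\<dots> \<le> ennreal (1 / V) * ennreal (C * (2 * r) powr (?n - \<alpha>)) + ennreal (D powr (- \<alpha>))"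
      using riesz_potential_cball_le[of "2 * r" \<alpha> x] r \<alpha> unfolding C_def mult_1_right
      by (intro add_mono mult_left_mono order_refl) auto
    also have "\<dots> = ennreal B"
      using C V unfolding B_def by (simp flip: ennreal_mult ennreal_plus)
    finally show ?thesis .
  qed
  have km: "(\<lambda>x. \<integral>\<^sup>+y. riesz_kernel \<alpha> x y \<partial>\<mu>) \<in> borel_measurable borel"
  proof -
    have "(\<lambda>x. \<integral>\<^sup>+y. riesz_kernel \<alpha> x y \<partial>\<mu>) = (\<lambda>x. \<integral>\<^sup>+y. ennreal (1 / V) * indicator T y * riesz_kernel \<alpha> x y \<partial>lborel)"
      by (intro ext \<mu>) simp
    also have "\<dots> \<in> borel_measurable borel" unfolding riesz_kernel_def by measurable
    finally show ?thesis .
  qed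
  have "riesz_energy \<alpha> E \<le> (\<integral>\<^sup>+x. (\<integral>\<^sup>+y. riesz_kernel \<alpha> x y \<partial>\<mu>) \<partial>\<mu>)"
    unfolding riesz_energy_def using s\<mu> \<mu>E by (intro INF_lower) auto
  also have "\<dots> = (\<integral>\<^sup>+x. ennreal (1 / V) * indicator T x * (\<integral>\<^sup>+y. riesz_kernel \<alpha> x y \<partial>\<mu>) \<partial>lborel)"
    by (rule \<mu>[OF km])
  also have "\<dots> \<le> (\<integral>\<^sup>+x. ennreal B * (ennreal (1 / V) * indicator T x) \<partial>lborel)"
  proof (rule nn_integral_mono)
    fix x
    show "ennreal (1 / V) * indicator T x * (\<integral>\<^sup>+y. riesz_kernel \<alpha> x y \<partial>\<mu>) \<le> ennreal B * (ennreal (1 / V) * indicator T x)"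
      using mult_left_mono[OF inner[of x], of "ennreal (1 / V)"] by (cases "x \<in> T") (auto simp: mult_ac)
  qed
  also have "\<dots> = ennreal B * (\<integral>\<^sup>+x. ennreal (1 / V) * indicator T x \<partial>lborel)"
    by (rule nn_integral_cmult) measurable
  finally have "riesz_energy \<alpha> E \<le> ennreal B" by (simp only: mass mult_1_right)
  then show ?thesis by (simp add: B_def V_def)
qed

text \<open>Ball 0 has nearly the whole volume and is left uncharged, so its size does not enter the
  energy; balls 1 to \<open>N\<close> hold the charge.\<close>

lemma competitor_exists:
  fixes m \<alpha> \<delta> :: real
  assumes d: "2 \<le> DIM('a::euclidean_space)" and m: "0 < m"
    and \<alpha>: "0 < \<alpha>" "\<alpha> < real DIM('a) - 1" and \<delta>: "0 < \<delta>"
  shows "\<exists>E::'a set. compact E \<and> emeasure lborel E = ennreal m \<and>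
    perimeter E \<le> ennreal (DIM('a) * unit_ball_vol DIM('a) * root DIM('a) (m / unit_ball_vol DIM('a)) ^ (DIM('a) - 1) + \<delta>) \<and>
    riesz_energy \<alpha> E \<le> ennreal \<delta>"
proof -
  let ?n = "DIM('a)" and ?w = "unit_ball_vol (real DIM('a))"
  have w: "0 < ?w" by simp
  define C where "C = 2 powr \<alpha> * ?w / (1 - 2 powr (\<alpha> - ?n))"
  have C: "0 \<le> C"
  proof -
    have "2 powr (\<alpha> - ?n) < 1" using \<alpha> powr_less_mono[of "\<alpha> - ?n" 0 2] by simp
    then show ?thesis by (simp add: C_def)
  qed
  \<comment> \<open>The near part of the energy bound of
    \<open>riesz_energy_disjoint_cballs_le\<close> equals
    \<open>K * (r powr (- \<alpha>) / N)\<close>.\<close>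
  define K where "K = C * 2 powr (?n - \<alpha>) / ?w"
  have K: "0 \<le> K" using C by (simp add: K_def)
  \<comment> \<open>The three bounds serve, in this order, the perimeter of the small balls, their
    volume, which must stay below \<open>m\<close>, and the near part of the energy, which may use
    half of \<delta>. The 1 in K + 1 guards against K = 0.\<close>
  define \<delta>1 where "\<delta>1 = min (\<delta> / (?n * ?w)) (min (m / ?w) (\<delta> / 2 / (K + 1)))"
  have "0 < \<delta>1" using \<delta> m K w by (simp add: \<delta>1_def add_nonneg_pos)
  then obtain N :: nat and r :: real where Nr: "0 < N" "0 < r" "r \<le> 1" "N * r ^ (?n - 1) < \<delta>1" "r powr (- \<alpha>) / N < \<delta>1"
    using exponents_exist[OF d \<alpha>] by metis
  have "r ^ ?n \<le> r ^ (?n - 1)" using Nr by (intro power_decreasing) auto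
  then have "N * r ^ ?n \<le> N * r ^ (?n - 1)" by (intro mult_left_mono) auto
  then have Nm: "N * r ^ ?n < m / ?w" using Nr(4) by (simp add: \<delta>1_def)
  \<comment> \<open>The radius that brings the total volume back to \<open>m\<close>; it is at most
    the radius of a ball of volume \<open>m\<close>, so the large ball costs no excess
    perimeter.\<close>
  define R where "R = root ?n (m / ?w - N * r ^ ?n)"
  have R: "0 < R" using Nm by (simp add: R_def)
  have Rn: "R ^ ?n = m / ?w - N * r ^ ?n" using Nm by (simp add: R_def)
  have Rle: "R \<le> root ?n (m / ?w)" using Nr by (simp add: R_def)
  have "((\<lambda>D. D powr (- \<alpha>)) \<longlongrightarrow> 0) at_top"
    using \<alpha> by (intro tendsto_neg_powr filterlim_ident) auto
  then have "eventually (\<lambda>D. D powr (- \<alpha>) < \<delta> / 2) at_top" using \<delta> by (intro order_tendstoD(2)) auto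
  then have "eventually (\<lambda>D. D powr (- \<alpha>) < \<delta> / 2 \<and> 0 < D) at_top"
    by (intro eventually_conj eventually_gt_at_top)
  then obtain D :: real where D: "D powr (- \<alpha>) < \<delta> / 2" "0 < D"
    by (auto simp: eventually_at_top_linorder)
  obtain b :: 'a where b: "b \<in> Basis" using nonempty_Basis by blast
  \<comment> \<open>Spacing of the centres on a line. It exceeds the sum of any two radii that occur
    together and leaves the gap \<open>D\<close> between charged balls.\<close>
  define L where "L = D + 2 * r + R"
  have L: "0 < L" using D Nr R by (simp add: L_def)
  define c where "c i = (L * real i) *\<^sub>R b" for i :: nat
  define \<rho> where "\<rho> i = (if i = 0 then R else r)" for i :: nat
  have \<rho>: "0 < \<rho> i" for i using R Nr by (simp add: \<rho>_def)
  have cd: "L \<le> dist (c i) (c j)" if "i \<noteq> j" for i j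
  proof -
    have "dist (c i) (c j) = L * \<bar>real i - real j\<bar>"
      using b L by (simp add: c_def dist_norm abs_mult flip: scaleR_left_diff_distrib right_diff_distrib)
    moreover have "1 \<le> \<bar>real i - real j\<bar>" using that by linarith
    ultimately show ?thesis using L by (simp add: mult_le_cancel_left1)
  qed
  have dj: "disjoint_family_on (\<lambda>i. cball (c i) (\<rho> i)) I" for I
    unfolding disjoint_family_on_def
  proof (intro ballI impI)
    fix i j :: nat assume "i \<noteq> j"
    have "\<rho> i + \<rho> j < L" using \<open>i \<noteq> j\<close> D Nr R by (auto simp: \<rho>_def L_def)
    then have *: "\<rho> i + \<rho> j < dist (c i) (c j)" using cd[OF \<open>i \<noteq> j\<close>] by linarith
    show "cball (c i) (\<rho> i) \<inter> cball (c j) (\<rho> j) = {}"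
    proof (rule ccontr)
      assume "cball (c i) (\<rho> i) \<inter> cball (c j) (\<rho> j) \<noteq> {}"
      then obtain z where "dist (c i) z \<le> \<rho> i" "dist (c j) z \<le> \<rho> j" by auto
      then show False using * dist_triangle2[of "c i" "c j" z] by linarith
    qed
  qed
  have sum\<rho>: "(\<Sum>i\<le>N. f (\<rho> i)) = f R + N * f r" for f :: "real \<Rightarrow> real"
  proof -
    have "(\<Sum>i\<le>N. f (\<rho> i)) = f (\<rho> 0) + (\<Sum>i\<in>{1..N}. f (\<rho> i))"
      by (simp add: atMost_atLeast0 sum.atLeast_Suc_atMost)
    also have "(\<Sum>i\<in>{1..N}. f (\<rho> i)) = (\<Sum>i\<in>{1..N}. f r)"
      by (intro sum.cong) (auto simp: \<rho>_def)
    finally show ?thesis by (simp add: \<rho>_def)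
  qed
  define E where "E = (\<Union>i\<le>N. cball (c i) (\<rho> i))"
  have E: "compact E" unfolding E_def by (intro compact_UN) auto
  have "emeasure lborel E = ennreal (\<Sum>i\<le>N. ?w * \<rho> i ^ ?n)"
    unfolding E_def by (intro emeasure_disjoint_cballs dj less_imp_le \<rho>) auto
  also have "(\<Sum>i\<le>N. ?w * \<rho> i ^ ?n) = m"
    using less_imp_neq[OF w, symmetric] by (subst sum\<rho>[of "\<lambda>x. ?w * x ^ ?n"]) (simp add: Rn algebra_simps)
  finally have vol: "emeasure lborel E = ennreal m" .
  have "perimeter E \<le> ennreal (\<Sum>i\<le>N. ?n * ?w * \<rho> i ^ (?n - 1))"
    unfolding E_def by (intro perimeter_disjoint_cballs_le dj \<rho>) auto
  also have "(\<Sum>i\<le>N. ?n * ?w * \<rho> i ^ (?n - 1)) = ?n * ?w * R ^ (?n - 1) + ?n * ?w * (N * r ^ (?n - 1))"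
    by (subst sum\<rho>[of "\<lambda>x. ?n * ?w * x ^ (?n - 1)"]) (simp add: algebra_simps)
  also have "ennreal \<dots> \<le> ennreal (?n * ?w * root ?n (m / ?w) ^ (?n - 1) + \<delta>)"
  proof (intro ennreal_leI add_mono mult_left_mono power_mono Rle)
    have "N * r ^ (?n - 1) \<le> \<delta> / (?n * ?w)" using Nr(4) by (simp add: \<delta>1_def)
    then show "?n * ?w * (N * r ^ (?n - 1)) \<le> \<delta>" using w by (simp add: pos_le_divide_eq mult.commute)
  qed (use R w in auto)
  finally have per: "perimeter E \<le> ennreal (?n * ?w * root ?n (m / ?w) ^ (?n - 1) + \<delta>)" .
  have "riesz_energy \<alpha> E \<le> ennreal (C * (2 * r) powr (?n - \<alpha>) / (N * (?w * r ^ ?n)) + D powr (- \<alpha>))"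
    unfolding C_def
  \<comment> \<open>Index 0 is omitted: only the small balls are charged.\<close>
  proof (rule riesz_energy_disjoint_cballs_le[where I="{1..N}" and c=c])
    show "\<alpha> < ?n" using \<alpha> by simp
    show "D + 2 * r \<le> dist (c i) (c j)" if "i \<noteq> j" for i j
      using cd[OF that] R by (simp add: L_def)
    show "E \<in> sets borel" using E by (simp add: compact_imp_closed borel_closed)
    show "(\<Union>i\<in>{1..N}. cball (c i) r) \<subseteq> E" by (auto simp: E_def \<rho>_def intro!: bexI)
  qed (use Nr \<alpha> D in auto)
  also have "C * (2 * r) powr (?n - \<alpha>) / (N * (?w * r ^ ?n)) = K * (r powr (- \<alpha>) / N)"
  proof -
    have "(2 * r) powr (?n - \<alpha>) = 2 powr (?n - \<alpha>) * (r ^ ?n * r powr (- \<alpha>))"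
      using Nr(2) by (simp add: powr_mult powr_diff powr_realpow powr_minus divide_inverse)
    then show ?thesis using Nr(1,2) less_imp_neq[OF w, symmetric] by (simp add: K_def field_simps)
  qed
  also have "ennreal (K * (r powr (- \<alpha>) / N) + D powr (- \<alpha>)) \<le> ennreal \<delta>"
  proof (rule ennreal_leI)
    have "K * (r powr (- \<alpha>) / N) \<le> K * (\<delta> / 2 / (K + 1))"
      using Nr(5) K by (intro mult_left_mono) (auto simp: \<delta>1_def)
    also have "\<dots> \<le> \<delta> / 2" using K \<delta> by (simp add: field_simps)
    finally show "K * (r powr (- \<alpha>) / N) + D powr (- \<alpha>) \<le> \<delta>" using D(1) by linarith
  qed
  finally show ?thesis using E vol per by blast
qed

section \<open>The value of the infimum\<close>

theorem theorem1p1: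
  fixes Q m \<alpha> :: real
  assumes "2 \<le> DIM('a::euclidean_space)"
    and "Q > 0" and "m > 0"
    and "0 < \<alpha>" and "\<alpha> < real DIM('a) - 1"
  shows "(INF E\<in>{E::'a set. compact E \<and> emeasure lebesgue E = ennreal m}. charged_energy \<alpha> Q E)
    = ennreal ((m / measure lebesgue (ball (0::'a) 1)) powr ((real DIM('a) - 1) / real DIM('a)))
      * perimeter (ball (0::'a) 1)"
proof -
  let ?n = "DIM('a)" and ?w = "unit_ball_vol (real DIM('a))"
  have w: "0 < ?w" by simp
  \<comment> \<open>The perimeter of a ball of volume \<open>m\<close>, whose radius is the root of
    \<open>m / ?w\<close>.\<close>
  define V where "V = ?n * ?w * root ?n (m / ?w) ^ (?n - 1)"
  have V0: "0 \<le> V" using \<open>m > 0\<close> w by (simp add: V_def)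
  have leb: "emeasure lebesgue E = emeasure lborel E" if "compact E" for E :: "'a set"
    using that by (simp add: compact_imp_closed borel_closed)
  have "(m / ?w) powr ((real ?n - 1) / real ?n) = root ?n (m / ?w) ^ (?n - 1)"
  proof -
    have "root ?n (m / ?w) ^ (?n - 1) = ((m / ?w) powr (1 / ?n)) powr (real (?n - 1))"
      using \<open>m > 0\<close> less_imp_neq[OF w, symmetric] by (subst powr_realpow) (auto simp: root_powr_inverse)
    also have "\<dots> = (m / ?w) powr ((real ?n - 1) / real ?n)"
      using assms(1) by (simp add: powr_powr of_nat_diff)
    finally show ?thesis by simp
  qed
  then have pw: "(m / measure lebesgue (ball (0::'a) 1)) powr ((real ?n - 1) / real ?n) = root ?n (m / ?w) ^ (?n - 1)"
    by (simp add: content_ball)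
  have rhs: "ennreal ((m / measure lebesgue (ball (0::'a) 1)) powr ((real ?n - 1) / real ?n)) * perimeter (ball (0::'a) 1) = ennreal V"
    unfolding pw perimeter_unit_ball V_def using \<open>m > 0\<close>
    by (subst ennreal_mult[symmetric]) (auto simp: mult.commute)
  show ?thesis
    unfolding rhs
  proof (rule antisym)
    show "ennreal V \<le> (INF E\<in>{E::'a set. compact E \<and> emeasure lebesgue E = ennreal m}. charged_energy \<alpha> Q E)"
    proof (rule INF_greatest)
      fix E :: "'a set" assume "E \<in> {E. compact E \<and> emeasure lebesgue E = ennreal m}"
      then have E: "compact E" and "emeasure lborel E = ennreal m" using leb by auto
      then have mE: "measure lborel E = m" using \<open>m > 0\<close> by (simp add: measure_def)
      \<comment> \<open>Taking the volume of the unit ball out of \<open>m\<close> supplies the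
        missing power of \<open>root ?n ?w\<close> and turns the isoperimetric bound into
        \<open>V\<close>.\<close>
      have "root ?n m = root ?n ?w * root ?n (m / ?w)"
        using less_imp_neq[OF w, symmetric] by (simp flip: real_root_mult)
      then have "?n * root ?n ?w * root ?n m ^ (?n - 1) = ?n * (root ?n ?w * root ?n ?w ^ (?n - 1)) * root ?n (m / ?w) ^ (?n - 1)"
        by (simp only: power_mult_distrib mult_ac)
      also have "root ?n ?w * root ?n ?w ^ (?n - 1) = ?w"
        by (rule root_mult_power_pred) auto
      finally have k: "?n * root ?n ?w * root ?n m ^ (?n - 1) = V" by (simp only: V_def)
      have "ennreal (?n * root ?n ?w * root ?n m ^ (?n - 1)) \<le> perimeter E"
        using isoperimetric_inequality[OF E] \<open>m > 0\<close> by (simp add: mE)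
      then have "ennreal V \<le> perimeter E" unfolding k .
      then show "ennreal V \<le> charged_energy \<alpha> Q E"
        unfolding charged_energy_def by (rule add_increasing2[rotated]) simp
    qed
    show "(INF E\<in>{E::'a set. compact E \<and> emeasure lebesgue E = ennreal m}. charged_energy \<alpha> Q E) \<le> ennreal V"
    proof (rule ennreal_le_epsilon)
      fix e :: real assume e: "0 < e"
      \<comment> \<open>The competitor exceeds \<open>V\<close> by at most \<delta> in perimeter and
        Q^2 \<delta> in energy, together exactly \<open>e\<close>.\<close>
      define \<delta> where "\<delta> = e / (1 + Q\<^sup>2)"
      have Q1: "0 < 1 + Q\<^sup>2" by (simp add: add_pos_nonneg)
      have \<delta>: "0 < \<delta>" using e Q1 by (simp add: \<delta>_def)
      obtain E :: "'a set" where E: "compact E" "emeasure lborel E = ennreal m"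
        and per: "perimeter E \<le> ennreal (V + \<delta>)" and en: "riesz_energy \<alpha> E \<le> ennreal \<delta>"
        using competitor_exists[OF assms(1,3-5) \<delta>] unfolding V_def by blast
      have "(INF E\<in>{E::'a set. compact E \<and> emeasure lebesgue E = ennreal m}. charged_energy \<alpha> Q E) \<le> charged_energy \<alpha> Q E"
        using E leb by (intro INF_lower) auto
      also have "\<dots> \<le> ennreal (V + \<delta>) + ennreal (Q\<^sup>2) * ennreal \<delta>"
        unfolding charged_energy_def using per en by (intro add_mono mult_left_mono) auto
      also have "\<dots> = ennreal (V + \<delta> + Q\<^sup>2 * \<delta>)"
        using V0 \<delta> by (simp add: ennreal_mult ennreal_plus)
      also have "V + \<delta> + Q\<^sup>2 * \<delta> = V + (1 + Q\<^sup>2) * \<delta>" by (simp add: algebra_simps)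
      also have "(1 + Q\<^sup>2) * \<delta> = e" using Q1 by (simp add: \<delta>_def)
      also have "ennreal (V + e) = ennreal V + ennreal e" using V0 e by simp
      finally show "(INF E\<in>{E::'a set. compact E \<and> emeasure lebesgue E = ennreal m}. charged_energy \<alpha> Q E) \<le> ennreal V + ennreal e" .
    qed
  qed
qed

end
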